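(* Assume that a unitary representation of $L^0(\lambda,\mathbb{T})$ is the Koopman representation associated with an ergodic boolean action of $L^0(\lambda,\mathbb{T})$, and let $(\mu_x)_{x\in\mathbb{N}[\mathbb{Z}^\times]}$ be the measures associated with this representation. Then, for all $\ell_1,\dots,\ell_p\in\{-1,1\}$ and $x_1,\dots,x_p,x\in\mathbb{N}[\mathbb{Z}^\times]$ with $$\ell_1x_1\oplus\cdots\oplus\ell_px_p=x,$$ we have $$\ell_1\mu_{x_1}\otimes\cdots\otimes\ell_p\mu_{x_p}\preceq\mu_x.$$
   Context: Conventions. $\mathbb{N}=\{1,2,\dots\}$, $\mathbb{Z}^\times=\mathbb{Z}\setminus\{0\}$, $\mathbb{T}$ is the circle group. $\lambda$ is the product measure on $2^{\mathbb{N}}=\{0,1\}^{\mathbb{N}}$ giving weight $1/2$ to each point of $\{0,1\}$. $L^0(\lambda,\mathbb{T})$ is the Polish group of $\lambda$-classes of measurable functions $2^{\mathbb{N}}\to\mathbb{T}$ with pointwise multiplication and convergence in measure. Unitary representations are continuous homomorphisms into the unitary group with the strong operator topology; Hilbert spaces are complex. $\mu\preceq\nu$ means $\mu$ is absolutely continuous with respect to $\nu$. Boolean actions. $\gamma$ is an atomless Borel probability measure on a standard Borel space $X$; $\mathrm{Aut}(\gamma)$ is the group of classes of measure preserving bijections of $(X,\gamma)$ with the weak topology (the weakest making $T\mapsto\gamma(T(A))$ continuous for Borel $A$). A boolean action of a Polish group $G$ on $(X,\gamma)$ is a continuous homomorphism $\zeta:G\to\mathrm{Aut}(\gamma)$;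 write $g\omega=\zeta(g)(\omega)$ (defined for almost every $\omega$). It is ergodic if each measurable $B$ with $\gamma(gB\,\triangle\, B)=0$ for all $g\in G$ has $\gamma(B)\in\{0,1\}$. The Koopman representation associated with a boolean action of $L^0(\lambda,\mathbb{T})$ is the unitary representation on $L^2(\gamma)$ given by $U_\phi(f)(\omega)=f(\phi^{-1}\omega)$. The semigroup $\mathbb{N}[\mathbb{Z}^\times]$. It is the set of all functions $x$ with nonempty finite domain $\mathrm{dom}(x)\subseteq\mathbb{Z}^\times$ and values in $\mathbb{N}$. $x\oplus y$ has domain $\mathrm{dom}(x)\cup\mathrm{dom}(y)$ and is the sum of $x$ and $y$, a function being treated as $0$ off its domain. For $\ell\in\mathbb{Z}^\times$, $\ell x$ has domain $\{\ell m\mid m\in\mathrm{dom}(x)\}$ and $(\ell x)(k)=x(k/\ell)$. Spaces $C_x$. $D(x)=\{(k,i)\mid k\in\mathrm{dom}(x),\,0\le i<x(k)\}$, $C_x=(2^{\mathbb{N}})^{D(x)}$, with projections $\pi_{k,i}:C_x\to2^{\mathbb{N}}$. A diagonal of $C_x$ is a set $\{\alpha\mid\pi_{k,i}(\alpha)=\pi_{k',i'}(\alpha)\}$ for distinct $(k,i),(k',i')\in D(x)$. A permutation $\delta$ of $D(x)$ is good if for each $(k,i)$, $\delta(k,i)=(k,j)$ for some $j$; it induces the good homeomorphism $\widetilde\delta$ of $C_x$ determined by $\pi_{\delta(k,i)}(\widetilde\delta(\alpha))=\pi_{k,i}(\alpha)$. Compatible measures. A finite Borel measure $\mu$ on $C_x$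 is compatible with $x$ if (a) each marginal $(\pi_{k,i})_*(\mu)$, $(k,i)\in D(x)$, is absolutely continuous with respect to $\lambda$; (b) $\mu$ is invariant under all good homeomorphisms of $C_x$; (c) all diagonals of $C_x$ have $\mu$-measure zero. Operations on measures. Let $\mu,\nu$ be compatible with $x,y$. Let $\bar\iota=(\iota^x,\iota^y)$ range over pairs of injections $\iota^x:D(x)\to D(x\oplus y)$, $\iota^y:D(y)\to D(x\oplus y)$ with disjoint images that preserve first coordinates ($\iota^x(k,i)=(k,j)$ for some $j$, and similarly for $\iota^y$). The homeomorphism $h_{\bar\iota}:C_x\times C_y\to C_{x\oplus y}$ is given by $\pi_{\iota^x(k,i)}(h_{\bar\iota}(\alpha,\beta))=\pi_{k,i}(\alpha)$ for $(k,i)\in D(x)$ and $\pi_{\iota^y(k,i)}(h_{\bar\iota}(\alpha,\beta))=\pi_{k,i}(\beta)$ for $(k,i)\in D(y)$. Then $\mu\otimes\nu=\sum_{\bar\iota}(h_{\bar\iota})_*(\mu\times\nu)$, a measure compatible with $x\oplus y$; $\otimes$ is associative and commutative. For $\ell\in\mathbb{Z}^\times$, $\ell\mu=(e_{x,\ell})_*(\mu)$, where $e_{x,\ell}:C_x\to C_{\ell x}$ is the homeomorphism $e_{x,\ell}(\alpha)(k,i)=\alpha(k/\ell,i)$; $\ell\mu$ is compatible with $\ell x$. Basic representations. For $\phi\in L^0(\lambda,\mathbb{T})$ let $R_x(\phi)=\prod_{(k,i)\in D(x)}(\phi\circ\pi_{k,i})^k$. For $\mu$ compatible with $x$, $\widetilde{L^2}(\mu)$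 is the closed subspace of $L^2(\mu)$ of functions invariant under good homeomorphisms of $C_x$, and $\rho_x$ is the unitary representation of $L^0(\lambda,\mathbb{T})$ on it given by $\rho_x(\phi)(f)=R_x(\phi)f$. Measures associated with a representation (known theorem, may be assumed). Let $\xi$ be a unitary representation of $L^0(\lambda,\mathbb{T})$ on a separable Hilbert space $H$, and let $H_0$ be the orthogonal complement of the subspace of $\xi$-fixed vectors. There are finite Borel measures $(\mu^j_x)_{x\in\mathbb{N}[\mathbb{Z}^\times],\,j\in\mathbb{N}}$, with $\mu^j_x$ a measure on $C_x$ compatible with $x$ and $\mu^{j+1}_x\preceq\mu^j_x$, such that $\xi$ restricted to $H_0$ is isomorphic to the $\ell^2$-sum over $x$ and $j$ of the representations $\rho_x$ on $\widetilde{L^2}(\mu^j_x)$; the family is unique up to mutual absolute continuity of its entries. One writes $\mu_x=\mu^1_x$; these are the measures associated with $\xi$. *)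

theory Defs
  imports "HOL-Probability.Probability" "HOL-Algebra.Group" "HOL-Library.Poly_Mapping"
begin

section \<open>Almost-everywhere classes\<close>

text \<open>Elements of \<open>L\<^sup>0\<close>, \<open>L\<^sup>2\<close> and \<open>Aut(\<gamma>)\<close> are classes of functions modulo almost-everywhere
  equality.  A class is represented by the set of those members of \<open>S\<close> that belong to it.
  Pointwise operations on classes are given as the set of all functions that agree
  almost everywhere with the result of the operation on representatives.\<close>

definition ae_classes :: "'a measure \<Rightarrow> ('a \<Rightarrow> 'b) set \<Rightarrow> ('a \<Rightarrow> 'b) set set" where
  "ae_classes M S = (\<lambda>f. {g \<in> S. AE \<omega> in M. g \<omega> = f \<omega>}) ` S"


section \<open>The group \<open>L\<^sup>0(\<lambda>, \<bbbT>)\<close>\<close>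

definition lam :: "(nat \<Rightarrow> bool) measure" where
  "lam = (\<Pi>\<^sub>M n\<in>UNIV. measure_pmf (bernoulli_pmf (1/2)))"

definition circle_functions :: "((nat \<Rightarrow> bool) \<Rightarrow> complex) set" where
  "circle_functions = {f \<in> borel_measurable lam. \<forall>\<alpha>. cmod (f \<alpha>) = 1}"

type_synonym L0_elem = "((nat \<Rightarrow> bool) \<Rightarrow> complex) set"

definition L0 :: "L0_elem monoid" where
  "L0 = \<lparr>carrier = ae_classes lam circle_functions,
         mult = (\<lambda>A B. {h \<in> circle_functions. \<exists>f\<in>A. \<exists>g\<in>B. AE \<alpha> in lam. h \<alpha> = f \<alpha> * g \<alpha>}),
         one = {h \<in> circle_functions. AE \<alpha> in lam. h \<alpha> = 1}\<rparr>"

text \<open>Basic neighbourhoods for convergence in measure.\<close>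

definition L0_nhd :: "L0_elem \<Rightarrow> real \<Rightarrow> L0_elem set" where
  "L0_nhd A \<epsilon> = {B \<in> carrier L0. \<forall>f\<in>A. \<forall>g\<in>B.
      measure lam {\<alpha> \<in> space lam. dist (f \<alpha>) (g \<alpha>) > \<epsilon>} < \<epsilon>}"

definition L0_open :: "L0_elem set \<Rightarrow> bool" where
  "L0_open U \<longleftrightarrow> U \<subseteq> carrier L0 \<and> (\<forall>A\<in>U. \<exists>\<epsilon>>0. L0_nhd A \<epsilon> \<subseteq> U)"

definition L0_topology :: "L0_elem topology" where
  "L0_topology = topology L0_open"

lemma prob_space_lam: "prob_space lam"
  unfolding lam_def by (intro prob_space_PiM prob_space_measure_pmf)

lemma L0_nhd_mono:
  assumes "\<epsilon> \<le> \<epsilon>'" "A \<in> carrier L0"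
  shows "L0_nhd A \<epsilon> \<subseteq> L0_nhd A \<epsilon>'"
proof
  fix B assume B: "B \<in> L0_nhd A \<epsilon>"
  show "B \<in> L0_nhd A \<epsilon>'"
    unfolding L0_nhd_def
  proof (intro CollectI conjI ballI)
    show "B \<in> carrier L0" using B by (simp add: L0_nhd_def)
    fix f g assume f: "f \<in> A" and g: "g \<in> B"
    have m: "f \<in> borel_measurable lam" "g \<in> borel_measurable lam"
      using f g assms B by (auto simp: L0_nhd_def L0_def ae_classes_def circle_functions_def)
    have "measure lam {\<alpha> \<in> space lam. dist (f \<alpha>) (g \<alpha>) > \<epsilon>'}
       \<le> measure lam {\<alpha> \<in> space lam. dist (f \<alpha>) (g \<alpha>) > \<epsilon>}"
      using assms(1) m
      by (intro finite_measure.finite_measure_mono[OF prob_space.finite_measure[OF prob_space_lam]])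
         (auto intro!: borel_measurable_less)
    also have "\<dots> < \<epsilon>" using B f g by (auto simp: L0_nhd_def)
    finally show "measure lam {\<alpha> \<in> space lam. dist (f \<alpha>) (g \<alpha>) > \<epsilon>'} < \<epsilon>'"
      using assms by simp
  qed
qed

lemma istopology_L0_open: "istopology L0_open"
  unfolding istopology_def
proof (intro conjI allI impI)
  fix S T assume S: "L0_open S" and T: "L0_open T"
  show "L0_open (S \<inter> T)"
    unfolding L0_open_def
  proof (intro conjI ballI)
    show "S \<inter> T \<subseteq> carrier L0" using S by (auto simp: L0_open_def)
    fix A assume A: "A \<in> S \<inter> T"
    then have A0: "A \<in> carrier L0" using S by (auto simp: L0_open_def)
    obtain e1 e2 where "e1 > 0" "L0_nhd A e1 \<subseteq> S" "e2 > 0" "L0_nhd A e2 \<subseteq> T"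
      using A S T unfolding L0_open_def by blast
    then show "\<exists>\<epsilon>>0. L0_nhd A \<epsilon> \<subseteq> S \<inter> T"
      using L0_nhd_mono[OF _ A0, of "min e1 e2" e1] L0_nhd_mono[OF _ A0, of "min e1 e2" e2]
      by (intro exI[of _ "min e1 e2"]) auto
  qed
next
  fix K assume "\<forall>S\<in>K. L0_open S"
  then show "L0_open (\<Union>K)"
    unfolding L0_open_def by (meson Sup_le_iff Union_iff Union_upper order_trans)
qed

lemma openin_L0_topology: "openin L0_topology = L0_open"
  unfolding L0_topology_def by (simp add: istopology_L0_open topology_inverse')

lemma topspace_L0_topology: "topspace L0_topology = carrier L0"
proof -
  have "L0_open (carrier L0)"
    unfolding L0_open_def L0_nhd_def by (auto intro: exI[of _ 1])
  then show ?thesis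
    unfolding topspace_def openin_L0_topology by (auto simp: L0_open_def)
qed

definition L0_class :: "((nat \<Rightarrow> bool) \<Rightarrow> complex) \<Rightarrow> L0_elem" where
  "L0_class f = {g \<in> circle_functions. AE \<alpha> in lam. g \<alpha> = f \<alpha>}"

lemma carrier_L0: "carrier L0 = L0_class ` circle_functions"
  by (auto simp: L0_def ae_classes_def L0_class_def)

lemma one_L0: "\<one>\<^bsub>L0\<^esub> = L0_class (\<lambda>_. 1)" by (simp add: L0_def L0_class_def)

lemma circle_functions_mult:
  "f \<in> circle_functions \<Longrightarrow> g \<in> circle_functions \<Longrightarrow> (\<lambda>\<alpha>. f \<alpha> * g \<alpha>) \<in> circle_functions"
  by (auto simp: circle_functions_def norm_mult)

lemma circle_functions_inverse:
  "f \<in> circle_functions \<Longrightarrow> (\<lambda>\<alpha>. inverse (f \<alpha>)) \<in> circle_functions"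
  by (auto simp: circle_functions_def norm_inverse)

lemma circle_functions_one: "(\<lambda>\<alpha>. 1) \<in> circle_functions"
  by (auto simp: circle_functions_def)

lemma mult_L0:
  assumes "f \<in> circle_functions" "g \<in> circle_functions"
  shows "L0_class f \<otimes>\<^bsub>L0\<^esub> L0_class g = L0_class (\<lambda>\<alpha>. f \<alpha> * g \<alpha>)"
proof -
  have "h \<in> L0_class f \<otimes>\<^bsub>L0\<^esub> L0_class g \<longleftrightarrow> h \<in> L0_class (\<lambda>\<alpha>. f \<alpha> * g \<alpha>)" for h
  proof
    assume "h \<in> L0_class f \<otimes>\<^bsub>L0\<^esub> L0_class g"
    then obtain u v where h: "h \<in> circle_functions"
       and "AE \<alpha> in lam. u \<alpha> = f \<alpha>" "AE \<alpha> in lam. v \<alpha> = g \<alpha>" 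
       "AE \<alpha> in lam. h \<alpha> = u \<alpha> * v \<alpha>"
      by (auto simp: L0_def L0_class_def)
    from this(2-) have "AE \<alpha> in lam. h \<alpha> = f \<alpha> * g \<alpha>" by eventually_elim simp
    with h show "h \<in> L0_class (\<lambda>\<alpha>. f \<alpha> * g \<alpha>)" by (simp add: L0_class_def)
  next
    assume h: "h \<in> L0_class (\<lambda>\<alpha>. f \<alpha> * g \<alpha>)"
    have "f \<in> L0_class f" "g \<in> L0_class g" using assms by (auto simp: L0_class_def)
    with h show "h \<in> L0_class f \<otimes>\<^bsub>L0\<^esub> L0_class g"
      by (auto simp: L0_def L0_class_def)
  qed
  then show ?thesis by blast
qed

lemma comm_group_L0: "comm_group L0"
proof (rule comm_groupI)
  fix x assume "x \<in> carrier L0"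
  then obtain f where f: "f \<in> circle_functions" "x = L0_class f" by (auto simp: carrier_L0)
  have [simp]: "inverse (f \<alpha>) * f \<alpha> = 1" for \<alpha>
  proof -
    have "cmod (f \<alpha>) = 1" using f by (simp add: circle_functions_def)
    then have "f \<alpha> \<noteq> 0" by force
    then show ?thesis by simp
  qed
  have "L0_class (\<lambda>\<alpha>. inverse (f \<alpha>)) \<otimes>\<^bsub>L0\<^esub> x = \<one>\<^bsub>L0\<^esub>"
    using f circle_functions_inverse by (simp add: mult_L0 one_L0)
  then show "\<exists>y\<in>carrier L0. y \<otimes>\<^bsub>L0\<^esub> x = \<one>\<^bsub>L0\<^esub>"
    using circle_functions_inverse[OF f(1)] by (auto simp: carrier_L0)
qed (auto simp: carrier_L0 one_L0 mult_L0 circle_functions_mult circle_functions_one mult_ac)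


section \<open>Boolean actions\<close>

definition standard_borel_space :: "'a measure \<Rightarrow> bool" where
  "standard_borel_space M \<longleftrightarrow>
     (\<exists>X. completely_metrizable_space X \<and> second_countable X \<and> topspace X = space M \<and>
          sets M = sigma_sets (space M) {U. openin X U})"

definition atomless :: "'a measure \<Rightarrow> bool" where
  "atomless M \<longleftrightarrow>
     (\<forall>A\<in>sets M. emeasure M A > 0 \<longrightarrow>
        (\<exists>B\<in>sets M. B \<subseteq> A \<and> 0 < emeasure M B \<and> emeasure M B < emeasure M A))"

definition measure_preserving_bijections :: "'a measure \<Rightarrow> ('a \<Rightarrow> 'a) set" where
  "measure_preserving_bijections \<gamma> =
     {t \<in> measurable \<gamma> \<gamma>. bij_betw t (space \<gamma>) (space \<gamma>) \<and>
        the_inv_into (space \<gamma>) t \<in> measurable \<gamma> \<gamma> \<and> distr \<gamma> \<gamma> t = \<gamma>}"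

definition Aut :: "'a measure \<Rightarrow> ('a \<Rightarrow> 'a) set monoid" where
  "Aut \<gamma> = \<lparr>carrier = ae_classes \<gamma> (measure_preserving_bijections \<gamma>),
     mult = (\<lambda>A B. {t \<in> measure_preserving_bijections \<gamma>.
                      \<exists>r\<in>A. \<exists>s\<in>B. AE \<omega> in \<gamma>. t \<omega> = r (s \<omega>)}),
     one = {t \<in> measure_preserving_bijections \<gamma>. AE \<omega> in \<gamma>. t \<omega> = \<omega>}\<rparr>"

text \<open>The weak topology is the weakest one for which \<open>T \<mapsto> T(A)\<close> is continuous, for each
  measurable \<open>A\<close>, as a map to the measure algebra of \<open>\<gamma>\<close> with the metric \<open>\<gamma>(A \<triangle> B)\<close>;
  equivalently, for which all \<open>T \<mapsto> \<gamma>(T(A) \<triangle> B)\<close> are continuous.  (The maps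
  \<open>T \<mapsto> \<gamma>(T(A))\<close> themselves are constant on \<open>Aut(\<gamma>)\<close>.)\<close>

definition weak_topology :: "'a measure \<Rightarrow> ('a \<Rightarrow> 'a) set topology" where
  "weak_topology \<gamma> = topology_generated_by
     {{T \<in> carrier (Aut \<gamma>). \<forall>t\<in>T. measure \<gamma> (sym_diff (t ` A) B) \<in> U} | A B U.
        A \<in> sets \<gamma> \<and> B \<in> sets \<gamma> \<and> open U}"

definition boolean_action :: "'a measure \<Rightarrow> (L0_elem \<Rightarrow> ('a \<Rightarrow> 'a) set) \<Rightarrow> bool" where
  "boolean_action \<gamma> \<zeta> \<longleftrightarrow>
     \<zeta> \<in> hom L0 (Aut \<gamma>) \<and> continuous_map L0_topology (weak_topology \<gamma>) \<zeta>"

definition ergodic_action :: "'a measure \<Rightarrow> (L0_elem \<Rightarrow> ('a \<Rightarrow> 'a) set) \<Rightarrow> bool" where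
  "ergodic_action \<gamma> \<zeta> \<longleftrightarrow>
     (\<forall>B\<in>sets \<gamma>. (\<forall>\<phi>\<in>carrier L0. \<forall>t\<in>\<zeta> \<phi>. measure \<gamma> (sym_diff (t ` B) B) = 0) \<longrightarrow>
        measure \<gamma> B \<in> {0, 1})"


section \<open>Hilbert spaces and unitary representations\<close>

record 'h hilbert =
  hcarrier :: "'h set"
  hadd :: "'h \<Rightarrow> 'h \<Rightarrow> 'h"
  hscale :: "complex \<Rightarrow> 'h \<Rightarrow> 'h"
  hinner :: "'h \<Rightarrow> 'h \<Rightarrow> complex"

definition hnorm :: "'h hilbert \<Rightarrow> 'h \<Rightarrow> real" where
  "hnorm H v = sqrt (Re (hinner H v v))"

definition hdist :: "'h hilbert \<Rightarrow> 'h \<Rightarrow> 'h \<Rightarrow> real" where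
  "hdist H v w = hnorm H (hadd H v (hscale H (-1) w))"

definition isometric_iso :: "'h hilbert \<Rightarrow> 'k hilbert \<Rightarrow> ('h \<Rightarrow> 'k) \<Rightarrow> bool" where
  "isometric_iso H K u \<longleftrightarrow>
     bij_betw u (hcarrier H) (hcarrier K) \<and>
     (\<forall>v\<in>hcarrier H. \<forall>w\<in>hcarrier H. u (hadd H v w) = hadd K (u v) (u w)) \<and>
     (\<forall>c. \<forall>v\<in>hcarrier H. u (hscale H c v) = hscale K c (u v)) \<and>
     (\<forall>v\<in>hcarrier H. \<forall>w\<in>hcarrier H. hinner K (u v) (u w) = hinner H v w)"

definition unitary_group :: "'h hilbert \<Rightarrow> ('h \<Rightarrow> 'h) monoid" where
  "unitary_group H = \<lparr>carrier = {u \<in> extensional (hcarrier H). isometric_iso H H u},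
     mult = (\<lambda>u v. compose (hcarrier H) u v), one = (\<lambda>v\<in>hcarrier H. v)\<rparr>"

definition strong_operator_topology :: "'h hilbert \<Rightarrow> ('h \<Rightarrow> 'h) topology" where
  "strong_operator_topology H = topology_generated_by
     {{u \<in> carrier (unitary_group H). hdist H (u v) w < \<epsilon>} | v w \<epsilon>.
        v \<in> hcarrier H \<and> w \<in> hcarrier H \<and> 0 < \<epsilon>}"

definition unitary_representation :: "'h hilbert \<Rightarrow> (L0_elem \<Rightarrow> 'h \<Rightarrow> 'h) \<Rightarrow> bool" where
  "unitary_representation H \<xi> \<longleftrightarrow>
     \<xi> \<in> hom L0 (unitary_group H) \<and>
     continuous_map L0_topology (strong_operator_topology H) \<xi>"

definition square_integrable :: "'a measure \<Rightarrow> ('a \<Rightarrow> complex) set" where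
  "square_integrable M = {f \<in> borel_measurable M. integrable M (\<lambda>\<omega>. (cmod (f \<omega>))\<^sup>2)}"

definition L2 :: "'a measure \<Rightarrow> ('a \<Rightarrow> complex) set hilbert" where
  "L2 M = \<lparr>hcarrier = ae_classes M (square_integrable M),
     hadd = (\<lambda>A B. {h \<in> square_integrable M. \<exists>f\<in>A. \<exists>g\<in>B. AE \<omega> in M. h \<omega> = f \<omega> + g \<omega>}),
     hscale = (\<lambda>c A. {h \<in> square_integrable M. \<exists>f\<in>A. AE \<omega> in M. h \<omega> = c * f \<omega>}),
     hinner = (\<lambda>A B. \<integral>\<omega>. (SOME f. f \<in> A) \<omega> * cnj ((SOME g. g \<in> B) \<omega>) \<partial>M)\<rparr>"

definition koopman ::
  "'a measure \<Rightarrow> (L0_elem \<Rightarrow> ('a \<Rightarrow> 'a) set) \<Rightarrow> L0_elem \<Rightarrow> ('a \<Rightarrow> complex) set \<Rightarrow> ('a \<Rightarrow> complex) set" where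
  "koopman \<gamma> \<zeta> \<phi> = (\<lambda>A\<in>hcarrier (L2 \<gamma>).
     {g \<in> square_integrable \<gamma>. \<exists>f\<in>A. \<exists>t\<in>\<zeta> (inv\<^bsub>L0\<^esub> \<phi>). AE \<omega> in \<gamma>. g \<omega> = f (t \<omega>)})"

definition nonfixed_part :: "'h hilbert \<Rightarrow> (L0_elem \<Rightarrow> 'h \<Rightarrow> 'h) \<Rightarrow> 'h hilbert" where
  "nonfixed_part H \<xi> = H\<lparr>hcarrier := {v \<in> hcarrier H.
     \<forall>w\<in>hcarrier H. (\<forall>\<phi>\<in>carrier L0. \<xi> \<phi> w = w) \<longrightarrow> hinner H v w = 0}\<rparr>"

definition hilbert_sum :: "'i set \<Rightarrow> ('i \<Rightarrow> 'h hilbert) \<Rightarrow> ('i \<Rightarrow> 'h) hilbert" where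
  "hilbert_sum I H = \<lparr>hcarrier = {F \<in> (\<Pi>\<^sub>E i\<in>I. hcarrier (H i)).
                                     (\<lambda>i. (hnorm (H i) (F i))\<^sup>2) summable_on I},
     hadd = (\<lambda>F G. \<lambda>i\<in>I. hadd (H i) (F i) (G i)),
     hscale = (\<lambda>c F. \<lambda>i\<in>I. hscale (H i) c (F i)),
     hinner = (\<lambda>F G. \<Sum>\<^sub>\<infinity>i\<in>I. hinner (H i) (F i) (G i))\<rparr>"

definition representation_sum ::
  "'i set \<Rightarrow> ('i \<Rightarrow> 'h hilbert) \<Rightarrow> ('i \<Rightarrow> L0_elem \<Rightarrow> 'h \<Rightarrow> 'h) \<Rightarrow> L0_elem \<Rightarrow> ('i \<Rightarrow> 'h) \<Rightarrow> 'i \<Rightarrow> 'h" where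
  "representation_sum I H \<eta> \<phi> = (\<lambda>F\<in>hcarrier (hilbert_sum I H). \<lambda>i\<in>I. \<eta> i \<phi> (F i))"

definition isomorphic_representations ::
  "'h hilbert \<Rightarrow> (L0_elem \<Rightarrow> 'h \<Rightarrow> 'h) \<Rightarrow> 'k hilbert \<Rightarrow> (L0_elem \<Rightarrow> 'k \<Rightarrow> 'k) \<Rightarrow> bool" where
  "isomorphic_representations H \<xi> K \<eta> \<longleftrightarrow>
     (\<exists>V. isometric_iso H K V \<and>
          (\<forall>\<phi>\<in>carrier L0. \<forall>v\<in>hcarrier H. V (\<xi> \<phi> v) = \<eta> \<phi> (V v)))"


section \<open>The semigroup \<open>\<nat>[\<int>\<^sup>\<times>]\<close> and the spaces \<open>C\<^sub>x\<close>\<close>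

text \<open>A function with finite domain \<open>dom(x) \<subseteq> \<int>\<^sup>\<times>\<close> and positive values is represented by its
  extension by \<open>0\<close>, so that \<open>dom(x)\<close> is \<open>keys x\<close> and \<open>\<oplus>\<close> is \<open>+\<close>.\<close>

type_synonym exponents = "int \<Rightarrow>\<^sub>0 nat"

definition NZ :: "exponents set" where
  "NZ = {x. Poly_Mapping.keys x \<noteq> {} \<and> 0 \<notin> Poly_Mapping.keys x}"

lift_definition dilate :: "int \<Rightarrow> exponents \<Rightarrow> exponents" is
  "\<lambda>l x k. if l dvd k then x (k div l) else 0"
proof -
  fix l :: int and x :: "int \<Rightarrow> nat"
  assume "finite {k. x k \<noteq> 0}"
  moreover have "{k. (if l dvd k then x (k div l) else 0) \<noteq> 0} \<subseteq> (\<lambda>m. l * m) ` {k. x k \<noteq> 0}"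
    by (auto split: if_splits)
  ultimately show "finite {k. (if l dvd k then x (k div l) else 0) \<noteq> 0}"
    by (meson finite_imageI finite_subset)
qed

definition D :: "exponents \<Rightarrow> (int \<times> nat) set" where
  "D x = {(k, i). k \<in> Poly_Mapping.keys x \<and> i < Poly_Mapping.lookup x k}"

type_synonym point = "int \<times> nat \<Rightarrow> nat \<Rightarrow> bool"

text \<open>Only the underlying measurable space of \<open>C x\<close> is used; its \<open>\<sigma>\<close>-algebra is the Borel one.\<close>

definition C :: "exponents \<Rightarrow> point measure" where
  "C x = (\<Pi>\<^sub>M p\<in>D x. lam)"

definition diagonal :: "exponents \<Rightarrow> int \<times> nat \<Rightarrow> int \<times> nat \<Rightarrow> point set" where
  "diagonal x p q = {\<alpha> \<in> space (C x). \<alpha> p = \<alpha> q}"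

definition good :: "exponents \<Rightarrow> (int \<times> nat \<Rightarrow> int \<times> nat) \<Rightarrow> bool" where
  "good x \<delta> \<longleftrightarrow> \<delta> permutes D x \<and> (\<forall>p\<in>D x. fst (\<delta> p) = fst p)"

definition good_homeo :: "exponents \<Rightarrow> (int \<times> nat \<Rightarrow> int \<times> nat) \<Rightarrow> point \<Rightarrow> point" where
  "good_homeo x \<delta> \<alpha> = (\<lambda>q\<in>D x. \<alpha> (inv_into UNIV \<delta> q))"

definition compatible :: "exponents \<Rightarrow> point measure \<Rightarrow> bool" where
  "compatible x \<mu> \<longleftrightarrow>
     finite_measure \<mu> \<and> sets \<mu> = sets (C x) \<and>
     (\<forall>p\<in>D x. absolutely_continuous lam (distr \<mu> lam (\<lambda>\<alpha>. \<alpha> p))) \<and>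
     (\<forall>\<delta>. good x \<delta> \<longrightarrow> distr \<mu> (C x) (good_homeo x \<delta>) = \<mu>) \<and>
     (\<forall>p\<in>D x. \<forall>q\<in>D x. p \<noteq> q \<longrightarrow> emeasure \<mu> (diagonal x p q) = 0)"


section \<open>Operations on measures\<close>

definition injection_pairs ::
  "exponents \<Rightarrow> exponents \<Rightarrow> ((int \<times> nat \<Rightarrow> int \<times> nat) \<times> (int \<times> nat \<Rightarrow> int \<times> nat)) set" where
  "injection_pairs x y = {(a, b). a \<in> D x \<rightarrow>\<^sub>E D (x + y) \<and> b \<in> D y \<rightarrow>\<^sub>E D (x + y) \<and>
     inj_on a (D x) \<and> inj_on b (D y) \<and> a ` D x \<inter> b ` D y = {} \<and>
     (\<forall>p\<in>D x. fst (a p) = fst p) \<and> (\<forall>p\<in>D y. fst (b p) = fst p)}"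

definition merge_points ::
  "exponents \<Rightarrow> exponents \<Rightarrow> (int \<times> nat \<Rightarrow> int \<times> nat) \<times> (int \<times> nat \<Rightarrow> int \<times> nat) \<Rightarrow>
   point \<times> point \<Rightarrow> point" where
  "merge_points x y = (\<lambda>(a, b) (\<alpha>, \<beta>). \<lambda>q\<in>D (x + y).
     if q \<in> a ` D x then \<alpha> (the_inv_into (D x) a q) else \<beta> (the_inv_into (D y) b q))"

definition tensor ::
  "exponents \<Rightarrow> exponents \<Rightarrow> point measure \<Rightarrow> point measure \<Rightarrow> point measure" where
  "tensor x y \<mu> \<nu> = measure_of (space (C (x + y))) (sets (C (x + y)))
     (\<lambda>B. \<Sum>\<iota>\<in>injection_pairs x y. emeasure (distr (\<mu> \<Otimes>\<^sub>M \<nu>) (C (x + y)) (merge_points x y \<iota>)) B)"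

lemma emeasure_tensor:
  assumes "B \<in> sets (C (x + y))"
  shows "emeasure (tensor x y \<mu> \<nu>) B =
    (\<Sum>\<iota>\<in>injection_pairs x y. emeasure (distr (\<mu> \<Otimes>\<^sub>M \<nu>) (C (x + y)) (merge_points x y \<iota>)) B)"
  unfolding tensor_def
proof (rule emeasure_measure_of_sigma)
  show "sigma_algebra (space (C (x + y))) (sets (C (x + y)))" by (rule sets.sigma_algebra_axioms)
  let ?m = "\<lambda>\<iota>. emeasure (distr (\<mu> \<Otimes>\<^sub>M \<nu>) (C (x + y)) (merge_points x y \<iota>))"
  show "positive (sets (C (x + y))) (\<lambda>B. \<Sum>\<iota>\<in>injection_pairs x y. ?m \<iota> B)"
    by (simp add: positive_def)
  show "countably_additive (sets (C (x + y))) (\<lambda>B. \<Sum>\<iota>\<in>injection_pairs x y. ?m \<iota> B)"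
    unfolding countably_additive_def
  proof (intro allI impI)
    fix A :: "nat \<Rightarrow> point set"
    assume A: "range A \<subseteq> sets (C (x + y))" "disjoint_family A"
    have "suminf (\<lambda>i. \<Sum>\<iota>\<in>injection_pairs x y. ?m \<iota> (A i)) = (\<Sum>\<iota>\<in>injection_pairs x y. suminf (\<lambda>i. ?m \<iota> (A i)))"
      by (rule suminf_sum) simp
    also have "\<dots> = (\<Sum>\<iota>\<in>injection_pairs x y. ?m \<iota> (\<Union>i. A i))"
      using A by (intro sum.cong refl suminf_emeasure) auto
    finally show "suminf (\<lambda>i. \<Sum>\<iota>\<in>injection_pairs x y. ?m \<iota> (A i)) = (\<Sum>\<iota>\<in>injection_pairs x y. ?m \<iota> (\<Union>i. A i))" .
  qed
qed (use assms in auto)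

definition dilate_measure :: "int \<Rightarrow> exponents \<Rightarrow> point measure \<Rightarrow> point measure" where
  "dilate_measure l x \<mu> =
     distr \<mu> (C (dilate l x)) (\<lambda>\<alpha>. \<lambda>(k, i)\<in>D (dilate l x). \<alpha> (k div l, i))"

text \<open>\<open>tensor_upto x \<mu> p\<close> is \<open>\<mu>\<^sub>1 \<otimes> \<dots> \<otimes> \<mu>\<^sub>p\<close>, bracketed to the left, for \<open>p \<ge> 1\<close> and measures
  \<open>\<mu>\<^sub>i\<close> compatible with \<open>x\<^sub>i\<close>; there is no empty product.\<close>

fun tensor_upto ::
  "(nat \<Rightarrow> exponents) \<Rightarrow> (nat \<Rightarrow> point measure) \<Rightarrow> nat \<Rightarrow> point measure" where
  "tensor_upto x \<mu> 0 = undefined"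
| "tensor_upto x \<mu> (Suc 0) = \<mu> 1"
| "tensor_upto x \<mu> (Suc (Suc n)) =
     tensor (\<Sum>i=1..Suc n. x i) (x (Suc (Suc n))) (tensor_upto x \<mu> (Suc n)) (\<mu> (Suc (Suc n)))"


section \<open>Basic representations and associated measures\<close>

definition R :: "exponents \<Rightarrow> ((nat \<Rightarrow> bool) \<Rightarrow> complex) \<Rightarrow> point \<Rightarrow> complex" where
  "R x f \<alpha> = (\<Prod>(k, i)\<in>D x. f (\<alpha> (k, i)) powi k)"

definition L2_symmetric :: "exponents \<Rightarrow> point measure \<Rightarrow> (point \<Rightarrow> complex) set hilbert" where
  "L2_symmetric x \<mu> = (L2 \<mu>)\<lparr>hcarrier := {A \<in> hcarrier (L2 \<mu>).
     \<forall>\<delta>. good x \<delta> \<longrightarrow> (\<forall>f\<in>A. AE \<alpha> in \<mu>. f (good_homeo x \<delta> \<alpha>) = f \<alpha>)}\<rparr>"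

definition basic_representation ::
  "exponents \<Rightarrow> point measure \<Rightarrow> L0_elem \<Rightarrow> (point \<Rightarrow> complex) set \<Rightarrow> (point \<Rightarrow> complex) set" where
  "basic_representation x \<mu> \<phi> = (\<lambda>A\<in>hcarrier (L2_symmetric x \<mu>).
     {g \<in> square_integrable \<mu>. \<exists>u\<in>\<phi>. \<exists>f\<in>A. AE \<alpha> in \<mu>. g \<alpha> = R x u \<alpha> * f \<alpha>})"

definition associated_family ::
  "'h hilbert \<Rightarrow> (L0_elem \<Rightarrow> 'h \<Rightarrow> 'h) \<Rightarrow> (exponents \<Rightarrow> nat \<Rightarrow> point measure) \<Rightarrow> bool" where
  "associated_family H \<xi> M \<longleftrightarrow>
     (\<forall>x\<in>NZ. \<forall>j\<ge>1. compatible x (M x j) \<and> absolutely_continuous (M x j) (M x (Suc j))) \<and>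
     isomorphic_representations
       (nonfixed_part H \<xi>) \<xi>
       (hilbert_sum (NZ \<times> {1..}) (\<lambda>(x, j). L2_symmetric x (M x j)))
       (representation_sum (NZ \<times> {1..}) (\<lambda>(x, j). L2_symmetric x (M x j))
          (\<lambda>(x, j). basic_representation x (M x j)))"

definition associated_measures ::
  "'h hilbert \<Rightarrow> (L0_elem \<Rightarrow> 'h \<Rightarrow> 'h) \<Rightarrow> (exponents \<Rightarrow> point measure) \<Rightarrow> bool" where
  "associated_measures H \<xi> \<mu> \<longleftrightarrow>
     (\<exists>M. associated_family H \<xi> M \<and> (\<forall>x\<in>NZ. \<mu> x = M x 1))"

end

theory Submission
  imports Defs "HOL-Library.Real_Mod"
begin

text \<open>Split \<open>2\<^sup>\<nat>\<close> into a set \<open>A\<close> and its complement.  The vectors \<open>f\<close> and \<open>g\<close> of \<open>L\<^sup>2(\<gamma>)\<close> that correspond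
  to the indicators of \<open>A\<^bsup>D(x)\<^esup>\<close> in \<open>L\<^sup>2(\<mu>\<^sub>x)\<close> and of \<open>(-A)\<^bsup>D(y)\<^esup>\<close> in \<open>L\<^sup>2(\<mu>\<^sub>y)\<close> are fixed by the
  functions supported on \<open>-A\<close> and on \<open>A\<close>, respectively.  These two groups commute and generate
  \<open>L\<^sup>0(\<lambda>, \<bbbT>)\<close>, so ergodicity makes \<open>f\<close> and \<open>g\<close> independent, and the matrix coefficient of
  \<open>f g\<close> is the integral of \<open>R\<^bsub>x \<oplus> y\<^esub>\<close> against the part of \<open>\<mu>\<^sub>x \<times> \<mu>\<^sub>y\<close> on \<open>A\<^bsup>D(x)\<^esup> \<times> (-A)\<^bsup>D(y)\<^esup>\<close>.
  Countably many sets \<open>A\<close> suffice to separate almost all pairs of points.  Likewise the complex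
  conjugate of a vector of type \<open>\<mu>\<^sub>x\<close> has type \<open>-\<mu>\<^sub>x\<close>.

  It remains to see that a matrix coefficient equal to \<open>\<integral> R\<^sub>z d\<sigma>\<close> forces \<open>\<sigma> \<preceq> \<mu>\<^sub>z\<close>.  Expanding it in
  the basic representations expresses \<open>\<integral> R\<^sub>z d\<sigma>\<close> as a sum of integrals of the \<open>R\<^sub>w\<close>.  Averaging
  over roots of unity, linear combinations of the functions \<open>(w, \<alpha>) \<mapsto> R\<^sub>w(u)(\<alpha>)\<close> include all
  indicators of congruences modulo \<open>N\<close> on \<open>\<Sum>{k. \<alpha>(k, i) \<in> P}\<close>.  Refining the sets \<open>P\<close> and increasing
  \<open>N\<close> recovers off the diagonals \<open>w\<close> and, up to good permutations, \<open>\<alpha>\<close>.\<close>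

section \<open>Exponential polynomials on the spaces \<open>C\<^sub>w\<close>\<close>

text \<open>Exponents and multiplicities run over infinite sets, so no fixed modulus and no fixed
  partition decodes all points at once. Decoding holds only eventually, with a threshold depending
  on \<open>w\<close> and \<open>a\<close>; the limit is taken by dominated convergence, inside each
  integral and again in the sum over \<open>(w, j)\<close>. What the functions \<open>R z u\<close>
  see of a point is invariant under good permutations, whereas \<sigma> need not be. Hence \<sigma>
  is compared through its symmetrisation, which dominates it, and the invariance of
  \<open>M z 1\<close> makes this harmless. As every \<open>M z j\<close> is absolutely continuous
  with respect to \<open>M z 1\<close>, one density over \<open>M z 1\<close> collects all
  multiplicities.

  On the side of the action the obstacle is that a product of two vectors of
  \<open>L\<^sup>2(\<gamma>)\<close> need not be square integrable, and that its matrix coefficient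
  need not factorise. Both are repaired by independence, which is available only for vectors fixed
  by complementary subgroups; this forces the restriction to complementary boxes, and the whole
  product measure is regained by countably many splittings.\<close>

lemma space_lam [simp]: "space lam = UNIV"
  by (simp add: lam_def space_PiM)

lemma finite_D [simp, intro]: "finite (D x)"
proof -
  have "D x = Sigma (Poly_Mapping.keys x) (\<lambda>k. {..<Poly_Mapping.lookup x k})"
    by (auto simp: D_def)
  then show ?thesis by auto
qed

lemma measurable_C_component [measurable]: "q \<in> D w \<Longrightarrow> (\<lambda>a. a q) \<in> measurable (C w) lam"
  unfolding C_def by (rule measurable_component_singleton)

lemma borel_measurable_powi [measurable]:
  fixes f :: "'a \<Rightarrow> complex"
  assumes [measurable]: "f \<in> borel_measurable M"
  shows "(\<lambda>\<omega>. f \<omega> powi k) \<in> borel_measurable M"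
  by (cases "k \<ge> 0") (simp_all add: power_int_def)

lemma circle_functionsD [dest]:
  assumes "u \<in> circle_functions"
  shows "u \<in> borel_measurable lam" and "cmod (u \<beta>) = 1" and "u \<beta> \<noteq> 0"
proof -
  show "u \<in> borel_measurable lam" "cmod (u \<beta>) = 1"
    using assms by (auto simp: circle_functions_def)
  then show "u \<beta> \<noteq> 0" by force
qed

lemma R_alt: "R w u a = (\<Prod>q\<in>D w. u (a q) powi fst q)"
  by (simp add: R_def case_prod_unfold)

lemma norm_R: "u \<in> circle_functions \<Longrightarrow> cmod (R w u a) = 1"
  by (simp add: R_alt prod_norm[symmetric] norm_power_int circle_functionsD)

lemma R_mult: "R w u a * R w v a = R w (\<lambda>\<beta>. u \<beta> * v \<beta>) a"
  by (simp add: R_alt prod.distrib[symmetric] power_int_mult_distrib)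

lemma R_one [simp]: "R w (\<lambda>_. 1) = (\<lambda>_. 1)"
  by (simp add: R_alt fun_eq_iff)

lemma measurable_R [measurable]:
  assumes "u \<in> circle_functions"
  shows "R w u \<in> borel_measurable (C w)"
proof -
  have "(\<lambda>a. u (a q)) \<in> borel_measurable (C w)" if "q \<in> D w" for q
    using measurable_compose[OF measurable_C_component[OF that]] assms by blast
  then show ?thesis
    unfolding R_alt[abs_def] by (intro borel_measurable_prod borel_measurable_powi) auto
qed

text \<open>A matrix coefficient mixes all exponents, so one \<open>u\<close> acts on every
  \<open>w\<close> at once; therefore the elements are families indexed by \<open>w\<close>. As
  \<open>R w\<close> is multiplicative in \<open>u\<close>, this linear span is also closed under
  products, and the indicators in it form a Boolean algebra.\<close>

inductive_set R_span :: "(exponents \<Rightarrow> point \<Rightarrow> complex) set" where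
  R: "u \<in> circle_functions \<Longrightarrow> (\<lambda>w. R w u) \<in> R_span"
| scale: "G \<in> R_span \<Longrightarrow> (\<lambda>w a. c * G w a) \<in> R_span"
| add: "G \<in> R_span \<Longrightarrow> H \<in> R_span \<Longrightarrow> (\<lambda>w a. G w a + H w a) \<in> R_span"

lemma R_span_one: "(\<lambda>w a. 1) \<in> R_span"
  using R_span.R[OF circle_functions_one] by simp

lemma R_span_mult:
  assumes "G \<in> R_span" "H \<in> R_span"
  shows "(\<lambda>w a. G w a * H w a) \<in> R_span"
  using assms(1)
proof induction
  case (R u)
  show ?case using assms(2)
  proof induction
    case (R v)
    then show ?case
      using R_span.R[OF circle_functions_mult[OF \<open>u \<in> circle_functions\<close> R]]
      by (simp add: R_mult)
  next
    case (scale G c)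
    then show ?case using R_span.scale[of _ c] by (simp add: mult.left_commute)
  next
    case (add G H)
    then show ?case using R_span.add by (simp add: distrib_left)
  qed
next
  case (scale G c)
  then show ?case using R_span.scale[of _ c] by (simp add: mult.assoc)
next
  case (add G H)
  then show ?case using R_span.add by (simp add: distrib_right)
qed

lemma R_span_sum:
  assumes "finite K" "K \<noteq> {}" "\<And>k. k \<in> K \<Longrightarrow> G k \<in> R_span"
  shows "(\<lambda>w a. \<Sum>k\<in>K. G k w a) \<in> R_span"
  using assms by (induction K rule: finite_ne_induct) (auto intro: R_span.add)

text \<open>Uniformity in \<open>w\<close> is the point: a single constant times the summable masses
  of \<open>d\<close> will dominate the sum over all exponents.\<close>

lemma R_span_bounded: "G \<in> R_span \<Longrightarrow> \<exists>B. \<forall>w a. cmod (G w a) \<le> B"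
proof (induction rule: R_span.induct)
  case (R u)
  then show ?case by (intro exI[of _ 1]) (simp add: norm_R)
next
  case (scale G c)
  then obtain B where "\<forall>w a. cmod (G w a) \<le> B" by blast
  then show ?case by (intro exI[of _ "cmod c * B"]) (simp add: norm_mult mult_left_mono)
next
  case (add G H)
  then obtain B B' where "\<forall>w a. cmod (G w a) \<le> B" "\<forall>w a. cmod (H w a) \<le> B'" by blast
  then show ?case by (intro exI[of _ "B + B'"]) (meson norm_triangle_le add_mono)
qed

lemma R_span_measurable: "G \<in> R_span \<Longrightarrow> G w \<in> borel_measurable (C w)"
  by (induction rule: R_span.induct) (auto intro: measurable_R)

definition R_event :: "(exponents \<Rightarrow> point \<Rightarrow> bool) \<Rightarrow> bool" where
  "R_event E \<longleftrightarrow> (\<lambda>w a. of_bool (E w a)) \<in> R_span"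

lemma R_event_True: "R_event (\<lambda>w a. True)"
  by (simp add: R_event_def R_span_one)

lemma R_event_not: "R_event E \<Longrightarrow> R_event (\<lambda>w a. \<not> E w a)"
  using R_span.add[OF R_span_one R_span.scale[of "\<lambda>w a. of_bool (E w a)" "-1"]]
  by (simp add: R_event_def of_bool_not_iff)

lemma R_event_conj: "R_event E \<Longrightarrow> R_event F \<Longrightarrow> R_event (\<lambda>w a. E w a \<and> F w a)"
  using R_span_mult[of "\<lambda>w a. of_bool (E w a)" "\<lambda>w a. of_bool (F w a)"]
  by (simp add: R_event_def of_bool_conj)

lemma R_event_Ball:
  "finite K \<Longrightarrow> (\<And>k. k \<in> K \<Longrightarrow> R_event (E k)) \<Longrightarrow> R_event (\<lambda>w a. \<forall>k\<in>K. E k w a)"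
  by (induction K rule: finite_induct) (auto intro: R_event_conj R_event_True)

lemma R_event_Bex:
  "finite K \<Longrightarrow> (\<And>k. k \<in> K \<Longrightarrow> R_event (E k)) \<Longrightarrow> R_event (\<lambda>w a. \<exists>k\<in>K. E k w a)"
  using R_event_not[OF R_event_Ball[of K "\<lambda>k w a. \<not> E k w a"]] R_event_not by simp

section \<open>Counting events\<close>

text \<open>This is the total power of \<open>c\<close> that \<open>R w\<close> collects from the
  function equal to \<open>c\<close> on \<open>P\<close> and to \<open>1\<close> elsewhere.
  Exponents are added with their signs, so they may cancel.\<close>

definition counts :: "exponents \<Rightarrow> (nat \<Rightarrow> bool) set \<Rightarrow> point \<Rightarrow> int" where
  "counts w P a = (\<Sum>q\<in>{q \<in> D w. a q \<in> P}. fst q)"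

text \<open>Orthogonality of the characters of the cyclic group of order \<open>N\<close>: the terms
  are the powers of some \<open>r\<close> with \<open>r ^ N = 1\<close>, and their geometric sum
  vanishes unless \<open>r = 1\<close>.\<close>

lemma sum_cis_multiples:
  fixes j :: int
  assumes "N > 0"
  shows "(\<Sum>k<N. cis (2 * pi * (real k * of_int j) / real N)) = (if int N dvd j then of_nat N else 0)"
proof -
  define r where "r = cis (2 * pi * of_int j / real N)"
  have pw: "cis (2 * pi * (real k * of_int j) / real N) = r ^ k" for k
    unfolding r_def Complex.DeMoivre by (rule arg_cong[of _ _ cis]) simp
  have "r ^ N = cis (2 * pi * of_int j)"
    using assms by (simp add: r_def Complex.DeMoivre)
  then have rN: "r ^ N = 1"
    by (simp add: cis_multiple_2pi)
  have r1: "r = 1 \<longleftrightarrow> int N dvd j"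
  proof
    assume "r = 1"
    then obtain n where "2 * pi * of_int j / real N = of_int n * (2 * pi)"
      unfolding r_def cis_eq_1_iff by blast
    then have "real_of_int j = of_int n * real N"
      using assms by (simp add: field_simps)
    then have "j = n * int N" by (metis of_int_eq_iff of_int_mult of_int_of_nat_eq)
    then show "int N dvd j" by simp
  next
    assume "int N dvd j"
    then obtain n where "j = int N * n" by blast
    then have "2 * pi * of_int j / real N = of_int n * (2 * pi)" using assms by simp
    then show "r = 1" unfolding r_def cis_eq_1_iff by blast
  qed
  show ?thesis
  proof (cases "r = 1")
    case True
    then show ?thesis using r1 by (simp add: pw)
  next
    case False
    then have "(\<Sum>k<N. r ^ k) = 0" using rN by (simp add: geometric_sum)
    with False r1 show ?thesis by (simp add: pw)
  qed
qed

lemma power_int_sum: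
  fixes c :: complex
  assumes "c \<noteq> 0"
  shows "c powi sum f A = (\<Prod>q\<in>A. c powi f q)"
  by (induction A rule: infinite_finite_induct) (simp_all add: assms power_int_add)

lemma R_indicator_cis:
  "R w (\<lambda>\<beta>. if \<beta> \<in> P then cis c else 1) a = cis (c * of_int (counts w P a))"
proof -
  have "R w (\<lambda>\<beta>. if \<beta> \<in> P then cis c else 1) a
      = (\<Prod>q\<in>D w. if a q \<in> P then cis c powi fst q else 1)"
    unfolding R_alt by (intro prod.cong) auto
  also have "\<dots> = (\<Prod>q\<in>{q \<in> D w. a q \<in> P}. cis c powi fst q)"
    by (rule prod.inter_filter[symmetric]) simp
  also have "\<dots> = cis c powi counts w P a"
    unfolding counts_def by (simp add: power_int_sum cis_neq_zero)
  also have "\<dots> = cis (c * of_int (counts w P a))"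
    by (simp add: cis_power_int mult.commute)
  finally show ?thesis .
qed

text \<open>Fourier inversion on the integers modulo \<open>N\<close>. On \<open>P\<close> the
  function \<open>u k\<close> is the \<open>k\<close>-th power of an \<open>N\<close>-th root of
  unity, so \<open>R w (u k)\<close> is a character of \<open>counts w P a\<close>; the factor
  containing \<open>m\<close> shifts it, and the average over \<open>k\<close> is the
  indicator.\<close>

lemma R_event_counts:
  assumes "P \<in> sets lam" "N > 0"
  shows "R_event (\<lambda>w a. int N dvd counts w P a - m)"
proof -
  define u where "u k = (\<lambda>\<beta>. if \<beta> \<in> P then cis (2 * pi * real k / real N) else 1)" for k
  have u: "u k \<in> circle_functions" for k
    using assms(1) unfolding circle_functions_def u_def by (auto intro!: measurable_If_set)
  have "(\<lambda>w a. (1 / of_nat N) * (\<Sum>k<N. cis (- (2 * pi * real k * of_int m / real N)) * R w (u k) a)) \<in> R_span"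
    using assms u by (intro R_span.scale R_span_sum R_span.R) auto
  also have "(\<lambda>w a. (1 / of_nat N) * (\<Sum>k<N. cis (- (2 * pi * real k * of_int m / real N)) * R w (u k) a))
     = (\<lambda>w a. of_bool (int N dvd counts w P a - m))" (is "?L = ?R")
  proof (intro ext)
    fix w a
    have "cis (- (2 * pi * real k * of_int m / real N)) * R w (u k) a
        = cis (2 * pi * (real k * of_int (counts w P a - m)) / real N)" for k
      unfolding u_def R_indicator_cis cis_mult using assms
      by (intro arg_cong[of _ _ cis]) (simp add: field_simps)
    then show "?L w a = ?R w a"
      using assms by (simp only: sum_cis_multiples) auto
  qed
  finally show ?thesis by (simp add: R_event_def)
qed

section \<open>Dyadic cells and the detection of single coordinates\<close>

definition cell :: "nat \<Rightarrow> bool list \<Rightarrow> (nat \<Rightarrow> bool) set" where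
  "cell n s = {\<beta>. map \<beta> [0..<n] = s}"

lemma measurable_map_upt [measurable]:
  "(\<lambda>\<beta>. map \<beta> [0..<n]) \<in> measurable lam (count_space UNIV)"
proof (induction n)
  case (Suc n)
  have "(\<lambda>\<beta>. \<beta> n) \<in> measurable lam (count_space UNIV)"
    unfolding lam_def
    using measurable_component_singleton[of n UNIV "\<lambda>_. measure_pmf (bernoulli_pmf (1 / 2))"]
    by (simp cong: measurable_cong_sets)
  then have "(\<lambda>\<beta>. (map \<beta> [0..<n], \<beta> n)) \<in> measurable lam (count_space UNIV \<Otimes>\<^sub>M count_space UNIV)"
    using Suc by (intro measurable_Pair)
  then have "(\<lambda>\<beta>. (\<lambda>(l, b). l @ [b]) (map \<beta> [0..<n], \<beta> n)) \<in> measurable lam (count_space UNIV)"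
    by (rule measurable_compose) (simp add: pair_measure_countable)
  then show ?case by simp
qed simp

lemma sets_cell [measurable]: "cell n s \<in> sets lam"
proof -
  have "(\<lambda>\<beta>. map \<beta> [0..<n]) -` {s} \<inter> space lam \<in> sets lam"
    by (rule measurable_sets[OF measurable_map_upt]) simp
  then show ?thesis by (simp add: cell_def vimage_def)
qed

lemma eventually_cell_separates:
  fixes A :: "(nat \<Rightarrow> bool) set"
  assumes "finite A"
  shows "\<forall>\<^sub>F n in sequentially. \<forall>\<beta>\<in>A. \<forall>\<beta>'\<in>A. map \<beta> [0..<n] = map \<beta>' [0..<n] \<longrightarrow> \<beta> = \<beta>'"
proof (intro eventually_ball_finite assms ballI)
  fix \<beta> \<beta>' :: "nat \<Rightarrow> bool"
  show "\<forall>\<^sub>F n in sequentially. map \<beta> [0..<n] = map \<beta>' [0..<n] \<longrightarrow> \<beta> = \<beta>'"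
  proof (cases "\<beta> = \<beta>'")
    case False
    then obtain m where "\<beta> m \<noteq> \<beta>' m" by blast
    then have "map \<beta> [0..<n] \<noteq> map \<beta>' [0..<n]" if "n \<ge> Suc m" for n
      using that by (auto simp: map_eq_conv)
    then show ?thesis by (intro eventually_sequentiallyI[of "Suc m"]) blast
  qed simp
qed

text \<open>For fine cells this says that \<open>U\<close> contains exactly one coordinate and that
  its exponent is \<open>k\<close>. A congruence for \<open>U\<close> alone would also admit several
  coordinates whose exponents add up to \<open>k\<close>; cell by cell, nothing can cancel. Level
  and modulus share \<open>n\<close>, so that one limit refines both, and the modulus
  \<open>Suc n\<close> is positive even for \<open>n = 0\<close>.\<close>

definition single_event :: "nat \<Rightarrow> (nat \<Rightarrow> bool) set \<Rightarrow> int \<Rightarrow> exponents \<Rightarrow> point \<Rightarrow> bool" where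
  "single_event n U k w a \<longleftrightarrow> (\<exists>s\<in>{s. length s = n}. \<forall>s'\<in>{s. length s = n}.
     int (Suc n) dvd counts w (U \<inter> cell n s') a - (if s' = s then k else 0))"

text \<open>The idle \<open>- 0\<close> gives the congruence the shape of
  \<open>R_event_counts\<close>.\<close>

definition empty_event :: "nat \<Rightarrow> (nat \<Rightarrow> bool) set \<Rightarrow> exponents \<Rightarrow> point \<Rightarrow> bool" where
  "empty_event n U w a \<longleftrightarrow>
     (\<forall>s\<in>{s. length s = n}. int (Suc n) dvd counts w (U \<inter> cell n s) a - 0)"

lemma finite_bool_lists: "finite {s :: bool list. length s = n}"
  using finite_lists_length_eq[of "UNIV :: bool set" n] by simp

lemma R_event_single: "U \<in> sets lam \<Longrightarrow> R_event (single_event n U k)"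
  unfolding single_event_def[abs_def]
  by (intro R_event_Bex R_event_Ball finite_bool_lists R_event_counts) auto

lemma R_event_empty: "U \<in> sets lam \<Longrightarrow> R_event (empty_event n U)"
  unfolding empty_event_def[abs_def]
  by (intro R_event_Ball finite_bool_lists R_event_counts) auto

lemma NZ_D: "w \<in> NZ \<Longrightarrow> q \<in> D w \<Longrightarrow> fst q \<noteq> 0"
  by (auto simp: NZ_def D_def)

lemma dvd_small: "int (Suc n) dvd k \<Longrightarrow> \<bar>k\<bar> \<le> int n \<Longrightarrow> k = 0"
  using dvd_imp_le_int[of k "int (Suc n)"] by fastforce

text \<open>The factor \<open>2\<close> bounds the difference of two exponents by \<open>n\<close>,
  so that congruence modulo \<open>Suc n\<close> becomes equality.\<close>

definition separating :: "exponents \<Rightarrow> point \<Rightarrow> nat \<Rightarrow> bool" where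
  "separating w a n \<longleftrightarrow> (\<forall>q\<in>D w. \<forall>q'\<in>D w. map (a q) [0..<n] = map (a q') [0..<n] \<longrightarrow> q = q') \<and>
     (\<forall>q\<in>D w. 2 * \<bar>fst q\<bar> \<le> int n)"

lemma eventually_separating:
  assumes "inj_on a (D w)"
  shows "\<forall>\<^sub>F n in sequentially. separating w a n"
proof -
  have "\<forall>\<^sub>F n in sequentially. \<forall>q\<in>D w. 2 * \<bar>fst q\<bar> \<le> int n"
  proof (intro eventually_ball_finite finite_D ballI)
    fix q :: "int \<times> nat"
    show "\<forall>\<^sub>F n in sequentially. 2 * \<bar>fst q\<bar> \<le> int n"
      by (rule eventually_sequentiallyI[of "nat (2 * \<bar>fst q\<bar>)"]) linarith
  qed
  with eventually_cell_separates[OF finite_imageI[OF finite_D[of w], of a]]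
  show ?thesis
    by eventually_elim (use assms in \<open>auto simp: separating_def dest: inj_onD\<close>)
qed

lemma counts_singleton:
  assumes "separating w a n" "q \<in> D w" "a q \<in> U"
  shows "counts w (U \<inter> cell n (map (a q) [0..<n])) a = fst q"
proof -
  have "{q' \<in> D w. a q' \<in> U \<inter> cell n (map (a q) [0..<n])} = {q}"
    using assms by (auto simp: separating_def cell_def)
  then show ?thesis by (simp add: counts_def)
qed

lemma counts_empty: "(\<And>q. q \<in> D w \<Longrightarrow> a q \<notin> P) \<Longrightarrow> counts w P a = 0"
  unfolding counts_def by (intro sum.neutral) auto

text \<open>Under separation a cell contains at most one coordinate, so each congruence reads off
  one exponent. Membership in \<open>NZ\<close> matters because a coordinate of exponent
  \<open>0\<close> would be invisible to \<open>counts\<close>.\<close>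

lemma single_event_iff:
  assumes sep: "separating w a n" and w: "w \<in> NZ" and k: "k \<noteq> 0" "2 * \<bar>k\<bar> \<le> int n"
  shows "single_event n U k w a \<longleftrightarrow>
    (\<exists>q\<in>D w. a q \<in> U \<and> fst q = k \<and> (\<forall>q'\<in>D w. a q' \<in> U \<longrightarrow> q' = q))"
proof
  assume "single_event n U k w a"
  then obtain s where s: "length s = n"
    "\<And>s'. length s' = n \<Longrightarrow> int (Suc n) dvd counts w (U \<inter> cell n s') a - (if s' = s then k else 0)"
    unfolding single_event_def by blast
  have sk: "int (Suc n) dvd counts w (U \<inter> cell n s) a - k"
    using s(2)[OF s(1)] by simp
  \<comment> \<open>If the cell were empty, \<open>Suc n\<close> would divide the nonzero and
    smaller number \<open>k\<close>.\<close>
  have "\<exists>q\<in>D w. a q \<in> U \<inter> cell n s"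
  proof (rule ccontr)
    assume "\<not> ?thesis"
    then have "counts w (U \<inter> cell n s) a = 0" by (intro counts_empty) blast
    then show False using sk k dvd_small[of n k] by simp
  qed
  then obtain q where q: "q \<in> D w" "a q \<in> U" "s = map (a q) [0..<n]" by (auto simp: cell_def)
  have "fst q - k = 0"
    using sk counts_singleton[OF sep q(1,2)] q(1) sep k
    by (intro dvd_small[of n]) (auto simp: q(3) separating_def)
  \<comment> \<open>Separation puts another \<open>q'\<close> into a different cell, where the count
    must vanish modulo \<open>Suc n\<close> although it is the small nonzero exponent of
    \<open>q'\<close>.\<close>
  moreover have "q' = q" if "q' \<in> D w" "a q' \<in> U" for q'
  proof (rule ccontr)
    assume "q' \<noteq> q"
    then have "map (a q') [0..<n] \<noteq> s" using sep q that unfolding separating_def by blast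
    then have "int (Suc n) dvd fst q'"
      using s(2)[of "map (a q') [0..<n]"] counts_singleton[OF sep that] by simp
    then have "fst q' = 0"
      using that(1) sep by (intro dvd_small[of n]) (auto simp: separating_def)
    then show False using NZ_D[OF w that(1)] by simp
  qed
  ultimately have "a q \<in> U \<and> fst q = k \<and> (\<forall>q'\<in>D w. a q' \<in> U \<longrightarrow> q' = q)"
    using q(2) by simp
  then show "\<exists>q\<in>D w. a q \<in> U \<and> fst q = k \<and> (\<forall>q'\<in>D w. a q' \<in> U \<longrightarrow> q' = q)"
    using q(1) by blast
next
  assume "\<exists>q\<in>D w. a q \<in> U \<and> fst q = k \<and> (\<forall>q'\<in>D w. a q' \<in> U \<longrightarrow> q' = q)"
  then obtain q where q: "q \<in> D w" "a q \<in> U" "fst q = k"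
    and uniq: "\<And>q'. q' \<in> D w \<Longrightarrow> a q' \<in> U \<Longrightarrow> q' = q" by blast
  have "counts w (U \<inter> cell n s') a = (if s' = map (a q) [0..<n] then k else 0)" for s'
    using counts_singleton[OF sep q(1,2)] uniq q(3)
    by (auto intro!: counts_empty simp: cell_def)
  then show "single_event n U k w a"
    unfolding single_event_def by (intro bexI[of _ "map (a q) [0..<n]"]) auto
qed

lemma empty_event_iff:
  assumes sep: "separating w a n" and w: "w \<in> NZ"
  shows "empty_event n U w a \<longleftrightarrow> (\<forall>q\<in>D w. a q \<notin> U)"
proof
  assume e: "empty_event n U w a"
  show "\<forall>q\<in>D w. a q \<notin> U"
  proof (intro ballI notI)
    fix q assume q: "q \<in> D w" "a q \<in> U"
    have "int (Suc n) dvd fst q"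
      using e[unfolded empty_event_def, rule_format, of "map (a q) [0..<n]"]
        counts_singleton[OF sep q] by simp
    then have "fst q = 0"
      using q(1) sep by (intro dvd_small[of n]) (auto simp: separating_def)
    then show False using NZ_D[OF w q(1)] by simp
  qed
qed (auto simp: empty_event_def counts_empty)

section \<open>Recognising an exponent, and a point up to good permutations\<close>

definition box_event :: "exponents \<Rightarrow> (int \<times> nat \<Rightarrow> (nat \<Rightarrow> bool) set) \<Rightarrow> nat \<Rightarrow> exponents \<Rightarrow> point \<Rightarrow> bool" where
  "box_event z V n w a \<longleftrightarrow> (\<forall>p\<in>D z. single_event n (V p) (fst p) w a) \<and>
     empty_event n (- (\<Union>p\<in>D z. V p)) w a"

lemma R_event_box:
  assumes "\<And>p. p \<in> D z \<Longrightarrow> V p \<in> sets lam"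
  shows "R_event (box_event z V n)"
proof -
  have "space lam - (\<Union>p\<in>D z. V p) \<in> sets lam"
    using assms by (intro sets.Diff sets.finite_UN sets.top) auto
  then show ?thesis
    using assms unfolding box_event_def[abs_def]
    by (intro R_event_conj R_event_Ball R_event_single R_event_empty) (auto simp: Compl_eq_Diff_UNIV)
qed

text \<open>This is the union of the images of the box with sides \<open>V p\<close> under good
  permutations; since the functions \<open>R z u\<close> are invariant under these, only such unions
  can be detected.\<close>

definition good_box :: "exponents \<Rightarrow> (int \<times> nat \<Rightarrow> (nat \<Rightarrow> bool) set) \<Rightarrow> point \<Rightarrow> bool" where
  "good_box z V a \<longleftrightarrow> (\<exists>d. good z d \<and> (\<forall>p\<in>D z. a (d p) \<in> V p))"

lemma lookup_eq_card: "Poly_Mapping.lookup w k = card {q \<in> D w. fst q = k}"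
proof -
  have "{q \<in> D w. fst q = k} = Pair k ` {..<Poly_Mapping.lookup w k}"
    by (auto simp: D_def image_def in_keys_iff)
  then show ?thesis by (simp add: card_image inj_on_def)
qed

text \<open>An exponent counts the coordinates lying over each \<open>k\<close>, and an
  exponent-preserving bijection keeps these numbers.\<close>

lemma exponents_eqI:
  assumes "bij_betw h (D z) (D w)" "\<And>p. p \<in> D z \<Longrightarrow> fst (h p) = fst p"
  shows "z = w"
proof (rule poly_mapping_eqI)
  fix k
  have "bij_betw h {q \<in> D z. fst q = k} {q \<in> D w. fst q = k}"
    unfolding bij_betw_def
  proof
    show "inj_on h {q \<in> D z. fst q = k}"
      using assms(1) by (auto simp: bij_betw_def inj_on_def)
    have "q \<in> h ` {q \<in> D z. fst q = k}" if "q \<in> D w" "fst q = k" for q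
    proof -
      from that assms(1) obtain p where "p \<in> D z" "q = h p" by (metis bij_betw_imp_surj_on imageE)
      with assms(2) that show ?thesis by auto
    qed
    moreover have "h p \<in> D w" if "p \<in> D z" for p
      using assms(1) that by (auto simp: bij_betw_def)
    ultimately show "h ` {q \<in> D z. fst q = k} = {q \<in> D w. fst q = k}"
      using assms(2) by auto
  qed
  then show "Poly_Mapping.lookup z k = Poly_Mapping.lookup w k"
    by (simp add: lookup_eq_card bij_betw_same_card)
qed

lemma goodD:
  assumes "good z d"
  shows "p \<in> D z \<Longrightarrow> d p \<in> D z" "p \<in> D z \<Longrightarrow> fst (d p) = fst p" "d permutes D z"
proof -
  show d: "d permutes D z" and "p \<in> D z \<Longrightarrow> fst (d p) = fst p"
    using assms unfolding good_def by blast+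
  show "d p \<in> D z" if "p \<in> D z"
    using permutes_in_image[OF d] that by blast
qed

lemma good_unique:
  assumes disj: "disjoint_family_on V (D z)" and a: "inj_on a (D z)"
    and d: "good z d" "\<And>p. p \<in> D z \<Longrightarrow> a (d p) \<in> V p"
    and e: "good z e" "\<And>p. p \<in> D z \<Longrightarrow> a (e p) \<in> V p"
  shows "d = e"
proof
  fix p
  show "d p = e p"
  proof (cases "p \<in> D z")
    case True
    then obtain p' where p': "p' \<in> D z" "e p' = d p"
      using goodD(1)[OF d(1)] permutes_image[OF goodD(3)[OF e(1)]] by (metis imageE)
    then have "a (d p) \<in> V p \<inter> V p'" using d(2)[OF True] e(2)[OF p'(1)] by auto
    then have "p = p'" using disj True p'(1) by (auto simp: disjoint_family_on_def)
    then show ?thesis using p' by simp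
  next
    case False
    then show ?thesis using goodD(3)[OF d(1)] goodD(3)[OF e(1)] by (simp add: permutes_not_in)
  qed
qed

text \<open>For fine cells the event sends each \<open>p\<close> to the unique coordinate in
  \<open>V p\<close>. This map preserves exponents, is injective because the \<open>V p\<close> are
  disjoint, and is onto because no coordinate lies outside their union; so \<open>w = z\<close> and
  the map is a good permutation. The threshold depends on \<open>a\<close>, whence the form of a
  pointwise limit.\<close>

lemma eventually_box_event:
  assumes w: "w \<in> NZ" and z: "z \<in> NZ" and a: "inj_on a (D w)"
    and disj: "disjoint_family_on V (D z)"
  shows "\<forall>\<^sub>F n in sequentially. box_event z V n w a \<longleftrightarrow> w = z \<and> good_box z V a"
proof -
  have "\<forall>\<^sub>F n in sequentially. \<forall>p\<in>D z. 2 * \<bar>fst p\<bar> \<le> int n"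
  proof (intro eventually_ball_finite finite_D ballI)
    fix p :: "int \<times> nat"
    show "\<forall>\<^sub>F n in sequentially. 2 * \<bar>fst p\<bar> \<le> int n"
      by (rule eventually_sequentiallyI[of "nat (2 * \<bar>fst p\<bar>)"]) linarith
  qed
  with eventually_separating[OF a] show ?thesis
  proof eventually_elim
    case (elim n)
    have *: "box_event z V n w a \<longleftrightarrow>
       (\<forall>p\<in>D z. \<exists>q\<in>D w. a q \<in> V p \<and> fst q = fst p \<and> (\<forall>q'\<in>D w. a q' \<in> V p \<longrightarrow> q' = q)) \<and>
       (\<forall>q\<in>D w. a q \<in> (\<Union>p\<in>D z. V p))"
    proof -
      have "single_event n (V p) (fst p) w a \<longleftrightarrow>
        (\<exists>q\<in>D w. a q \<in> V p \<and> fst q = fst p \<and> (\<forall>q'\<in>D w. a q' \<in> V p \<longrightarrow> q' = q))" if "p \<in> D z" for p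
        using single_event_iff[OF elim(1) w NZ_D[OF z that]] elim(2) that by blast
      then show ?thesis
        unfolding box_event_def empty_event_iff[OF elim(1) w] by blast
    qed
    show ?case
    proof
      assume "box_event z V n w a"
      then have sgl: "\<forall>p\<in>D z. \<exists>q. q \<in> D w \<and> a q \<in> V p \<and> fst q = fst p \<and> (\<forall>q'\<in>D w. a q' \<in> V p \<longrightarrow> q' = q)"
        and cov: "\<And>q. q \<in> D w \<Longrightarrow> \<exists>p\<in>D z. a q \<in> V p"
        unfolding * by blast+
      from bchoice[OF sgl] obtain h where
        hh: "\<forall>p\<in>D z. h p \<in> D w \<and> a (h p) \<in> V p \<and> fst (h p) = fst p \<and> (\<forall>q'\<in>D w. a q' \<in> V p \<longrightarrow> q' = h p)"
        by blast
      have h: "\<And>p. p \<in> D z \<Longrightarrow> h p \<in> D w" "\<And>p. p \<in> D z \<Longrightarrow> a (h p) \<in> V p"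
          "\<And>p. p \<in> D z \<Longrightarrow> fst (h p) = fst p"
          "\<And>p q'. p \<in> D z \<Longrightarrow> q' \<in> D w \<Longrightarrow> a q' \<in> V p \<Longrightarrow> q' = h p"
        using hh by blast+
      have "inj_on h (D z)"
      proof (rule inj_onI)
        fix p p' assume "p \<in> D z" "p' \<in> D z" "h p = h p'"
        then have "a (h p) \<in> V p \<inter> V p'" using h(2) by fastforce
        then show "p = p'" using disj \<open>p \<in> D z\<close> \<open>p' \<in> D z\<close>
          by (auto simp: disjoint_family_on_def)
      qed
      moreover have "h ` D z = D w" using h(1,4) cov by blast
      ultimately have bij: "bij_betw h (D z) (D w)" by (simp add: bij_betw_def)
      then have "z = w" using h(3) by (rule exponents_eqI)
      \<comment> \<open>\<open>permutes\<close> demands the identity outside \<open>D z\<close>,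
        where \<open>h\<close> is arbitrary.\<close>
      define d where "d p = (if p \<in> D z then h p else p)" for p
      have "bij_betw d (D z) (D z)"
        using bij unfolding \<open>z = w\<close>[symmetric]
        by (rule bij_betw_cong[THEN iffD1, rotated]) (simp add: d_def)
      then have "d permutes D z"
        by (rule bij_imp_permutes) (simp add: d_def)
      then have "good z d" using h(3) unfolding good_def by (auto simp only: d_def if_True)
      then show "w = z \<and> good_box z V a"
        using h(2) \<open>z = w\<close> by (auto simp: good_box_def d_def)
    next
      assume "w = z \<and> good_box z V a"
      then obtain d where d: "good z d" "\<And>p. p \<in> D z \<Longrightarrow> a (d p) \<in> V p" and "w = z"
        by (auto simp: good_box_def)
      have surj: "\<exists>p\<in>D z. q = d p" if "q \<in> D z" for q
        using permutes_image[OF goodD(3)[OF d(1)]] that by blast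
      have "q' = d p" if "p \<in> D z" "q' \<in> D z" "a q' \<in> V p" for p q'
      proof -
        from surj[OF that(2)] obtain p' where p': "p' \<in> D z" "q' = d p'" by blast
        then have "a q' \<in> V p \<inter> V p'" using d(2) that by blast
        then have "p = p'" using disj that(1) p'(1) by (auto simp: disjoint_family_on_def)
        then show ?thesis using p' by simp
      qed
      note uniq = this
      show "box_event z V n w a"
        unfolding * unfolding \<open>w = z\<close>
      proof (intro conjI ballI)
        fix p assume p: "p \<in> D z"
        show "\<exists>q\<in>D z. a q \<in> V p \<and> fst q = fst p \<and> (\<forall>q'\<in>D z. a q' \<in> V p \<longrightarrow> q' = q)"
          by (intro bexI[of _ "d p"] conjI ballI impI) (simp_all only: uniq[OF p] d(2)[OF p] goodD[OF d(1)] p)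
      next
        fix q assume "q \<in> D z"
        from surj[OF this] obtain p where "p \<in> D z" "q = d p" by blast
        then show "a q \<in> (\<Union>p\<in>D z. V p)" using d(2) by blast
      qed
    qed
  qed
qed

lemma finite_good: "finite {d. good z d}"
proof (rule finite_subset)
  show "{d. good z d} \<subseteq> {d. d permutes D z}"
    by (rule Collect_mono) (rule impI, rule goodD(3))
  show "finite {d. d permutes D z}"
    by (rule finite_permutations) (rule finite_D)
qed

text \<open>Disjoint sides and distinct coordinates leave at most one good permutation, by
  \<open>good_unique\<close>, so the union over permutations is counted without
  multiplicity.\<close>

lemma of_bool_good_box:
  assumes disj: "disjoint_family_on V (D z)" and a: "inj_on a (D z)"
  shows "of_bool (good_box z V a) = (\<Sum>d | good z d. of_bool (\<forall>p\<in>D z. a (d p) \<in> V p) :: 'b :: semiring_1)"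
proof (cases "good_box z V a")
  case True
  then obtain e where e: "good z e" "\<And>p. p \<in> D z \<Longrightarrow> a (e p) \<in> V p" unfolding good_box_def by blast
  have "(\<forall>p\<in>D z. a (d p) \<in> V p) = (d = e)" if "good z d" for d
  proof
    assume "\<forall>p\<in>D z. a (d p) \<in> V p"
    then have "\<And>p. p \<in> D z \<Longrightarrow> a (d p) \<in> V p" by blast
    from good_unique[OF disj a that this e] show "d = e" .
  next
    assume "d = e"
    show "\<forall>p\<in>D z. a (d p) \<in> V p"
      unfolding \<open>d = e\<close> by (rule ballI) (rule e(2))
  qed
  then have "(\<Sum>d | good z d. of_bool (\<forall>p\<in>D z. a (d p) \<in> V p) :: 'b)
      = (\<Sum>d | good z d. if d = e then 1 else 0)"
    unfolding of_bool_def by (intro sum.cong refl) (simp only: mem_Collect_eq)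
  also have "\<dots> = 1"
    by (subst sum.delta[OF finite_good]) (simp only: mem_Collect_eq e(1) if_True)
  finally show ?thesis using True by (simp only: of_bool_eq)
next
  case False
  then have "(\<Sum>d | good z d. of_bool (\<forall>p\<in>D z. a (d p) \<in> V p) :: 'b) = 0"
  proof (intro sum.neutral ballI)
    fix d assume "d \<in> {d. good z d}"
    then have "good z d" by (rule CollectD)
    have "\<not> (\<forall>p\<in>D z. a (d p) \<in> V p)"
    proof
      assume "\<forall>p\<in>D z. a (d p) \<in> V p"
      with \<open>good z d\<close> have "good_box z V a" unfolding good_box_def by (intro exI conjI)
      then show False using False by contradiction
    qed
    then show "of_bool (\<forall>p\<in>D z. a (d p) \<in> V p) = (0 :: 'b)"
      by (simp only: of_bool_eq_0_iff not_False_eq_True)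
  qed
  then show ?thesis using False by (simp only: of_bool_eq)
qed

text \<open>Dominated convergence for the counting measure on \<open>I\<close>; it exchanges the
  limit over refinements with the sum over all exponents and multiplicities.\<close>

lemma tendsto_infsum_dominated:
  fixes a :: "nat \<Rightarrow> 'i \<Rightarrow> complex"
  assumes g: "g summable_on I"
    and le: "\<And>n i. i \<in> I \<Longrightarrow> cmod (a n i) \<le> g i"
    and lim: "\<And>i. i \<in> I \<Longrightarrow> (\<lambda>n. a n i) \<longlonglongrightarrow> b i"
  shows "(\<lambda>n. infsum (a n) I) \<longlonglongrightarrow> infsum b I" and "b summable_on I"
proof -
  have g0: "g i \<ge> 0" if "i \<in> I" for i
    using le[OF that, of 0] norm_ge_zero by (meson order_trans)
  have bg: "cmod (b i) \<le> g i" if "i \<in> I" for i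
    using lim[OF that] le[OF that] by (intro tendsto_upperbound[OF tendsto_norm]) auto
  have s: "(\<lambda>i. cmod (a n i)) summable_on I" for n
    by (rule Infinite_Sum.abs_summable_on_comparison_test'[OF g]) (rule le)
  have sb: "(\<lambda>i. cmod (b i)) summable_on I"
    by (rule Infinite_Sum.abs_summable_on_comparison_test'[OF g]) (rule bg)
  then show "b summable_on I" by (rule abs_summable_summable)
  have "(\<lambda>i. norm (g i)) summable_on I"
    using g by (rule summable_on_cong[THEN iffD1, rotated]) (simp add: g0)
  then have gi: "integrable (count_space I) g"
    using abs_summable_equivalent[of g I] by (simp only: abs_summable_on_def)
  have conv: "infsum f I = integral\<^sup>L (count_space I) f" if "(\<lambda>i. cmod (f i)) summable_on I" for f :: "'i \<Rightarrow> complex"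
    using infsetsum_infsum[of f I] that
    by (simp add: infsetsum_def abs_summable_equivalent)
  have "(\<lambda>n. integral\<^sup>L (count_space I) (a n)) \<longlonglongrightarrow> integral\<^sup>L (count_space I) b"
    by (rule integral_dominated_convergence[OF _ _ gi]) (auto intro!: AE_I2 lim le)
  then show "(\<lambda>n. infsum (a n) I) \<longlonglongrightarrow> infsum b I"
    by (simp add: conv s sb)
qed

text \<open>Equality of two bit sequences is a countable conjunction of equalities of finite
  prefixes.\<close>

lemma sets_diagonal:
  assumes "p \<in> D w" "q \<in> D w"
  shows "diagonal w p q \<in> sets (C w)"
proof -
  have "a = b" if "\<And>n. map a [0..<n] = map b [0..<n]" for a b :: "nat \<Rightarrow> bool"
  proof
    fix n show "a n = b n" using that[of "Suc n"] by simp
  qed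
  then have "a p = a q \<longleftrightarrow> (\<forall>n. map (a p) [0..<n] = map (a q) [0..<n])" for a :: point
    by metis
  then have eq: "diagonal w p q = {a \<in> space (C w). \<forall>n. map (a p) [0..<n] = map (a q) [0..<n]}"
    unfolding diagonal_def by blast
  have [measurable]: "(\<lambda>a. map (a p) [0..<n]) \<in> measurable (C w) (count_space UNIV)"
    "(\<lambda>a. map (a q) [0..<n]) \<in> measurable (C w) (count_space UNIV)" for n
    using measurable_compose[OF measurable_C_component measurable_map_upt] assms by auto
  show ?thesis unfolding eq by measurable
qed

lemma sets_inj_on: "{a \<in> space (C w). inj_on a (D w)} \<in> sets (C w)"
proof -
  have "{a \<in> space (C w). inj_on a (D w)}
      = space (C w) - (\<Union>p\<in>D w. \<Union>q\<in>D w - {p}. diagonal w p q)"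
    by (auto simp: inj_on_def diagonal_def)
  also have "\<dots> \<in> sets (C w)"
    by (intro sets.Diff sets.top sets.finite_UN finite_D finite_Diff sets_diagonal) auto
  finally show ?thesis .
qed

lemma compatibleD:
  assumes "compatible w \<mu>"
  shows "finite_measure \<mu>" "sets \<mu> = sets (C w)" "space \<mu> = space (C w)"
    "AE a in \<mu>. inj_on a (D w)"
proof -
  have diag: "\<forall>p\<in>D w. \<forall>q\<in>D w. p \<noteq> q \<longrightarrow> emeasure \<mu> (diagonal w p q) = 0"
    using assms unfolding compatible_def by (elim conjE)
  show 1: "finite_measure \<mu>" and 2: "sets \<mu> = sets (C w)"
    using assms by (auto simp: compatible_def)
  show "space \<mu> = space (C w)" using 2 by (rule sets_eq_imp_space_eq)
  have "AE a in \<mu>. p \<noteq> q \<longrightarrow> a p \<noteq> a q" if "p \<in> D w" "q \<in> D w" for p q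
  proof (cases "p = q")
    case False
    then have "emeasure \<mu> (diagonal w p q) = 0"
      using diag that by blast
    moreover have "diagonal w p q \<in> sets \<mu>"
      using sets_diagonal[OF that] unfolding 2 .
    ultimately have "diagonal w p q \<in> null_sets \<mu>" by (rule null_setsI)
    then show ?thesis
      by (rule AE_I') (use \<open>space \<mu> = space (C w)\<close> in \<open>auto simp: diagonal_def\<close>)
  qed simp
  then have "AE a in \<mu>. \<forall>p\<in>D w. \<forall>q\<in>D w. p \<noteq> q \<longrightarrow> a p \<noteq> a q"
    by (intro AE_finite_allI finite_D) auto
  then show "AE a in \<mu>. inj_on a (D w)"
    by eventually_elim (auto simp: inj_on_def)
qed

lemma measurable_compatible:
  assumes "compatible w \<mu>" "f \<in> measurable (C w) N"
  shows "f \<in> measurable \<mu> N"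
  using assms(2) by (simp add: measurable_cong_sets[OF compatibleD(2)[OF assms(1)] refl])

section \<open>Symmetrisation over good permutations\<close>

definition permute_point :: "exponents \<Rightarrow> (int \<times> nat \<Rightarrow> int \<times> nat) \<Rightarrow> point \<Rightarrow> point" where
  "permute_point z d a = (\<lambda>p\<in>D z. a (d p))"

lemma measurable_permute_point:
  assumes "good z d"
  shows "permute_point z d \<in> measurable (C z) (C z)"
  unfolding permute_point_def C_def
  by (intro measurable_restrict measurable_component_singleton) (rule goodD(1)[OF assms])

lemma good_inv:
  assumes "good z d"
  shows "good z (inv_into UNIV d)"
proof -
  have p: "inv_into UNIV d permutes D z" by (rule permutes_inv[OF goodD(3)[OF assms]])
  have "fst (inv_into UNIV d q) = fst q" if "q \<in> D z" for q
    using goodD(2)[OF assms, of "inv_into UNIV d q"] permutes_in_image[OF p, of q] that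
      permutes_inverses(1)[OF goodD(3)[OF assms], of q] by metis
  then show ?thesis using p by (simp add: good_def)
qed

lemma good_homeo_eq: "good_homeo z d = permute_point z (inv_into UNIV d)"
  by (simp add: good_homeo_def permute_point_def fun_eq_iff)

lemma distr_permute_point:
  assumes "compatible z \<mu>" "good z d"
  shows "distr \<mu> (C z) (permute_point z d) = \<mu>"
proof -
  have "good_homeo z (inv_into UNIV d) = permute_point z d"
    by (simp add: good_homeo_eq permutes_inv_inv[OF goodD(3)[OF assms(2)]])
  then show ?thesis using assms good_inv[OF assms(2)] unfolding compatible_def by metis
qed

text \<open>The unnormalised sum of the images of \<sigma> under all good permutations. As a
  push-forward of a product with a counting measure it is countably additive without further
  proof.\<close>

definition sym_measure :: "exponents \<Rightarrow> point measure \<Rightarrow> point measure" where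
  "sym_measure z \<sigma> = distr (count_space {d. good z d} \<Otimes>\<^sub>M \<sigma>) (C z) (\<lambda>(d, a). permute_point z d a)"

lemma emeasure_sym_measure:
  assumes fin: "sigma_finite_measure \<sigma>" and \<sigma>: "sets \<sigma> = sets (C z)" and A: "A \<in> sets (C z)"
  shows "emeasure (sym_measure z \<sigma>) A = (\<Sum>d | good z d. emeasure \<sigma> (permute_point z d -` A \<inter> space (C z)))"
proof -
  interpret sigma_finite_measure \<sigma> by (rule fin)
  have sp: "space \<sigma> = space (C z)" using \<sigma> by (rule sets_eq_imp_space_eq)
  have m: "(\<lambda>(d, a). permute_point z d a) \<in> measurable (count_space {d. good z d} \<Otimes>\<^sub>M \<sigma>) (C z)"
    using measurable_permute_point
    by (intro measurable_pair_measure_countable1)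
       (auto simp: countable_finite[OF finite_good] measurable_cong_sets[OF \<sigma> refl])
  have "emeasure (sym_measure z \<sigma>) A = emeasure (count_space {d. good z d} \<Otimes>\<^sub>M \<sigma>)
      ((\<lambda>(d, a). permute_point z d a) -` A \<inter> space (count_space {d. good z d} \<Otimes>\<^sub>M \<sigma>))"
    unfolding sym_measure_def by (rule emeasure_distr[OF m A])
  also have "\<dots> = (\<integral>\<^sup>+d. emeasure \<sigma> (Pair d -` ((\<lambda>(d, a). permute_point z d a) -` A \<inter>
      space (count_space {d. good z d} \<Otimes>\<^sub>M \<sigma>))) \<partial>count_space {d. good z d})"
    by (rule emeasure_pair_measure_alt) (rule measurable_sets[OF m A])
  also have "\<dots> = (\<Sum>d | good z d. emeasure \<sigma> (Pair d -` ((\<lambda>(d, a). permute_point z d a) -` A \<inter>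
      space (count_space {d. good z d} \<Otimes>\<^sub>M \<sigma>))))"
    by (rule nn_integral_count_space_finite[OF finite_good])
  also have "\<dots> = (\<Sum>d | good z d. emeasure \<sigma> (permute_point z d -` A \<inter> space (C z)))"
    by (intro sum.cong refl arg_cong[of _ _ "emeasure \<sigma>"]) (auto simp: space_pair_measure sp)
  finally show ?thesis .
qed

lemma sets_sym_measure [simp]: "sets (sym_measure z \<sigma>) = sets (C z)"
  by (simp add: sym_measure_def)

abbreviation good_boxes :: "exponents \<Rightarrow> (int \<times> nat \<Rightarrow> (nat \<Rightarrow> bool) set) \<Rightarrow> point set" where
  "good_boxes z V \<equiv> {a \<in> space (C z). good_box z V a}"

lemma sets_good_box:
  assumes "\<And>p. p \<in> D z \<Longrightarrow> V p \<in> sets lam"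
  shows "good_boxes z V \<in> sets (C z)"
proof -
  have "(good_boxes z V)
      = (\<Union>d\<in>{d. good z d}. permute_point z d -` (Pi\<^sub>E (D z) V) \<inter> space (C z))"
    by (auto simp: good_box_def permute_point_def PiE_iff)
  also have "\<dots> \<in> sets (C z)"
  proof (intro sets.finite_UN finite_good)
    fix d assume "d \<in> {d. good z d}"
    moreover have "Pi\<^sub>E (D z) V \<in> sets (C z)"
      unfolding C_def using assms by (intro sets_PiM_I_finite) auto
    ultimately show "permute_point z d -` (Pi\<^sub>E (D z) V) \<inter> space (C z) \<in> sets (C z)"
      by (intro measurable_sets[OF measurable_permute_point]) auto
  qed
  finally show ?thesis .
qed

text \<open>Almost every point has distinct coordinates and so lies in at most one of the permuted
  boxes; hence the sum of their masses is the mass of their union. This expresses the symmetrised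
  mass of a box through sets that box events detect.\<close>

lemma emeasure_sym_measure_box:
  assumes fin: "sigma_finite_measure \<sigma>" and \<sigma>: "sets \<sigma> = sets (C z)"
    and V: "\<And>p. p \<in> D z \<Longrightarrow> V p \<in> sets lam" and disj: "disjoint_family_on V (D z)"
    and inj: "AE a in \<sigma>. inj_on a (D z)"
  shows "emeasure (sym_measure z \<sigma>) (Pi\<^sub>E (D z) V) = emeasure \<sigma> (good_boxes z V)"
proof -
  have sp: "space \<sigma> = space (C z)" using \<sigma> by (rule sets_eq_imp_space_eq)
  have B: "Pi\<^sub>E (D z) V \<in> sets (C z)"
    unfolding C_def using V by (intro sets_PiM_I_finite) auto
  have ms: "permute_point z d -` (Pi\<^sub>E (D z) V) \<inter> space (C z) \<in> sets \<sigma>" if "good z d" for d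
    using measurable_sets[OF measurable_permute_point[OF that] B] \<sigma> by simp
  have "emeasure (sym_measure z \<sigma>) (Pi\<^sub>E (D z) V)
      = (\<Sum>d | good z d. emeasure \<sigma> (permute_point z d -` (Pi\<^sub>E (D z) V) \<inter> space (C z)))"
    by (rule emeasure_sym_measure[OF fin \<sigma> B])
  also have "\<dots> = (\<Sum>d | good z d. \<integral>\<^sup>+a. indicator (permute_point z d -` (Pi\<^sub>E (D z) V) \<inter> space (C z)) a \<partial>\<sigma>)"
    using ms by (intro sum.cong refl) (simp add: nn_integral_indicator)
  also have "\<dots> = (\<integral>\<^sup>+a. (\<Sum>d | good z d. indicator (permute_point z d -` (Pi\<^sub>E (D z) V) \<inter> space (C z)) a) \<partial>\<sigma>)"
    using ms by (intro nn_integral_sum[symmetric]) simp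
  also have "\<dots> = (\<integral>\<^sup>+a. indicator (good_boxes z V) a \<partial>\<sigma>)"
  proof (rule nn_integral_cong_AE)
    show "AE a in \<sigma>. (\<Sum>d | good z d. indicator (permute_point z d -` (Pi\<^sub>E (D z) V) \<inter> space (C z)) a)
       = (indicator (good_boxes z V) a :: ennreal)"
      using inj AE_space
    proof eventually_elim
      case (elim a)
      then have "(\<Sum>d | good z d. indicator (permute_point z d -` (Pi\<^sub>E (D z) V) \<inter> space (C z)) a)
         = (\<Sum>d | good z d. of_bool (\<forall>p\<in>D z. a (d p) \<in> V p) :: ennreal)"
        by (intro sum.cong refl) (auto simp: indicator_def permute_point_def PiE_iff sp of_bool_def)
      then show ?case
        using of_bool_good_box[OF disj elim(1), where 'b = ennreal] elim(2)
        by (simp add: indicator_def sp of_bool_def)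
    qed
  qed
  also have "\<dots> = emeasure \<sigma> (good_boxes z V)"
    using sets_good_box[OF V] by (intro nn_integral_indicator) (auto simp: \<sigma>)
  finally show ?thesis .
qed

text \<open>The identity permutation contributes \<sigma> itself to the sum.\<close>

lemma sym_measure_ge:
  assumes fin: "sigma_finite_measure \<sigma>" and \<sigma>: "sets \<sigma> = sets (C z)" and A: "A \<in> sets (C z)"
  shows "emeasure \<sigma> A \<le> emeasure (sym_measure z \<sigma>) A"
proof -
  have g: "good z id" by (simp add: good_def permutes_id)
  have "permute_point z id -` A \<inter> space (C z) = A"
    using sets.sets_into_space[OF A]
    by (auto simp: permute_point_def C_def space_PiM PiE_restrict)
  then have "emeasure \<sigma> A = emeasure \<sigma> (permute_point z id -` A \<inter> space (C z))" by simp
  also have "\<dots> \<le> (\<Sum>d | good z d. emeasure \<sigma> (permute_point z d -` A \<inter> space (C z)))"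
    by (rule member_le_sum[where i = id and f = "\<lambda>d. emeasure \<sigma> (permute_point z d -` A \<inter> space (C z))"])
       (simp_all add: g finite_good del: id_apply)
  also have "\<dots> = emeasure (sym_measure z \<sigma>) A"
    by (rule emeasure_sym_measure[OF assms, symmetric])
  finally show ?thesis .
qed

text \<open>The compatible measure \<mu> is invariant, so the preimages of its null sets under good
  permutations are again null for \<mu>, and hence for \<sigma>.\<close>

lemma sym_measure_absolutely_continuous:
  assumes \<mu>: "compatible z \<mu>" and fin: "sigma_finite_measure \<sigma>" and \<sigma>: "sets \<sigma> = sets (C z)"
    and ac: "absolutely_continuous \<mu> \<sigma>"
  shows "absolutely_continuous \<mu> (sym_measure z \<sigma>)"
  unfolding absolutely_continuous_def
proof
  fix A assume A: "A \<in> null_sets \<mu>"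
  then have AC: "A \<in> sets (C z)" using compatibleD(2)[OF \<mu>] by auto
  have "emeasure \<sigma> (permute_point z d -` A \<inter> space (C z)) = 0" if "good z d" for d
  proof -
    have m: "permute_point z d \<in> measurable \<mu> (C z)"
      by (rule measurable_compatible[OF \<mu> measurable_permute_point[OF that]])
    have "emeasure \<mu> (permute_point z d -` A \<inter> space (C z)) = emeasure (distr \<mu> (C z) (permute_point z d)) A"
      using compatibleD(3)[OF \<mu>] by (simp add: emeasure_distr[OF m AC])
    also have "\<dots> = 0" using A distr_permute_point[OF \<mu> that] by auto
    finally have "permute_point z d -` A \<inter> space (C z) \<in> null_sets \<mu>"
      using measurable_sets[OF m AC] compatibleD(3)[OF \<mu>] by auto
    then show ?thesis using ac by (auto simp: absolutely_continuous_def)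
  qed
  then have "emeasure (sym_measure z \<sigma>) A = 0"
    by (simp add: emeasure_sym_measure[OF fin \<sigma> AC])
  then show "A \<in> null_sets (sym_measure z \<sigma>)" using AC by auto
qed

section \<open>Uniqueness of the spectral measures\<close>

text \<open>The data left over from one vector of a sum of basic representations:
  \<open>d w j\<close> stands for the squared modulus of its component, and \<open>summ\<close> says
  that its norm is finite.\<close>

locale spectral_family =
  fixes M :: "exponents \<Rightarrow> nat \<Rightarrow> point measure" and d :: "exponents \<Rightarrow> nat \<Rightarrow> point \<Rightarrow> real"
  assumes compat: "w \<in> NZ \<Longrightarrow> j \<ge> 1 \<Longrightarrow> compatible w (M w j)"
    and ac_Suc: "w \<in> NZ \<Longrightarrow> j \<ge> 1 \<Longrightarrow> absolutely_continuous (M w j) (M w (Suc j))"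
    and d_int: "w \<in> NZ \<Longrightarrow> j \<ge> 1 \<Longrightarrow> integrable (M w j) (d w j)"
    and d_nonneg: "d w j a \<ge> 0"
    and summ: "(\<lambda>(w, j). \<integral>a. d w j a \<partial>M w j) summable_on NZ \<times> {1..}"
begin

declare One_nat_def [simp del]

definition pairing :: "(exponents \<Rightarrow> point \<Rightarrow> complex) \<Rightarrow> exponents \<times> nat \<Rightarrow> complex" where
  "pairing G = (\<lambda>(w, j). \<integral>a. G w a * of_real (d w j a) \<partial>M w j)"

lemma absolutely_continuous_first:
  assumes "w \<in> NZ" "j \<ge> 1"
  shows "absolutely_continuous (M w 1) (M w j)"
  using assms(2)
proof (induction j rule: nat_induct_at_least)
  case base
  then show ?case by (simp add: absolutely_continuous_def)
next
  case (Suc n)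
  then show ?case using ac_Suc[OF assms(1), of n] by (auto simp: absolutely_continuous_def)
qed

lemma pairing_integrable:
  assumes "w \<in> NZ" "j \<ge> 1" "g \<in> borel_measurable (C w)" "\<And>a. cmod (g a) \<le> B"
  shows "integrable (M w j) (\<lambda>a. g a * of_real (d w j a))"
proof (rule Bochner_Integration.integrable_bound)
  show "integrable (M w j) (\<lambda>a. B * d w j a)"
    using d_int[OF assms(1,2)] by simp
  have "g \<in> borel_measurable (M w j)"
    by (rule measurable_compatible[OF compat[OF assms(1,2)] assms(3)])
  moreover have "d w j \<in> borel_measurable (M w j)"
    using d_int[OF assms(1,2)] by (rule borel_measurable_integrable)
  ultimately show "(\<lambda>a. g a * of_real (d w j a)) \<in> borel_measurable (M w j)"
    by simp
  have "B \<ge> 0" using assms(4) norm_ge_zero by (meson order_trans)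
  then show "AE a in M w j. norm (g a * of_real (d w j a)) \<le> norm (B * d w j a)"
    using assms(4) d_nonneg by (auto simp: norm_mult abs_mult intro!: mult_right_mono)
qed

lemma pairing_bound:
  assumes "w \<in> NZ" "j \<ge> 1" "G w \<in> borel_measurable (C w)" "\<And>a. cmod (G w a) \<le> B"
  shows "cmod (pairing G (w, j)) \<le> B * (\<integral>a. d w j a \<partial>M w j)"
proof -
  have "cmod (pairing G (w, j)) \<le> (\<integral>a. cmod (G w a * of_real (d w j a)) \<partial>M w j)"
    unfolding pairing_def by simp
  also have "\<dots> \<le> (\<integral>a. B * d w j a \<partial>M w j)"
    using pairing_integrable[OF assms(1,2), of "G w", OF assms(3,4)] d_int[OF assms(1,2)] assms(4) d_nonneg
    by (intro integral_mono integrable_norm) (auto simp: norm_mult intro!: mult_right_mono)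
  also have "\<dots> = B * (\<integral>a. d w j a \<partial>M w j)" by simp
  finally show ?thesis .
qed

lemma pairing_summable:
  assumes "G \<in> R_span"
  shows "pairing G summable_on NZ \<times> {1..}"
proof -
  obtain B where B: "\<And>w a. cmod (G w a) \<le> B" using R_span_bounded[OF assms] by blast
  have "(\<lambda>i. norm (pairing G i)) summable_on NZ \<times> {1..}"
  proof (rule Infinite_Sum.abs_summable_on_comparison_test')
    show "(\<lambda>i. B * (case i of (w, j) \<Rightarrow> \<integral>a. d w j a \<partial>M w j)) summable_on NZ \<times> {1..}"
      by (rule summable_on_cmult_right[OF summ])
  qed (auto intro!: pairing_bound R_span_measurable[OF assms] B)
  then show ?thesis by (rule abs_summable_summable)
qed

end

text \<open>By \<open>match\<close>, the matrix coefficient of the vector is the transform of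
  \<sigma>. The measure \<sigma> lives off the diagonals, but invariance under good permutations is
  not demanded of it.\<close>

locale spectral_match = spectral_family +
  fixes z :: exponents and \<sigma> :: "point measure"
  assumes z: "z \<in> NZ" and fin: "finite_measure \<sigma>" and sets_\<sigma>: "sets \<sigma> = sets (C z)"
    and inj: "AE a in \<sigma>. inj_on a (D z)"
    and match: "u \<in> circle_functions \<Longrightarrow>
      (\<Sum>\<^sub>\<infinity>(w, j)\<in>NZ \<times> {1..}. \<integral>a. R w u a * of_real (d w j a) \<partial>M w j) = (\<integral>a. R z u a \<partial>\<sigma>)"
begin

lemma space_\<sigma>: "space \<sigma> = space (C z)"
  using sets_\<sigma> by (rule sets_eq_imp_space_eq)

lemma integrable_\<sigma>:
  assumes "f \<in> borel_measurable (C z)" "\<And>a. cmod (f a) \<le> B"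
  shows "integrable \<sigma> f"
  using assms by (intro finite_measure.integrable_const_bound[OF fin, where B = B])
    (auto simp: measurable_cong_sets[OF sets_\<sigma> refl])

text \<open>Both sides of \<open>match\<close> are linear in the family of test functions; splitting
  the infinite sum is justified by \<open>pairing_summable\<close>.\<close>

lemma match_span:
  assumes "G \<in> R_span"
  shows "infsum (pairing G) (NZ \<times> {1..}) = (\<integral>a. G z a \<partial>\<sigma>)"
  using assms
proof induction
  case (R u)
  then show ?case using match[OF R] by (simp add: pairing_def)
next
  case (scale G c)
  have "pairing (\<lambda>w a. c * G w a) = (\<lambda>i. c * pairing G i)"
    by (auto simp: pairing_def fun_eq_iff mult.assoc)
  then show ?case using scale by (simp add: infsum_cmult_right')
next
  case (add G H)
  have b: "\<exists>B. \<forall>w a. cmod (F w a) \<le> B" if "F \<in> R_span" for F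
    by (rule R_span_bounded[OF that])
  have int: "integrable (M w j) (\<lambda>a. F w a * of_real (d w j a))"
    if "F \<in> R_span" "w \<in> NZ" "j \<ge> 1" for F w j
    using b[OF that(1)] pairing_integrable[OF that(2,3), of "F w", OF R_span_measurable[OF that(1)]] by blast
  have "infsum (pairing (\<lambda>w a. G w a + H w a)) (NZ \<times> {1..})
      = infsum (\<lambda>i. pairing G i + pairing H i) (NZ \<times> {1..})"
  proof (rule infsum_cong)
    fix i :: "exponents \<times> nat" assume "i \<in> NZ \<times> {1..}"
    then show "pairing (\<lambda>w a. G w a + H w a) i = pairing G i + pairing H i"
      using int[OF add(1)] int[OF add(2)] by (auto simp: pairing_def distrib_right)
  qed
  also have "\<dots> = infsum (pairing G) (NZ \<times> {1..}) + infsum (pairing H) (NZ \<times> {1..})"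
    by (rule infsum_add) (rule pairing_summable, rule add)+
  also have "\<dots> = (\<integral>a. G z a + H z a \<partial>\<sigma>)"
  proof -
    have "integrable \<sigma> (G z)" "integrable \<sigma> (H z)"
      using b[OF add(1)] b[OF add(2)] integrable_\<sigma>[OF R_span_measurable[OF add(1)]]
        integrable_\<sigma>[OF R_span_measurable[OF add(2)]] by blast+
    then show ?thesis by (simp only: add.IH Bochner_Integration.integral_add)
  qed
  finally show ?case .
qed

text \<open>Box events are admissible test families. Off the diagonals they converge to the
  indicator of the good box at the exponent \<open>z\<close> and to \<open>0\<close> at every other
  one, so the limit of \<open>match_span\<close> is an identity about \<open>z\<close>
  alone.\<close>

lemma match_box:
  assumes V: "\<And>p. p \<in> D z \<Longrightarrow> V p \<in> sets lam" and disj: "disjoint_family_on V (D z)"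
  shows "((\<lambda>j. \<integral>a. of_bool (good_box z V a) * d z j a \<partial>M z j)
    has_sum measure \<sigma> (good_boxes z V)) {1..}"
proof -
  define e where "e n w a = (of_bool (box_event z V n w a) :: complex)" for n w a
  define b where "b w a = (of_bool (w = z \<and> good_box z V a) :: complex)" for w a
  have span: "e n \<in> R_span" for n
    using R_event_box[where z = z and V = V and n = n] V by (simp add: R_event_def e_def[abs_def])
  have e1: "cmod (e n w a) \<le> 1" for n w a by (simp add: e_def)
  have lim: "(\<lambda>n. e n w a) \<longlonglongrightarrow> b w a" if "w \<in> NZ" "inj_on a (D w)" for w a
    unfolding e_def b_def
    by (rule tendsto_eventually, rule eventually_mono[OF eventually_box_event[OF that(1) z that(2) disj]]) simp
  have meas: "G \<in> borel_measurable (M w j)" if "G \<in> borel_measurable (C w)" "w \<in> NZ" "j \<ge> 1"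
    for G :: "point \<Rightarrow> complex" and w j
    by (rule measurable_compatible[OF compat[OF that(2,3)] that(1)])
  have bm: "b w \<in> borel_measurable (C w)" for w
  proof (cases "w = z")
    case True
    have "(\<lambda>a. indicator (good_boxes z V) a :: complex) \<in> borel_measurable (C z)"
      using sets_good_box[OF V] by (intro borel_measurable_indicator) auto
    moreover have "b z \<in> borel_measurable (C z) \<longleftrightarrow>
        (\<lambda>a. indicator (good_boxes z V) a :: complex) \<in> borel_measurable (C z)"
      by (rule measurable_cong) (auto simp: b_def indicator_def)
    ultimately show ?thesis using True by blast
  next
    case False
    then have "b w = (\<lambda>_. 0)" by (auto simp: b_def)
    then show ?thesis by simp
  qed
  have "(\<lambda>n. pairing (e n) i) \<longlonglongrightarrow> pairing b i" if mem: "i \<in> NZ \<times> {1..}" for i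
  proof -
    obtain w j where i: "i = (w, j)" "w \<in> NZ" "j \<ge> 1" using mem by (cases i) auto
    show ?thesis
      unfolding pairing_def i(1) prod.case
    proof (rule integral_dominated_convergence[where w = "d w j"])
      show "AE a in M w j. (\<lambda>n. e n w a * of_real (d w j a)) \<longlonglongrightarrow> b w a * of_real (d w j a)"
        using compatibleD(4)[OF compat[OF i(2,3)]]
        by eventually_elim (intro tendsto_mult tendsto_const lim i)
      show "AE a in M w j. cmod (e n w a * of_real (d w j a)) \<le> d w j a" for n
        using e1 d_nonneg by (auto simp: norm_mult intro!: mult_left_le_one_le)
      have [measurable]: "d w j \<in> borel_measurable (M w j)"
        using d_int[OF i(2,3)] by (rule borel_measurable_integrable)
      have [measurable]: "b w \<in> borel_measurable (M w j)" "\<And>n. e n w \<in> borel_measurable (M w j)"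
        using meas[OF bm i(2,3)] meas[OF R_span_measurable[OF span] i(2,3)] by auto
      show "(\<lambda>a. b w a * of_real (d w j a)) \<in> borel_measurable (M w j)"
        "(\<lambda>a. e n w a * of_real (d w j a)) \<in> borel_measurable (M w j)" for n by measurable
    qed (rule d_int[OF i(2,3)])
  qed
  note lim_pair = this
  have bnd: "cmod (pairing (e n) i) \<le> (case i of (w, j) \<Rightarrow> \<integral>a. d w j a \<partial>M w j)"
    if "i \<in> NZ \<times> {1..}" for n i
    using that pairing_bound[of _ _ "e n" 1] R_span_measurable[OF span] e1 by fastforce
  note L = tendsto_infsum_dominated[OF summ bnd lim_pair]
  have "(\<lambda>n. \<integral>a. e n z a \<partial>\<sigma>) \<longlonglongrightarrow> (\<integral>a. b z a \<partial>\<sigma>)"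
  proof (rule integral_dominated_convergence[where w = "\<lambda>_. 1"])
    show "AE a in \<sigma>. (\<lambda>n. e n z a) \<longlonglongrightarrow> b z a"
      using inj by eventually_elim (rule lim[OF z])
    show "integrable \<sigma> (\<lambda>_. 1 :: real)"
      using finite_measure.integrable_const[OF fin] by auto
    show "AE a in \<sigma>. cmod (e n z a) \<le> 1" for n using e1 by simp
  qed (use bm[of z] R_span_measurable[OF span] in \<open>auto simp: measurable_cong_sets[OF sets_\<sigma> refl]\<close>)
  then have "infsum (pairing b) (NZ \<times> {1..}) = (\<integral>a. b z a \<partial>\<sigma>)"
    using L(1) LIMSEQ_unique by (auto simp: match_span[OF span])
  also have "(\<integral>a. b z a \<partial>\<sigma>) = (\<integral>a. indicator (good_boxes z V) a \<partial>\<sigma>)"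
    by (intro Bochner_Integration.integral_cong) (auto simp: b_def indicator_def space_\<sigma>)
  also have "\<dots> = of_real (measure \<sigma> (good_boxes z V))"
  proof -
    have "good_boxes z V \<inter> space \<sigma> = (good_boxes z V)"
      by (auto simp: space_\<sigma>)
    moreover have "(\<integral>a. indicator (good_boxes z V) a \<partial>\<sigma>)
        = complex_of_real (\<integral>a. indicator (good_boxes z V) a \<partial>\<sigma>)"
      by (subst integral_complex_of_real[symmetric]) (intro Bochner_Integration.integral_cong, auto simp: indicator_def)
    ultimately show ?thesis by simp
  qed
  finally have "(pairing b has_sum of_real (measure \<sigma> (good_boxes z V))) (NZ \<times> {1..})"
    using has_sum_infsum[OF L(2)] by simp
  \<comment> \<open>Summands with \<open>w \<noteq> z\<close> vanish; only the multiplicities of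
    \<open>z\<close> remain.\<close>
  then have "(pairing b has_sum of_real (measure \<sigma> (good_boxes z V))) (Pair z ` {1..})"
  proof (rule has_sum_cong_neutral[THEN iffD1, rotated 3])
    show "pairing b i = 0" if off: "i \<in> NZ \<times> {1..} - Pair z ` {1..}" for i
    proof (cases i)
      case (Pair w j)
      then have "w \<noteq> z" using off by blast
      then show ?thesis by (simp add: Pair pairing_def b_def)
    qed
  qed (use z in auto)
  then have "(pairing b \<circ> Pair z has_sum of_real (measure \<sigma> (good_boxes z V))) {1..}"
    by (subst (asm) has_sum_reindex) (auto simp: inj_on_def)
  moreover have "(pairing b \<circ> Pair z) j = of_real (\<integral>a. of_bool (good_box z V a) * d z j a \<partial>M z j)" for j
    unfolding pairing_def b_def comp_def prod.case
    by (subst integral_complex_of_real[symmetric]) (intro Bochner_Integration.integral_cong, auto)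
  ultimately have "((\<lambda>j. complex_of_real (\<integral>a. of_bool (good_box z V a) * d z j a \<partial>M z j))
      has_sum of_real (measure \<sigma> (good_boxes z V))) {1..}"
    by (simp add: comp_def)
  then show ?thesis
    by (subst (asm) has_sum_of_real_iff)
qed

text \<open>This is the sum over \<open>j \<ge> 1\<close> of \<open>M z j\<close> weighted by
  \<open>d z j\<close>. Writing it as a density over \<open>M z 1\<close>, by means of the
  Radon-Nikodym derivatives that \<open>absolutely_continuous_first\<close> provides, builds in
  absolute continuity. \<open>suminf\<close> starts at \<open>0\<close> and multiplicities at
  \<open>1\<close>, hence \<open>Suc j\<close>.\<close>

definition spectral_part :: "point measure" where
  "spectral_part = density (M z 1)
     (\<lambda>a. suminf (\<lambda>j. RN_deriv (M z 1) (M z (Suc j)) a * ennreal (d z (Suc j) a)))"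

lemma sets_M: "j \<ge> 1 \<Longrightarrow> sets (M z j) = sets (C z)"
  by (rule compatibleD(2)[OF compat[OF z]])

lemma space_M: "j \<ge> 1 \<Longrightarrow> space (M z j) = space (C z)"
  by (rule compatibleD(3)[OF compat[OF z]])

lemma measurable_d: "(\<lambda>a. d z (Suc j) a) \<in> borel_measurable (C z)"
  using borel_measurable_integrable[OF d_int[OF z, of "Suc j"]]
  by (simp add: measurable_cong_sets[OF sets_M refl])

lemma measurable_RN: "RN_deriv (M z 1) (M z (Suc j)) \<in> borel_measurable (C z)"
  using borel_measurable_RN_deriv[of "M z 1" "M z (Suc j)"]
  by (simp add: measurable_cong_sets[OF sets_M refl])

lemma sets_spectral_part: "sets spectral_part = sets (C z)"
  by (simp add: spectral_part_def sets_M)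

lemma emeasure_spectral_part:
  assumes A: "A \<in> sets (C z)"
  shows "emeasure spectral_part A = suminf (\<lambda>j. ennreal (\<integral>a. indicator A a * d z (Suc j) a \<partial>M z (Suc j)))"
proof -
  interpret M1: finite_measure "M z 1" by (rule compatibleD(1)[OF compat[OF z]]) simp
  note [measurable] = A measurable_d measurable_RN
  note [simp] = measurable_cong_sets[OF sets_M refl]
  have "emeasure spectral_part A = (\<integral>\<^sup>+a. suminf (\<lambda>j. RN_deriv (M z 1) (M z (Suc j)) a * ennreal (d z (Suc j) a)) * indicator A a \<partial>M z 1)"
    unfolding spectral_part_def using A by (intro emeasure_density) (auto simp: sets_M)
  also have "\<dots> = (\<integral>\<^sup>+a. suminf (\<lambda>j. RN_deriv (M z 1) (M z (Suc j)) a * (ennreal (d z (Suc j) a) * indicator A a)) \<partial>M z 1)"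
    by (simp add: ennreal_suminf_multc[symmetric] mult.assoc)
  also have "\<dots> = suminf (\<lambda>j. \<integral>\<^sup>+a. RN_deriv (M z 1) (M z (Suc j)) a * (ennreal (d z (Suc j) a) * indicator A a) \<partial>M z 1)"
    by (intro nn_integral_suminf) simp
  also have "\<dots> = suminf (\<lambda>j. ennreal (\<integral>a. indicator A a * d z (Suc j) a \<partial>M z (Suc j)))"
  proof (intro suminf_cong)
    fix j
    have "(\<integral>\<^sup>+a. RN_deriv (M z 1) (M z (Suc j)) a * (ennreal (d z (Suc j) a) * indicator A a) \<partial>M z 1)
        = (\<integral>\<^sup>+a. ennreal (d z (Suc j) a) * indicator A a \<partial>M z (Suc j))"
      by (rule M1.RN_deriv_nn_integral[symmetric])
         (auto intro!: absolutely_continuous_first[OF z] simp: sets_M)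
    also have "\<dots> = (\<integral>\<^sup>+a. ennreal (indicator A a * d z (Suc j) a) \<partial>M z (Suc j))"
      by (intro nn_integral_cong) (auto simp: indicator_def)
    also have "\<dots> = ennreal (\<integral>a. indicator A a * d z (Suc j) a \<partial>M z (Suc j))"
    proof (rule nn_integral_eq_integral)
      show "integrable (M z (Suc j)) (\<lambda>a. indicator A a * d z (Suc j) a)"
        using integrable_mult_indicator[OF _ d_int[OF z, of "Suc j"], of A] A by (simp add: sets_M)
    qed (simp add: d_nonneg)
    finally show "(\<integral>\<^sup>+a. RN_deriv (M z 1) (M z (Suc j)) a * (ennreal (d z (Suc j) a) * indicator A a) \<partial>M z 1)
      = ennreal (\<integral>a. indicator A a * d z (Suc j) a \<partial>M z (Suc j))" .
  qed
  finally show ?thesis .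
qed

lemma suminf_ennreal_has_sum:
  fixes f :: "nat \<Rightarrow> real"
  assumes "(f has_sum s) {1..}" "\<And>j. f j \<ge> 0"
  shows "suminf (\<lambda>j. ennreal (f (Suc j))) = ennreal s"
proof -
  have "bij_betw Suc UNIV {1..}" by (rule bij_betwI[where g = "\<lambda>n. n - 1"]) auto
  then have "((\<lambda>j. f (Suc j)) has_sum s) UNIV"
    using assms(1) by (subst has_sum_reindex_bij_betw)
  then show ?thesis
    by (intro suminf_ennreal_eq has_sum_imp_sums assms(2))
qed

lemma finite_spectral_part: "finite_measure spectral_part"
proof
  have "(\<lambda>(w, j). \<integral>a. d w j a \<partial>M w j) summable_on Pair z ` {1..}"
    using z by (intro summable_on_subset_banach[OF summ]) auto
  then have "(\<lambda>j. \<integral>a. d z j a \<partial>M z j) summable_on {1..}"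
    by (subst (asm) summable_on_reindex) (auto simp: inj_on_def comp_def)
  then obtain s where s: "((\<lambda>j. \<integral>a. d z j a \<partial>M z j) has_sum s) {1..}"
    by (auto simp: summable_on_def)
  have "emeasure spectral_part (space spectral_part)
      = suminf (\<lambda>j. ennreal (\<integral>a. indicator (space (C z)) a * d z (Suc j) a \<partial>M z (Suc j)))"
    using sets_eq_imp_space_eq[OF sets_spectral_part] by (simp add: emeasure_spectral_part)
  also have "\<dots> = suminf (\<lambda>j. ennreal (\<integral>a. d z (Suc j) a \<partial>M z (Suc j)))"
    by (intro suminf_cong arg_cong[of _ _ ennreal] Bochner_Integration.integral_cong refl)
       (simp add: space_M)
  also have "\<dots> = ennreal s"
    using d_nonneg by (intro suminf_ennreal_has_sum[OF s]) simp
  finally show "emeasure spectral_part (space spectral_part) \<noteq> \<infinity>" by simp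
qed

lemma emeasure_spectral_part_box:
  assumes V: "\<And>p. p \<in> D z \<Longrightarrow> V p \<in> sets lam" and disj: "disjoint_family_on V (D z)"
  shows "emeasure spectral_part (good_boxes z V)
       = emeasure \<sigma> (good_boxes z V)"
proof -
  have "emeasure spectral_part (good_boxes z V)
     = suminf (\<lambda>j. ennreal (\<integral>a. indicator (good_boxes z V) a * d z (Suc j) a \<partial>M z (Suc j)))"
    by (rule emeasure_spectral_part[OF sets_good_box[OF V]])
  also have "\<dots> = suminf (\<lambda>j. ennreal (\<integral>a. of_bool (good_box z V a) * d z (Suc j) a \<partial>M z (Suc j)))"
    by (intro suminf_cong arg_cong[of _ _ ennreal] Bochner_Integration.integral_cong refl)
       (simp add: space_M indicator_def)
  also have "\<dots> = ennreal (measure \<sigma> (good_boxes z V))"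
  proof (rule suminf_ennreal_has_sum[OF match_box[OF V disj]])
    show "(\<integral>a. of_bool (good_box z V a) * d z j a \<partial>M z j) \<ge> 0" for j
      by (rule Bochner_Integration.integral_nonneg) (simp add: d_nonneg)
  qed
  also have "\<dots> = emeasure \<sigma> (good_boxes z V)"
    by (simp add: finite_measure.emeasure_eq_measure[OF fin])
  finally show ?thesis .
qed

lemma ac_spectral_part: "absolutely_continuous (M z 1) spectral_part"
  unfolding spectral_part_def
  by (intro absolutely_continuousI_density borel_measurable_suminf_order borel_measurable_times_ennreal)
     (use measurable_RN measurable_d in \<open>auto simp: measurable_cong_sets[OF sets_M refl]\<close>)

text \<open>The two measures have been compared only on boxes with disjoint sides. Sub-boxes of such
  a box inherit the disjointness and form a generating family stable under intersection, so the
  symmetrisations agree once restricted to the box.\<close>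

lemma sym_measures_agree:
  assumes U: "\<And>p. p \<in> D z \<Longrightarrow> U p \<in> sets lam" and disj: "disjoint_family_on U (D z)"
  shows "density (sym_measure z \<sigma>) (indicator (Pi\<^sub>E (D z) U)) =
    density (sym_measure z spectral_part) (indicator (Pi\<^sub>E (D z) U))" (is "?P = ?Q")
proof -
  have B: "Pi\<^sub>E (D z) V \<in> sets (C z)" if "\<And>p. p \<in> D z \<Longrightarrow> V p \<in> sets lam" for V
    unfolding C_def using that by (intro sets_PiM_I_finite) auto
  have sf: "sigma_finite_measure \<sigma>" "sigma_finite_measure spectral_part"
    using fin finite_spectral_part by (auto simp: finite_measure_def)
  have injs: "AE a in spectral_part. inj_on a (D z)"
    using absolutely_continuous_AE[OF _ ac_spectral_part compatibleD(4)[OF compat[OF z]]]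
      sets_spectral_part sets_M[of 1] by simp
  have res: "emeasure (density (sym_measure z \<tau>) (indicator (Pi\<^sub>E (D z) U))) A
      = emeasure (sym_measure z \<tau>) (Pi\<^sub>E (D z) U \<inter> A)" if "A \<in> sets (C z)" for \<tau> A
    using that B[OF U] by (intro emeasure_restricted) auto
  show ?thesis
  proof (rule measure_eqI_PiM_finite[where I = "D z" and M = "\<lambda>_. lam" and A = "\<lambda>_. space (C z)"])
    show "sets ?P = sets (PiM (D z) (\<lambda>_. lam))" "sets ?Q = sets (PiM (D z) (\<lambda>_. lam))"
      by (simp_all add: C_def[symmetric])
    fix A :: "int \<times> nat \<Rightarrow> (nat \<Rightarrow> bool) set" assume A: "\<And>p. p \<in> D z \<Longrightarrow> A p \<in> sets lam"
    have V: "\<And>p. p \<in> D z \<Longrightarrow> U p \<inter> A p \<in> sets lam" using U A by auto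
    have d: "disjoint_family_on (\<lambda>p. U p \<inter> A p) (D z)"
      using disj unfolding disjoint_family_on_def by blast
    have "emeasure ?P (Pi\<^sub>E (D z) A) = emeasure (sym_measure z \<sigma>) (Pi\<^sub>E (D z) (\<lambda>p. U p \<inter> A p))"
      by (simp add: res B[OF A] PiE_Int)
    also have "\<dots> = emeasure (sym_measure z spectral_part) (Pi\<^sub>E (D z) (\<lambda>p. U p \<inter> A p))"
      by (simp add: emeasure_sym_measure_box[OF sf(1) sets_\<sigma> V d inj]
        emeasure_sym_measure_box[OF sf(2) sets_spectral_part V d injs] emeasure_spectral_part_box[OF V d])
    also have "\<dots> = emeasure ?Q (Pi\<^sub>E (D z) A)"
      by (simp add: res B[OF A] PiE_Int)
    finally show "emeasure ?P (Pi\<^sub>E (D z) A) = emeasure ?Q (Pi\<^sub>E (D z) A)" .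
  next
    have "space (C z) \<in> prod_algebra (D z) (\<lambda>_. lam)"
      unfolding C_def space_PiM by (intro prod_algebraI_finite finite_D ballI sets.top)
    then show "range (\<lambda>_::nat. space (C z)) \<subseteq> prod_algebra (D z) (\<lambda>_. lam)" by auto
    show "(\<Union>i::nat. space (C z)) = space (PiM (D z) (\<lambda>_. lam))" by (simp add: C_def)
    show "emeasure ?P (space (C z)) \<noteq> \<infinity>"
    proof -
      have "emeasure ?P (space (C z)) \<le> emeasure (sym_measure z \<sigma>) (space (C z))"
        by (subst res) (auto intro!: emeasure_mono)
      also have "\<dots> < \<infinity>"
        by (subst emeasure_sym_measure[OF sf(1) sets_\<sigma>])
           (auto simp: finite_measure.emeasure_eq_measure[OF fin])
      finally show ?thesis by simp
    qed
  qed simp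
qed

text \<open>Off the diagonals every point lies in a box whose sides are distinct dyadic cells of one
  level, and there are countably many such boxes. On each, \<sigma> is at most its symmetrisation,
  which equals that of \<open>spectral_part\<close> and therefore vanishes on null sets of
  \<open>M z 1\<close>.\<close>

lemma absolutely_continuous_spectral: "absolutely_continuous (M z 1) \<sigma>"
  unfolding absolutely_continuous_def
proof
  fix N assume N: "N \<in> null_sets (M z 1)"
  then have NC: "N \<in> sets (C z)" using sets_M[of 1] by auto
  have sf: "sigma_finite_measure \<sigma>" "sigma_finite_measure spectral_part"
    using fin finite_spectral_part by (auto simp: finite_measure_def)
  define K where "K n s = Pi\<^sub>E (D z) (\<lambda>p. cell n (s p))" for n and s :: "int \<times> nat \<Rightarrow> bool list"
  \<comment> \<open>Injectivity of \<open>s\<close> makes the cells disjoint; extensionality over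
    the finite \<open>D z\<close> keeps the index set countable.\<close>
  define S where "S = {(n :: nat, s). s \<in> Pi\<^sub>E (D z) (\<lambda>_. UNIV :: bool list set) \<and> inj_on s (D z)}"
  have "countable S"
    by (rule countable_subset[of _ "UNIV \<times> Pi\<^sub>E (D z) (\<lambda>_. UNIV)"])
       (auto simp: S_def intro!: countable_SIGMA countable_PiE)
  have "emeasure \<sigma> (N \<inter> K n s) = 0" if "(n, s) \<in> S" for n s
  proof -
    have U: "cell n (s p) \<in> sets lam" for p by (rule sets_cell)
    have disj: "disjoint_family_on (\<lambda>p. cell n (s p)) (D z)"
      unfolding disjoint_family_on_def
    proof (intro ballI impI)
      fix p q assume "p \<in> D z" "q \<in> D z" "p \<noteq> q"
      then have "s p \<noteq> s q" using that unfolding S_def by (blast dest: inj_onD)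
      then show "cell n (s p) \<inter> cell n (s q) = {}" by (auto simp: cell_def)
    qed
    have KC: "K n s \<in> sets (C z)"
      unfolding K_def C_def by (intro sets_PiM_I_finite) auto
    have res: "emeasure (density (sym_measure z \<tau>) (indicator (K n s))) N
        = emeasure (sym_measure z \<tau>) (K n s \<inter> N)" for \<tau>
      using NC KC by (intro emeasure_restricted) auto
    have "emeasure \<sigma> (N \<inter> K n s) \<le> emeasure (sym_measure z \<sigma>) (N \<inter> K n s)"
      using NC KC by (intro sym_measure_ge[OF sf(1) sets_\<sigma>]) auto
    also have "\<dots> = emeasure (sym_measure z spectral_part) (N \<inter> K n s)"
      using res[of \<sigma>] res[of spectral_part] sym_measures_agree[OF U disj]
      by (simp add: K_def Int_commute)
    also have "\<dots> = 0"
    proof -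
      have "N \<in> null_sets (sym_measure z spectral_part)"
        using sym_measure_absolutely_continuous[OF compat[OF z] sf(2) sets_spectral_part ac_spectral_part] N
        by (auto simp: absolutely_continuous_def)
      then have "N \<inter> K n s \<in> null_sets (sym_measure z spectral_part)"
        using KC by (intro null_set_Int2) auto
      then show ?thesis by (rule null_setsD1)
    qed
    finally show ?thesis by simp
  qed
  moreover have "K n s \<in> sets (C z)" for n s
    unfolding K_def C_def by (intro sets_PiM_I_finite) auto
  ultimately have "N \<inter> K n s \<in> null_sets \<sigma>" if "(n, s) \<in> S" for n s
    using NC that sets_\<sigma> by (intro null_setsI) auto
  then have "(\<Union>(n, s)\<in>S. N \<inter> K n s) \<in> null_sets \<sigma>"
    using \<open>countable S\<close> by (intro null_sets_UN') auto
  then have "AE a in \<sigma>. a \<notin> (\<Union>(n, s)\<in>S. N \<inter> K n s)" by (rule AE_not_in)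
  with inj AE_space have "AE a in \<sigma>. a \<notin> N"
  proof eventually_elim
    case (elim a)
    from eventually_separating[OF elim(1)] obtain n where n: "separating z a n"
      by (meson eventually_sequentially order_refl)
    define s where "s = (\<lambda>p\<in>D z. map (a p) [0..<n])"
    have "(n, s) \<in> S" using n by (auto simp: S_def s_def separating_def inj_on_def)
    moreover have "a \<in> K n s"
      using elim(2) by (auto simp: K_def s_def cell_def space_\<sigma> C_def space_PiM PiE_iff)
    ultimately show ?case using elim(3) by auto
  qed
  then show "N \<in> null_sets \<sigma>"
    using NC sets_\<sigma> sets.sets_into_space[OF NC] space_\<sigma>
    by (simp add: AE_iff_null_sets)
qed

end

section \<open>Independence from joint ergodicity\<close>

definition measure_preserving_self :: "'a measure \<Rightarrow> ('a \<Rightarrow> 'a) \<Rightarrow> bool" where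
  "measure_preserving_self M t \<longleftrightarrow> t \<in> measurable M M \<and> distr M M t = M"

lemma AE_measure_preserving:
  assumes "measure_preserving_self M t" "AE x in M. P x"
  shows "AE x in M. P (t x)"
  using assms AE_distrD[of t M M P] unfolding measure_preserving_self_def by metis

text \<open>The exceptional null set may depend on \<open>t\<close>, since the action provides each
  map only up to a null set and there are uncountably many of them.\<close>

definition invariant_set :: "'a measure \<Rightarrow> ('a \<Rightarrow> 'a) set \<Rightarrow> 'a set \<Rightarrow> bool" where
  "invariant_set M T E \<longleftrightarrow> E \<in> sets M \<and> (\<forall>t\<in>T. AE x in M. t x \<in> E \<longleftrightarrow> x \<in> E)"

definition invariant_algebra :: "'a measure \<Rightarrow> ('a \<Rightarrow> 'a) set \<Rightarrow> 'a measure" where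
  "invariant_algebra M T = sigma (space M) {E. invariant_set M T E}"

lemma sets_invariant_algebra:
  assumes mp: "\<And>t. t \<in> T \<Longrightarrow> measure_preserving_self M t"
  shows "sets (invariant_algebra M T) = {E. invariant_set M T E}"
    and "space (invariant_algebra M T) = space M"
proof -
  have sub: "{E. invariant_set M T E} \<subseteq> Pow (space M)"
    using sets.sets_into_space by (auto simp: invariant_set_def)
  have "sigma_algebra (space M) {E. invariant_set M T E}"
    unfolding sigma_algebra_iff2
  proof (intro conjI ballI allI impI sub)
    show "{} \<in> {E. invariant_set M T E}" by (simp add: invariant_set_def)
    show "space M - E \<in> {E. invariant_set M T E}" if "E \<in> {E. invariant_set M T E}" for E
    proof -
      have "AE x in M. t x \<in> space M - E \<longleftrightarrow> x \<in> space M - E" if "t \<in> T" for t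
      proof -
        have "AE x in M. t x \<in> E \<longleftrightarrow> x \<in> E"
          using \<open>E \<in> _\<close> \<open>t \<in> T\<close> by (simp add: invariant_set_def)
        with AE_measure_preserving[OF mp[OF \<open>t \<in> T\<close>] AE_space] AE_space
        show ?thesis by eventually_elim simp
      qed
      then show ?thesis using that by (auto simp: invariant_set_def)
    qed
    fix A :: "nat \<Rightarrow> 'a set" assume A: "range A \<subseteq> {E. invariant_set M T E}"
    have "AE x in M. t x \<in> (\<Union>i. A i) \<longleftrightarrow> x \<in> (\<Union>i. A i)" if "t \<in> T" for t
    proof -
      have "AE x in M. \<forall>i. t x \<in> A i \<longleftrightarrow> x \<in> A i"
        unfolding AE_all_countable using A that by (auto simp: invariant_set_def)
      then show ?thesis by eventually_elim simp
    qed
    moreover have "(\<Union>i. A i) \<in> sets M" using A by (auto simp: invariant_set_def)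
    ultimately show "(\<Union>i. A i) \<in> {E. invariant_set M T E}" by (simp add: invariant_set_def)
  qed
  then show "sets (invariant_algebra M T) = {E. invariant_set M T E}"
    unfolding invariant_algebra_def by (rule sigma_algebra.sets_measure_of_eq)
  show "space (invariant_algebra M T) = space M"
    unfolding invariant_algebra_def using sub by (rule space_measure_of)
qed

lemma subalgebra_invariant:
  assumes mp: "\<And>t. t \<in> T \<Longrightarrow> measure_preserving_self M t"
  shows "subalgebra M (invariant_algebra M T)"
  using sets_invariant_algebra[of T M] mp by (auto simp: subalgebra_def invariant_set_def)

lemma invariant_algebra_measurableI:
  fixes g :: "'a \<Rightarrow> real"
  assumes mp: "\<And>t. t \<in> T \<Longrightarrow> measure_preserving_self M t"
    and g: "g \<in> borel_measurable M" "\<And>t. t \<in> T \<Longrightarrow> AE x in M. g (t x) = g x"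
  shows "g \<in> borel_measurable (invariant_algebra M T)"
proof (rule measurableI)
  fix S :: "real set" assume S: "S \<in> sets borel"
  have "AE x in M. t x \<in> g -` S \<inter> space M \<longleftrightarrow> x \<in> g -` S \<inter> space M" if "t \<in> T" for t
    using g(2)[OF that] AE_measure_preserving[OF mp[OF that] AE_space] AE_space
    by eventually_elim simp
  then show "g -` S \<inter> space (invariant_algebra M T) \<in> sets (invariant_algebra M T)"
    using measurable_sets[OF g(1) S] by (simp add: sets_invariant_algebra[OF mp] invariant_set_def)
qed simp

text \<open>Sublevel sets at rational levels determine \<open>g\<close>, so countably many
  exceptional null sets have to be united.\<close>

lemma invariant_algebra_measurableD:
  fixes g :: "'a \<Rightarrow> real"
  assumes mp: "\<And>t. t \<in> T \<Longrightarrow> measure_preserving_self M t"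
    and g: "g \<in> borel_measurable (invariant_algebra M T)" and t: "t \<in> T"
  shows "AE x in M. g (t x) = g x"
proof -
  have "AE x in M. g (t x) < of_rat q \<longleftrightarrow> g x < of_rat q" for q
  proof -
    have "g -` {..<of_rat q} \<inter> space M \<in> sets (invariant_algebra M T)"
      using measurable_sets[OF g, of "{..<of_rat q}"] by (simp add: sets_invariant_algebra[OF mp])
    then have "AE x in M. t x \<in> g -` {..<of_rat q} \<inter> space M \<longleftrightarrow> x \<in> g -` {..<of_rat q} \<inter> space M"
      using t by (simp add: sets_invariant_algebra[OF mp] invariant_set_def)
    with AE_measure_preserving[OF mp[OF t] AE_space] AE_space
    show ?thesis by eventually_elim simp
  qed
  then have "AE x in M. \<forall>q. g (t x) < of_rat q \<longleftrightarrow> g x < of_rat q"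
    by (simp add: AE_all_countable)
  then show ?thesis
  proof eventually_elim
    case (elim x)
    show ?case
    proof (rule ccontr)
      assume "g (t x) \<noteq> g x"
      then consider "g (t x) < g x" | "g x < g (t x)" by linarith
      then show False
      proof cases
        case 1
        from of_rat_dense[OF this] obtain q where "g (t x) < of_rat q" "of_rat q < g x" by blast
        with elim show False by (meson less_asym)
      next
        case 2
        from of_rat_dense[OF this] obtain q where "g x < of_rat q" "of_rat q < g (t x)" by blast
        with elim show False by (meson less_asym)
      qed
    qed
  qed
qed

text \<open>Only the level \<open>expectation h\<close> is needed: the difference
  \<open>h - expectation h\<close> has one sign almost everywhere and integral zero, so it
  vanishes.\<close>

lemma (in prob_space) zero_one_imp_AE_const:
  fixes h :: "'a \<Rightarrow> real"
  assumes h: "integrable M h" and zo: "\<And>c. prob {x \<in> space M. h x < c} \<in> {0, 1}"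
  shows "AE x in M. h x = expectation h"
proof -
  let ?c = "expectation h"
  have [measurable]: "h \<in> borel_measurable M" using h by (rule borel_measurable_integrable)
  have ev: "{x \<in> space M. h x < ?c} \<in> events" by measurable
  have eq: "AE x in M. h x = ?c" if "AE x in M. 0 \<le> s * (h x - ?c)" "s \<noteq> 0" for s
  proof -
    have "integrable M (\<lambda>x. s * (h x - ?c))" using h by simp
    moreover have "(\<integral>x. s * (h x - ?c) \<partial>M) = 0" using h by (simp add: prob_space)
    ultimately have "AE x in M. s * (h x - ?c) = 0"
      using that(1) integral_nonneg_eq_0_iff_AE by blast
    then show ?thesis using that(2) by simp
  qed
  show ?thesis
  proof (cases "prob {x \<in> space M. h x < ?c} = 0")
    case True
    then have "AE x in M. x \<notin> {x \<in> space M. h x < ?c}"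
      using prob_eq_0[OF ev] by simp
    then have "AE x in M. 0 \<le> 1 * (h x - ?c)"
      using AE_space by eventually_elim auto
    then show ?thesis by (rule eq) simp
  next
    case False
    then have "prob {x \<in> space M. h x < ?c} = 1" using zo[of ?c] by simp
    then have "AE x in M. h x < ?c" using ev by (subst (asm) prob_Collect_eq_1) auto
    then have "AE x in M. 0 \<le> (- 1) * (h x - ?c)" by eventually_elim simp
    then show ?thesis by (rule eq) simp
  qed
qed

text \<open>Let \<open>h\<close> be the conditional expectation of the indicator of \<open>S\<close>
  on the \<open>A\<close>-invariant algebra. It is \<open>A\<close>-invariant by measurability, and
  \<open>B\<close>-invariant because the maps in \<open>B\<close> fix \<open>S\<close> and,
  commuting with \<open>A\<close>, preserve that algebra. Ergodicity makes \<open>h\<close>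
  constant, and integration over \<open>T\<close> gives the product.\<close>

lemma (in prob_space) commuting_invariant_sets_indep:
  assumes mp: "\<And>t. t \<in> A \<union> B \<Longrightarrow> measure_preserving_self M t"
    and comm: "\<And>s t. s \<in> A \<Longrightarrow> t \<in> B \<Longrightarrow> AE x in M. s (t x) = t (s x)"
    and inverse: "\<And>s. s \<in> B \<Longrightarrow> \<exists>s'\<in>B. AE x in M. s' (s x) = x"
    and erg: "\<And>E. invariant_set M (A \<union> B) E \<Longrightarrow> prob E \<in> {0, 1}"
    and S: "invariant_set M B S" and T: "invariant_set M A T"
  shows "prob (S \<inter> T) = prob S * prob T"
proof -
  have mpA: "\<And>t. t \<in> A \<Longrightarrow> measure_preserving_self M t"
    and mpB: "\<And>t. t \<in> B \<Longrightarrow> measure_preserving_self M t" using mp by auto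
  define F where "F = invariant_algebra M A"
  interpret F: finite_measure_subalgebra M F
    unfolding F_def by unfold_locales (rule subalgebra_invariant, rule mpA)
  have sF: "sets F = {E. invariant_set M A E}"
    unfolding F_def by (rule sets_invariant_algebra(1)) (rule mpA)
  have [measurable]: "S \<in> events" "T \<in> events" using S T by (auto simp: invariant_set_def)
  define f where "f = (indicator S :: 'a \<Rightarrow> real)"
  define h where "h = real_cond_exp M F f"
  have fi: "integrable M f" by (simp add: f_def emeasure_eq_measure)
  have hi: "integrable M h" unfolding h_def by (rule F.real_cond_exp_int(1)[OF fi])
  have hF: "h \<in> borel_measurable F" unfolding h_def by simp
  have [measurable]: "h \<in> borel_measurable M" "f \<in> borel_measurable M"
    using hi fi by auto
  have hA: "AE x in M. h (t x) = h x" if "t \<in> A" for t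
    by (rule invariant_algebra_measurableD[OF mpA hF[unfolded F_def] that])
  have hB: "AE x in M. h (s x) = h x" if s: "s \<in> B" for s
  proof -
    obtain s' where s': "s' \<in> B" "AE x in M. s' (s x) = x" using inverse[OF s] by blast
    note mps = mpB[OF s] mpB[OF s'(1)]
    have [measurable]: "s \<in> measurable M M" "s' \<in> measurable M M"
      using mps by (auto simp: measure_preserving_self_def)
    have shift: "(\<integral>x. g (s x) \<partial>M) = (\<integral>x. g x \<partial>M)" if [measurable]: "g \<in> borel_measurable M" for g :: "'a \<Rightarrow> real"
      using integral_distr[of s M M g] mps(1) by (simp add: measure_preserving_self_def)
    have hs_int: "integrable M (\<lambda>x. h (s x))"
      using integrable_distr[of s M M h] hi mps(1) by (simp add: measure_preserving_self_def)
    have fs: "AE x in M. f (s x) = f x"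
    proof -
      have "AE x in M. s x \<in> S \<longleftrightarrow> x \<in> S" using S s by (simp add: invariant_set_def)
      then show ?thesis by eventually_elim (simp add: f_def indicator_def)
    qed
    \<comment> \<open>The composition of \<open>h\<close> with \<open>s\<close> is shown to have the
      defining property of the conditional expectation of \<open>f\<close>, so it coincides with
      \<open>h\<close>.\<close>
    have "AE x in M. real_cond_exp M F f x = h (s x)"
    proof (rule F.real_cond_exp_charact[OF _ fi hs_int])
      have "AE x in M. h (s (t x)) = h (s x)" if "t \<in> A" for t
        using comm[OF that s] AE_measure_preserving[OF mps(1) hA[OF that]]
        by eventually_elim simp
      then show "(\<lambda>x. h (s x)) \<in> borel_measurable F"
        unfolding F_def by (intro invariant_algebra_measurableI[OF mpA]) auto
      fix W assume W: "W \<in> sets F"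
      then have WM [measurable]: "W \<in> events" using F.subalg by (auto simp: subalgebra_def)
      \<comment> \<open>For almost every \<open>x\<close>, the point \<open>s x\<close> lies in
        \<open>W'\<close> exactly when \<open>x\<close> lies in \<open>W\<close>; thus integrals
        over \<open>W\<close> after \<open>s\<close> become integrals over \<open>W'\<close>, which
        is again in \<open>F\<close>.\<close>
      define W' where "W' = s' -` W \<inter> space M"
      have W'M [measurable]: "W' \<in> events" unfolding W'_def by measurable
      have "AE x in M. t x \<in> W' \<longleftrightarrow> x \<in> W'" if "t \<in> A" for t
      proof -
        have "AE x in M. t x \<in> W \<longleftrightarrow> x \<in> W"
          using W that by (simp add: sF invariant_set_def)
        from AE_measure_preserving[OF mps(2) this] comm[OF that s'(1)] AE_space
          AE_measure_preserving[OF mpA[OF that] AE_space]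
        show ?thesis by eventually_elim (simp add: W'_def)
      qed
      then have W'F: "W' \<in> sets F" using W'M by (simp add: sF invariant_set_def)
      have move: "(\<integral>x\<in>W. g (s x) \<partial>M) = (\<integral>x\<in>W'. g x \<partial>M)"
        if [measurable]: "g \<in> borel_measurable M" for g :: "'a \<Rightarrow> real"
      proof -
        have "(\<integral>x. indicator W x *\<^sub>R g (s x) \<partial>M) = (\<integral>x. indicator W' (s x) *\<^sub>R g (s x) \<partial>M)"
        proof (rule integral_cong_AE)
          show "AE x in M. indicator W x *\<^sub>R g (s x) = indicator W' (s x) *\<^sub>R g (s x)"
            using s'(2) AE_measure_preserving[OF mps(1) AE_space]
            by eventually_elim (simp add: W'_def indicator_def)
        qed measurable
        also have "\<dots> = (\<integral>x. indicator W' x *\<^sub>R g x \<partial>M)"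
          by (rule shift[of "\<lambda>x. indicator W' x *\<^sub>R g x"]) measurable
        finally show ?thesis by (simp add: set_lebesgue_integral_def)
      qed
      have "(\<integral>x\<in>W. f x \<partial>M) = (\<integral>x\<in>W. f (s x) \<partial>M)"
        unfolding set_lebesgue_integral_def
      proof (rule integral_cong_AE)
        show "AE x in M. indicator W x *\<^sub>R f x = indicator W x *\<^sub>R f (s x)"
          using fs by eventually_elim simp
      qed measurable
      also have "\<dots> = (\<integral>x\<in>W'. f x \<partial>M)" by (rule move) measurable
      also have "\<dots> = (\<integral>x\<in>W'. h x \<partial>M)"
        unfolding h_def by (rule F.real_cond_exp_intA[OF fi W'F])
      also have "\<dots> = (\<integral>x\<in>W. h (s x) \<partial>M)" by (rule move[symmetric]) measurable
      finally show "(\<integral>x\<in>W. f x \<partial>M) = (\<integral>x\<in>W. h (s x) \<partial>M)" .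
    qed
    then show ?thesis by eventually_elim (simp add: h_def)
  qed
  have "AE x in M. h x = expectation h"
  proof (rule zero_one_imp_AE_const[OF hi])
    fix c
    have "invariant_set M (A \<union> B) {x \<in> space M. h x < c}"
      unfolding invariant_set_def
    proof (intro conjI ballI)
      fix t assume t: "t \<in> A \<union> B"
      then have "AE x in M. h (t x) = h x" using hA hB by blast
      with AE_measure_preserving[OF mp[OF t] AE_space] AE_space
      show "AE x in M. t x \<in> {x \<in> space M. h x < c} \<longleftrightarrow> x \<in> {x \<in> space M. h x < c}"
        by eventually_elim simp
    qed measurable
    then show "prob {x \<in> space M. h x < c} \<in> {0, 1}" by (rule erg)
  qed
  moreover have "expectation h = prob S"
    unfolding h_def by (simp add: F.real_cond_exp_int(2)[OF fi]) (simp add: f_def)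
  ultimately have h_const: "AE x in M. h x = prob S" by simp
  have TF: "T \<in> sets F" using T by (simp add: sF)
  have "prob (S \<inter> T) = (\<integral>x\<in>T. f x \<partial>M)"
    by (simp add: set_lebesgue_integral_def f_def indicator_inter_arith[symmetric] Int_commute)
  also have "\<dots> = (\<integral>x\<in>T. h x \<partial>M)"
    unfolding h_def by (rule F.real_cond_exp_intA[OF fi TF])
  also have "\<dots> = (\<integral>x\<in>T. prob S \<partial>M)"
    unfolding set_lebesgue_integral_def
  proof (rule integral_cong_AE)
    show "AE x in M. indicator T x *\<^sub>R h x = indicator T x *\<^sub>R prob S"
      using h_const by eventually_elim simp
  qed measurable
  also have "\<dots> = prob S * prob T" by (simp add: set_lebesgue_integral_def)
  finally show ?thesis .
qed

text \<open>Preimages of Borel sets under an invariant function are invariant sets, and they form a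
  family stable under intersection, so independence of sets suffices.\<close>

lemma (in prob_space) commuting_invariant_functions_indep:
  fixes X Y :: "'a \<Rightarrow> complex"
  assumes mp: "\<And>t. t \<in> A \<union> B \<Longrightarrow> measure_preserving_self M t"
    and comm: "\<And>s t. s \<in> A \<Longrightarrow> t \<in> B \<Longrightarrow> AE x in M. s (t x) = t (s x)"
    and inverse: "\<And>s. s \<in> B \<Longrightarrow> \<exists>s'\<in>B. AE x in M. s' (s x) = x"
    and erg: "\<And>E. invariant_set M (A \<union> B) E \<Longrightarrow> prob E \<in> {0, 1}"
    and X: "X \<in> borel_measurable M" "\<And>t. t \<in> B \<Longrightarrow> AE x in M. X (t x) = X x"
    and Y: "Y \<in> borel_measurable M" "\<And>t. t \<in> A \<Longrightarrow> AE x in M. Y (t x) = Y x"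
  shows "indep_var borel X borel Y"
proof -
  have inv: "invariant_set M T (Z -` E \<inter> space M)"
    if Z: "Z \<in> borel_measurable M" "\<And>t. t \<in> T \<Longrightarrow> AE x in M. Z (t x) = Z x"
      and T: "T \<subseteq> A \<union> B" and E: "E \<in> sets borel" for Z :: "'a \<Rightarrow> complex" and T E
    unfolding invariant_set_def
  proof (intro conjI ballI)
    show "Z -` E \<inter> space M \<in> events" by (rule measurable_sets[OF Z(1) E])
    fix t assume t: "t \<in> T"
    then have "measure_preserving_self M t" using T mp by blast
    from Z(2)[OF t] AE_measure_preserving[OF this AE_space] AE_space
    show "AE x in M. t x \<in> Z -` E \<inter> space M \<longleftrightarrow> x \<in> Z -` E \<inter> space M"
      by eventually_elim simp
  qed
  have stable: "Int_stable {Z -` E \<inter> space M |E. E \<in> sets borel}" for Z :: "'a \<Rightarrow> complex"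
  proof (rule Int_stableI)
    fix a b assume "a \<in> {Z -` E \<inter> space M |E. E \<in> sets borel}" "b \<in> {Z -` E \<inter> space M |E. E \<in> sets borel}"
    then obtain E E' where "E \<in> sets borel" "E' \<in> sets borel" "a = Z -` E \<inter> space M" "b = Z -` E' \<inter> space M"
      by blast
    then show "a \<inter> b \<in> {Z -` E \<inter> space M |E. E \<in> sets borel}"
      by (intro CollectI exI[of _ "E \<inter> E'"]) auto
  qed
  show ?thesis
    unfolding indep_var_eq
  proof (intro conjI indep_set_sigma_sets stable X(1) Y(1))
    show "indep_set {X -` E \<inter> space M |E. E \<in> sets borel} {Y -` E \<inter> space M |E. E \<in> sets borel}"
    proof (rule indep_setI)
      fix a b assume "a \<in> {X -` E \<inter> space M |E. E \<in> sets borel}" "b \<in> {Y -` E \<inter> space M |E. E \<in> sets borel}"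
      then have "invariant_set M B a" "invariant_set M A b"
        using inv[OF X] inv[OF Y] by auto
      from commuting_invariant_sets_indep[OF mp comm inverse erg this]
      show "prob (a \<inter> b) = prob a * prob b" .
    qed (auto intro: measurable_sets X Y)
  qed
qed

section \<open>Classes of square integrable functions\<close>

lemma borel_measurable_cnj [measurable (raw)]:
  "f \<in> borel_measurable M \<Longrightarrow> (\<lambda>x. cnj (f x)) \<in> borel_measurable M"
  by (rule measurable_compose[OF _ borel_measurable_continuous_onI]) (auto intro: continuous_intros)

definition L2_class :: "'a measure \<Rightarrow> ('a \<Rightarrow> complex) \<Rightarrow> ('a \<Rightarrow> complex) set" where
  "L2_class M f = {g \<in> square_integrable M. AE x in M. g x = f x}"

lemma hcarrier_L2: "hcarrier (L2 M) = L2_class M ` square_integrable M"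
  by (simp add: L2_def ae_classes_def L2_class_def image_def)

lemma L2_class_self: "f \<in> square_integrable M \<Longrightarrow> f \<in> L2_class M f"
  by (simp add: L2_class_def)

lemma L2_class_eq_iff:
  assumes "f \<in> square_integrable M"
  shows "L2_class M f = L2_class M g \<longleftrightarrow> (AE x in M. f x = g x)"
proof
  assume "L2_class M f = L2_class M g"
  then have "f \<in> L2_class M g" using L2_class_self[OF assms] by simp
  then show "AE x in M. f x = g x" by (simp add: L2_class_def)
next
  assume eq: "AE x in M. f x = g x"
  have "(AE x in M. h x = f x) \<longleftrightarrow> (AE x in M. h x = g x)" for h
  proof
    assume "AE x in M. h x = f x"
    with eq show "AE x in M. h x = g x" by eventually_elim simp
  next
    assume "AE x in M. h x = g x"
    with eq show "AE x in M. h x = f x" by eventually_elim simp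
  qed
  then show "L2_class M f = L2_class M g" by (simp add: L2_class_def)
qed

lemma hinner_L2_class:
  assumes "f \<in> square_integrable M" "g \<in> square_integrable M"
  shows "hinner (L2 M) (L2_class M f) (L2_class M g) = (\<integral>x. f x * cnj (g x) \<partial>M)"
proof -
  define f' where "f' = (SOME h. h \<in> L2_class M f)"
  define g' where "g' = (SOME h. h \<in> L2_class M g)"
  have "f' \<in> L2_class M f" "g' \<in> L2_class M g"
    unfolding f'_def g'_def some_in_eq using L2_class_self[OF assms(1)] L2_class_self[OF assms(2)] by blast+
  then have m: "f' \<in> borel_measurable M" "g' \<in> borel_measurable M"
    and ae: "AE x in M. f' x = f x" "AE x in M. g' x = g x"
    by (auto simp: L2_class_def square_integrable_def)
  have [measurable]: "f \<in> borel_measurable M" "g \<in> borel_measurable M"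
    using assms by (auto simp: square_integrable_def)
  have "(\<integral>x. f' x * cnj (g' x) \<partial>M) = (\<integral>x. f x * cnj (g x) \<partial>M)"
  proof (rule integral_cong_AE)
    show "AE x in M. f' x * cnj (g' x) = f x * cnj (g x)"
      using ae by eventually_elim simp
  qed (use m in measurable)
  then show ?thesis by (simp add: L2_def f'_def g'_def)
qed

lemma square_integrable_mult_unimodular:
  assumes "f \<in> square_integrable M" "r \<in> borel_measurable M" "\<And>x. cmod (r x) = 1"
  shows "(\<lambda>x. r x * f x) \<in> square_integrable M"
  using assms by (auto simp: square_integrable_def norm_mult)

lemma square_integrable_compose:
  assumes "f \<in> square_integrable M" "measure_preserving_self M t"
  shows "(\<lambda>x. f (t x)) \<in> square_integrable M"
proof -
  have t: "t \<in> measurable M M" "distr M M t = M"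
    using assms(2) by (auto simp: measure_preserving_self_def)
  have f: "f \<in> borel_measurable M" "integrable M (\<lambda>x. (cmod (f x))\<^sup>2)"
    using assms(1) by (auto simp: square_integrable_def)
  have "integrable M (\<lambda>x. (cmod (f (t x)))\<^sup>2)"
    using integrable_distr[OF t(1), of "\<lambda>x. (cmod (f x))\<^sup>2"] f(2) t(2) by simp
  then show ?thesis using measurable_compose[OF t(1) f(1)] by (simp add: square_integrable_def)
qed

lemma square_integrable_cnj: "f \<in> square_integrable M \<Longrightarrow> (\<lambda>x. cnj (f x)) \<in> square_integrable M"
  by (auto simp: square_integrable_def)

lemma square_integrable_zero: "(\<lambda>_. 0) \<in> square_integrable M"
  by (simp add: square_integrable_def)

lemma square_integrable_mult_integrable:
  assumes "f \<in> square_integrable M" "g \<in> square_integrable M"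
  shows "integrable M (\<lambda>x. f x * cnj (g x))"
proof (rule Bochner_Integration.integrable_bound)
  show "integrable M (\<lambda>x. (cmod (f x))\<^sup>2 + (cmod (g x))\<^sup>2)"
    using assms by (auto simp: square_integrable_def)
  show "(\<lambda>x. f x * cnj (g x)) \<in> borel_measurable M"
    using assms by (auto simp: square_integrable_def)
  have "a * b \<le> a\<^sup>2 + b\<^sup>2" if "a \<ge> 0" "b \<ge> 0" for a b :: real
  proof -
    have "2 * (a * b) \<le> a\<^sup>2 + b\<^sup>2" using sum_squares_bound[of a b] by simp
    moreover have "0 \<le> a * b" using that by simp
    ultimately show ?thesis by linarith
  qed
  then show "AE x in M. norm (f x * cnj (g x)) \<le> norm ((cmod (f x))\<^sup>2 + (cmod (g x))\<^sup>2)"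
    by (auto simp: norm_mult)
qed

lemma (in prob_space) square_integrable_one: "(\<lambda>_. 1) \<in> square_integrable M"
  by (simp add: square_integrable_def)

lemma (in prob_space) square_integrable_imp_integrable:
  "f \<in> square_integrable M \<Longrightarrow> integrable M f"
  using square_integrable_mult_integrable[OF _ square_integrable_one] by simp

section \<open>Basic representations\<close>

text \<open>Absolute continuity of the one-coordinate marginals pulls null sets of
  \<open>lam\<close> back to null sets of \<mu>; this makes \<open>R w\<close> well defined on
  classes.\<close>

lemma R_cong_AE:
  assumes \<mu>: "compatible w \<mu>" and eq: "AE b in lam. u b = v b"
  shows "AE a in \<mu>. R w u a = R w v a"
proof -
  have ac: "\<forall>p\<in>D w. absolutely_continuous lam (distr \<mu> lam (\<lambda>a. a p))"
    using \<mu> unfolding compatible_def by (elim conjE)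
  have "AE a in \<mu>. u (a q) = v (a q)" if q: "q \<in> D w" for q
  proof -
    have m: "(\<lambda>a. a q) \<in> measurable \<mu> lam"
      by (rule measurable_compatible[OF \<mu> measurable_C_component[OF q]])
    have "AE b in distr \<mu> lam (\<lambda>a. a q). u b = v b"
      using ac q by (intro absolutely_continuous_AE[OF _ _ eq]) auto
    then show ?thesis by (rule AE_distrD[OF m])
  qed
  then have "AE a in \<mu>. \<forall>q\<in>D w. u (a q) = v (a q)"
    by (intro AE_finite_allI finite_D)
  then show ?thesis
    by eventually_elim (simp add: R_alt)
qed

definition symmetric :: "exponents \<Rightarrow> point measure \<Rightarrow> (point \<Rightarrow> complex) \<Rightarrow> bool" where
  "symmetric w \<mu> f \<longleftrightarrow> (\<forall>\<delta>. good w \<delta> \<longrightarrow> (AE a in \<mu>. f (good_homeo w \<delta> a) = f a))"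

lemma good_homeo_preserving:
  assumes "compatible w \<mu>" "good w \<delta>"
  shows "measure_preserving_self \<mu> (good_homeo w \<delta>)"
proof -
  have "distr \<mu> (C w) (good_homeo w \<delta>) = \<mu>"
    using distr_permute_point[OF assms(1) good_inv[OF assms(2)]] by (simp add: good_homeo_eq)
  moreover have "distr \<mu> \<mu> (good_homeo w \<delta>) = distr \<mu> (C w) (good_homeo w \<delta>)"
    using compatibleD(2)[OF assms(1)] by (intro distr_cong) auto
  moreover have "good_homeo w \<delta> \<in> measurable \<mu> \<mu>"
    using measurable_permute_point[OF good_inv[OF assms(2)]]
    by (simp add: good_homeo_eq measurable_cong_sets[OF compatibleD(2)[OF assms(1)] compatibleD(2)[OF assms(1)]])
  ultimately show ?thesis by (simp add: measure_preserving_self_def)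
qed

lemma L2_class_symmetric:
  assumes \<mu>: "compatible w \<mu>" and f: "f \<in> square_integrable \<mu>"
  shows "L2_class \<mu> f \<in> hcarrier (L2_symmetric w \<mu>) \<longleftrightarrow> symmetric w \<mu> f"
proof
  assume "L2_class \<mu> f \<in> hcarrier (L2_symmetric w \<mu>)"
  then show "symmetric w \<mu> f"
    using L2_class_self[OF f] by (auto simp: L2_symmetric_def symmetric_def)
next
  assume sym: "symmetric w \<mu> f"
  have "AE a in \<mu>. g (good_homeo w \<delta> a) = g a" if "good w \<delta>" "g \<in> L2_class \<mu> f" for \<delta> g
  proof -
    have gf: "AE a in \<mu>. g a = f a" using that(2) by (simp add: L2_class_def)
    have "AE a in \<mu>. f (good_homeo w \<delta> a) = f a" using sym that(1) by (simp add: symmetric_def)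
    with gf AE_measure_preserving[OF good_homeo_preserving[OF \<mu> that(1)] gf]
    show ?thesis by eventually_elim simp
  qed
  then show "L2_class \<mu> f \<in> hcarrier (L2_symmetric w \<mu>)"
    using f by (simp add: L2_symmetric_def hcarrier_L2)
qed

lemma hcarrier_L2_symmetricE:
  assumes "A \<in> hcarrier (L2_symmetric w \<mu>)"
  obtains f where "f \<in> square_integrable \<mu>" "A = L2_class \<mu> f"
  using assms by (auto simp: L2_symmetric_def hcarrier_L2)

lemma hinner_L2_symmetric [simp]: "hinner (L2_symmetric w \<mu>) = hinner (L2 \<mu>)"
  by (simp add: L2_symmetric_def)

lemma hnorm_L2_symmetric:
  assumes "f \<in> square_integrable \<mu>"
  shows "(hnorm (L2_symmetric w \<mu>) (L2_class \<mu> f))\<^sup>2 = (\<integral>a. (cmod (f a))\<^sup>2 \<partial>\<mu>)"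
proof -
  have "hinner (L2 \<mu>) (L2_class \<mu> f) (L2_class \<mu> f) = (\<integral>a. of_real ((cmod (f a))\<^sup>2) \<partial>\<mu>)"
    unfolding hinner_L2_class[OF assms assms]
    by (intro Bochner_Integration.integral_cong refl) (simp add: complex_norm_square[symmetric])
  also have "\<dots> = of_real (\<integral>a. (cmod (f a))\<^sup>2 \<partial>\<mu>)" by (rule integral_complex_of_real)
  finally show ?thesis by (simp add: hnorm_def)
qed

lemma R_mult_square_integrable:
  assumes "compatible w \<mu>" "u \<in> circle_functions" "f \<in> square_integrable \<mu>"
  shows "(\<lambda>a. R w u a * f a) \<in> square_integrable \<mu>"
  using assms(3)
proof (rule square_integrable_mult_unimodular)
  show "R w u \<in> borel_measurable \<mu>"
    by (rule measurable_compatible[OF assms(1) measurable_R[OF assms(2)]])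
qed (rule norm_R[OF assms(2)])

lemma basic_representation_class:
  assumes \<mu>: "compatible w \<mu>" and u: "u \<in> circle_functions" and f: "f \<in> square_integrable \<mu>"
    and sym: "L2_class \<mu> f \<in> hcarrier (L2_symmetric w \<mu>)"
  shows "basic_representation w \<mu> (L0_class u) (L2_class \<mu> f) = L2_class \<mu> (\<lambda>a. R w u a * f a)"
proof -
  have "(\<exists>v\<in>L0_class u. \<exists>h\<in>L2_class \<mu> f. AE a in \<mu>. g a = R w v a * h a) \<longleftrightarrow>
      (AE a in \<mu>. g a = R w u a * f a)" for g
  proof
    assume "\<exists>v\<in>L0_class u. \<exists>h\<in>L2_class \<mu> f. AE a in \<mu>. g a = R w v a * h a"
    then obtain v h where "AE b in lam. v b = u b" and h: "AE a in \<mu>. h a = f a"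
       "AE a in \<mu>. g a = R w v a * h a"
      by (auto simp: L0_class_def L2_class_def)
    from R_cong_AE[OF \<mu> this(1)] h show "AE a in \<mu>. g a = R w u a * f a"
      by eventually_elim simp
  next
    assume "AE a in \<mu>. g a = R w u a * f a"
    moreover have "u \<in> L0_class u" using u by (simp add: L0_class_def)
    ultimately show "\<exists>v\<in>L0_class u. \<exists>h\<in>L2_class \<mu> f. AE a in \<mu>. g a = R w v a * h a"
      using L2_class_self[OF f] by blast
  qed
  then show ?thesis
    using sym by (simp add: basic_representation_def L2_class_def)
qed

section \<open>Koopman representations of ergodic actions\<close>

locale ergodic_boolean_action = prob_space \<gamma> for \<gamma> :: "'a measure" +
  fixes \<zeta> :: "L0_elem \<Rightarrow> ('a \<Rightarrow> 'a) set"
  assumes action: "boolean_action \<gamma> \<zeta>" and ergodic: "ergodic_action \<gamma> \<zeta>"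
begin

abbreviation "nonfixed \<equiv> hcarrier (nonfixed_part (L2 \<gamma>) (koopman \<gamma> \<zeta>))"

text \<open>The Koopman operator of the class of \<open>u\<close> is composition with \<open>act u\<close>, so \<open>act u\<close> represents
  the action of \<open>u\<^sup>-\<^sup>1\<close>.\<close>

definition act :: "((nat \<Rightarrow> bool) \<Rightarrow> complex) \<Rightarrow> 'a \<Rightarrow> 'a" where
  "act u = (SOME t. t \<in> \<zeta> (L0_class (\<lambda>b. inverse (u b))))"

abbreviation "correl f u \<equiv> (\<integral>x. f (act u x) * cnj (f x) \<partial>\<gamma>)"

lemma \<zeta>_class:
  assumes "u \<in> circle_functions"
  obtains t where "t \<in> measure_preserving_bijections \<gamma>"
    "\<zeta> (L0_class u) = {s \<in> measure_preserving_bijections \<gamma>. AE x in \<gamma>. s x = t x}"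
proof -
  have "\<zeta> (L0_class u) \<in> carrier (Aut \<gamma>)"
    using action assms carrier_L0 unfolding boolean_action_def hom_def by blast
  then show ?thesis using that by (auto simp: Aut_def ae_classes_def)
qed

lemma mpb_preserving: "t \<in> measure_preserving_bijections \<gamma> \<Longrightarrow> measure_preserving_self \<gamma> t"
  by (simp add: measure_preserving_bijections_def measure_preserving_self_def)

lemma act_mem: "u \<in> circle_functions \<Longrightarrow> act u \<in> \<zeta> (L0_class (\<lambda>b. inverse (u b)))"
proof -
  assume u: "u \<in> circle_functions"
  obtain t where "t \<in> measure_preserving_bijections \<gamma>" "\<zeta> (L0_class (\<lambda>b. inverse (u b)))
      = {s \<in> measure_preserving_bijections \<gamma>. AE x in \<gamma>. s x = t x}"
    by (rule \<zeta>_class[OF circle_functions_inverse[OF u]])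
  then have "t \<in> \<zeta> (L0_class (\<lambda>b. inverse (u b)))" by simp
  then show ?thesis unfolding act_def some_in_eq by blast
qed

lemma \<zeta>_mpb:
  assumes "u \<in> circle_functions" "t \<in> \<zeta> (L0_class u)"
  shows "t \<in> measure_preserving_bijections \<gamma>"
  by (rule \<zeta>_class[OF assms(1)]) (use assms(2) in blast)

lemma act_mpb: "u \<in> circle_functions \<Longrightarrow> act u \<in> measure_preserving_bijections \<gamma>"
  by (rule \<zeta>_mpb[OF circle_functions_inverse act_mem])

lemma act_preserving: "u \<in> circle_functions \<Longrightarrow> measure_preserving_self \<gamma> (act u)"
  by (rule mpb_preserving[OF act_mpb])

lemma act_unique:
  assumes "u \<in> circle_functions" "t \<in> \<zeta> (L0_class (\<lambda>b. inverse (u b)))"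
  shows "AE x in \<gamma>. t x = act u x"
proof -
  obtain r where r: "\<zeta> (L0_class (\<lambda>b. inverse (u b))) = {s \<in> measure_preserving_bijections \<gamma>. AE x in \<gamma>. s x = r x}"
    by (rule \<zeta>_class[OF circle_functions_inverse[OF assms(1)]])
  have "AE x in \<gamma>. t x = r x" "AE x in \<gamma>. act u x = r x"
    using assms(2) act_mem[OF assms(1)] unfolding r by auto
  then show ?thesis by eventually_elim simp
qed

lemma act_mult:
  assumes u: "u \<in> circle_functions" and v: "v \<in> circle_functions"
  shows "AE x in \<gamma>. act (\<lambda>b. u b * v b) x = act u (act v x)"
proof -
  note iu = circle_functions_inverse[OF u] and iv = circle_functions_inverse[OF v]
  have "\<zeta> (L0_class (\<lambda>b. inverse (u b)) \<otimes>\<^bsub>L0\<^esub> L0_class (\<lambda>b. inverse (v b)))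
      = \<zeta> (L0_class (\<lambda>b. inverse (u b))) \<otimes>\<^bsub>Aut \<gamma>\<^esub> \<zeta> (L0_class (\<lambda>b. inverse (v b)))"
    using action iu iv unfolding boolean_action_def by (intro hom_mult[of \<zeta> L0]) (auto simp: carrier_L0)
  then have "\<zeta> (L0_class (\<lambda>b. inverse (u b * v b)))
      = \<zeta> (L0_class (\<lambda>b. inverse (u b))) \<otimes>\<^bsub>Aut \<gamma>\<^esub> \<zeta> (L0_class (\<lambda>b. inverse (v b)))"
    by (simp add: mult_L0[OF iu iv])
  then have "act (\<lambda>b. u b * v b) \<in> \<zeta> (L0_class (\<lambda>b. inverse (u b))) \<otimes>\<^bsub>Aut \<gamma>\<^esub> \<zeta> (L0_class (\<lambda>b. inverse (v b)))"
    using act_mem[OF circle_functions_mult[OF u v]] by simp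
  then obtain r s where r: "r \<in> \<zeta> (L0_class (\<lambda>b. inverse (u b)))" and s: "s \<in> \<zeta> (L0_class (\<lambda>b. inverse (v b)))"
    and eq: "AE x in \<gamma>. act (\<lambda>b. u b * v b) x = r (s x)"
    by (auto simp: Aut_def)
  have "AE x in \<gamma>. r (act v x) = act u (act v x)"
    by (rule AE_measure_preserving[OF act_preserving[OF v] act_unique[OF u r]])
  with eq act_unique[OF v s] show ?thesis by eventually_elim simp
qed

lemma act_commute:
  assumes u: "u \<in> circle_functions" and v: "v \<in> circle_functions"
  shows "AE x in \<gamma>. act u (act v x) = act v (act u x)"
  using act_mult[OF u v] act_mult[OF v u] by eventually_elim (simp add: mult.commute)

text \<open>By \<open>act_mult\<close> the representative is idempotent almost everywhere; being a
  bijection of the space, it can then be cancelled.\<close>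

lemma act_one: "AE x in \<gamma>. act (\<lambda>_. 1) x = x"
proof -
  note one = circle_functions_one
  have bij: "bij_betw (act (\<lambda>_. 1)) (space \<gamma>) (space \<gamma>)"
    using act_mpb[OF one] by (simp add: measure_preserving_bijections_def)
  have "AE x in \<gamma>. act (\<lambda>_. 1) x = act (\<lambda>_. 1) (act (\<lambda>_. 1) x)"
    using act_mult[OF one one] by simp
  with AE_space AE_measure_preserving[OF act_preserving[OF one] AE_space] show ?thesis
    by eventually_elim (metis bij bij_betw_inv_into_left)
qed

lemma act_inverse:
  assumes u: "u \<in> circle_functions"
  shows "AE x in \<gamma>. act (\<lambda>b. inverse (u b)) (act u x) = x"
proof -
  have "inverse (u b) * u b = 1" for b using circle_functionsD(3)[OF u] by simp
  then have "AE x in \<gamma>. act (\<lambda>_. 1) x = act (\<lambda>b. inverse (u b)) (act u x)"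
    using act_mult[OF circle_functions_inverse[OF u] u] by simp
  with act_one show ?thesis by eventually_elim simp
qed

text \<open>The ergodicity hypothesis speaks of images under all representatives,
  \<open>invariant_set\<close> of preimages under the chosen ones. The image of \<open>E\<close> is
  measurable as a preimage under the inverse bijection; the symmetric difference is tested at
  \<open>t x\<close>, and the conclusion returns to \<gamma> because \<open>t\<close> preserves
  it.\<close>

lemma invariant_zero_one:
  assumes "invariant_set \<gamma> (act ` circle_functions) E"
  shows "prob E \<in> {0, 1}"
proof -
  have E [measurable]: "E \<in> sets \<gamma>" using assms by (simp add: invariant_set_def)
  have "measure \<gamma> (sym_diff (t ` E) E) = 0" if \<phi>: "\<phi> \<in> carrier L0" and t: "t \<in> \<zeta> \<phi>" for \<phi> t
  proof -
    obtain v where v: "v \<in> circle_functions" "\<phi> = L0_class v" using \<phi> by (auto simp: carrier_L0)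
    define u where "u = (\<lambda>b. inverse (v b))"
    have u: "u \<in> circle_functions" unfolding u_def by (rule circle_functions_inverse[OF v(1)])
    have t': "t \<in> \<zeta> (L0_class (\<lambda>b. inverse (u b)))" using t v(2) by (simp add: u_def)
    have mpb: "t \<in> measure_preserving_bijections \<gamma>"
      by (rule \<zeta>_mpb[OF circle_functions_inverse[OF u] t'])
    then have bij: "bij_betw t (space \<gamma>) (space \<gamma>)" and tm [measurable]: "t \<in> measurable \<gamma> \<gamma>"
      and inv_m: "the_inv_into (space \<gamma>) t \<in> measurable \<gamma> \<gamma>" and d: "distr \<gamma> \<gamma> t = \<gamma>"
      by (auto simp: measure_preserving_bijections_def)
    have inj: "inj_on t (space \<gamma>)" using bij by (rule bij_betw_imp_inj_on)
    have sub: "E \<subseteq> space \<gamma>" using E by (rule sets.sets_into_space)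
    have "t ` E = the_inv_into (space \<gamma>) t -` E \<inter> space \<gamma>"
    proof (intro equalityI subsetI)
      fix y assume "y \<in> t ` E"
      then show "y \<in> the_inv_into (space \<gamma>) t -` E \<inter> space \<gamma>"
        using sub inj bij by (auto simp: the_inv_into_f_f bij_betw_def)
    next
      fix y assume y: "y \<in> the_inv_into (space \<gamma>) t -` E \<inter> space \<gamma>"
      then have "t (the_inv_into (space \<gamma>) t y) = y"
        using f_the_inv_into_f_bij_betw[OF bij] by blast
      then show "y \<in> t ` E" using y by force
    qed
    then have tE [measurable]: "t ` E \<in> sets \<gamma>" using measurable_sets[OF inv_m E] by simp
    have "AE x in \<gamma>. act u x \<in> E \<longleftrightarrow> x \<in> E"
      using assms u by (simp add: invariant_set_def)
    with act_unique[OF u t'] AE_space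
    have "AE x in \<gamma>. t x \<notin> sym_diff (t ` E) E"
    proof eventually_elim
      case (elim x)
      then have "t x \<in> t ` E \<longleftrightarrow> x \<in> E" using inj_on_image_mem_iff[OF inj _ sub, of x] by simp
      then show ?case using elim by auto
    qed
    then have "AE x in distr \<gamma> \<gamma> t. x \<notin> sym_diff (t ` E) E"
      by (subst AE_distr_iff) measurable
    then have "AE x in \<gamma>. x \<notin> sym_diff (t ` E) E" by (simp only: d)
    then show ?thesis by (subst prob_eq_0) auto
  qed
  then show ?thesis using ergodic E by (simp add: ergodic_action_def)
qed

lemma koopman_class:
  assumes u: "u \<in> circle_functions" and f: "f \<in> square_integrable \<gamma>"
  shows "koopman \<gamma> \<zeta> (L0_class u) (L2_class \<gamma> f) = L2_class \<gamma> (\<lambda>x. f (act u x))"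
proof -
  have inv: "inv\<^bsub>L0\<^esub> (L0_class u) = L0_class (\<lambda>b. inverse (u b))"
  proof (rule group.inv_equality)
    show "group L0" using comm_group_L0 by (simp add: comm_group_def)
    show "L0_class (\<lambda>b. inverse (u b)) \<otimes>\<^bsub>L0\<^esub> L0_class u = \<one>\<^bsub>L0\<^esub>"
      using circle_functionsD(3)[OF u] by (simp add: mult_L0[OF circle_functions_inverse[OF u] u] one_L0)
  qed (use u circle_functions_inverse in \<open>auto simp: carrier_L0\<close>)
  have "(\<exists>h\<in>L2_class \<gamma> f. \<exists>t\<in>\<zeta> (L0_class (\<lambda>b. inverse (u b))). AE x in \<gamma>. g x = h (t x)) \<longleftrightarrow>
      (AE x in \<gamma>. g x = f (act u x))" for g
  proof
    assume "\<exists>h\<in>L2_class \<gamma> f. \<exists>t\<in>\<zeta> (L0_class (\<lambda>b. inverse (u b))). AE x in \<gamma>. g x = h (t x)"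
    then obtain h t where "AE x in \<gamma>. h x = f x" "t \<in> \<zeta> (L0_class (\<lambda>b. inverse (u b)))"
      "AE x in \<gamma>. g x = h (t x)"
      by (auto simp: L2_class_def)
    from this(3) AE_measure_preserving[OF act_preserving[OF u] this(1)] act_unique[OF u this(2)]
    show "AE x in \<gamma>. g x = f (act u x)" by eventually_elim simp
  next
    assume "AE x in \<gamma>. g x = f (act u x)"
    then show "\<exists>h\<in>L2_class \<gamma> f. \<exists>t\<in>\<zeta> (L0_class (\<lambda>b. inverse (u b))). AE x in \<gamma>. g x = h (t x)"
      using L2_class_self[OF f] act_mem[OF u] by blast
  qed
  then show ?thesis
    using f by (simp add: koopman_def inv hcarrier_L2 L2_class_def)
qed

lemma invariant_const:
  assumes f: "f \<in> square_integrable \<gamma>"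
    and inv: "\<And>u. u \<in> circle_functions \<Longrightarrow> AE x in \<gamma>. f (act u x) = f x"
  shows "\<exists>c. AE x in \<gamma>. f x = c"
proof -
  have int: "integrable \<gamma> f" by (rule square_integrable_imp_integrable[OF f])
  have const: "AE x in \<gamma>. h x = expectation h"
    if h: "integrable \<gamma> h" and hi: "\<And>u. u \<in> circle_functions \<Longrightarrow> AE x in \<gamma>. h (act u x) = h x" for h :: "'a \<Rightarrow> real"
  proof (rule zero_one_imp_AE_const[OF h])
    fix c
    have [measurable]: "h \<in> borel_measurable \<gamma>" using h by (rule borel_measurable_integrable)
    have "AE x in \<gamma>. act u x \<in> {x \<in> space \<gamma>. h x < c} \<longleftrightarrow> x \<in> {x \<in> space \<gamma>. h x < c}"
      if "u \<in> circle_functions" for u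
      using hi[OF that] AE_measure_preserving[OF act_preserving[OF that] AE_space] AE_space
      by eventually_elim simp
    then have "invariant_set \<gamma> (act ` circle_functions) {x \<in> space \<gamma>. h x < c}"
      unfolding invariant_set_def by auto
    then show "prob {x \<in> space \<gamma>. h x < c} \<in> {0, 1}" by (rule invariant_zero_one)
  qed
  have "AE x in \<gamma>. Re (f x) = expectation (\<lambda>x. Re (f x))"
  proof (rule const)
    show "integrable \<gamma> (\<lambda>x. Re (f x))" using int by simp
    show "AE x in \<gamma>. Re (f (act u x)) = Re (f x)" if "u \<in> circle_functions" for u
      using inv[OF that] by eventually_elim simp
  qed
  moreover have "AE x in \<gamma>. Im (f x) = expectation (\<lambda>x. Im (f x))"
  proof (rule const)
    show "integrable \<gamma> (\<lambda>x. Im (f x))" using int by simp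
    show "AE x in \<gamma>. Im (f (act u x)) = Im (f x)" if "u \<in> circle_functions" for u
      using inv[OF that] by eventually_elim simp
  qed
  ultimately have "AE x in \<gamma>. f x = Complex (expectation (\<lambda>x. Re (f x))) (expectation (\<lambda>x. Im (f x)))"
    by eventually_elim (simp add: complex_eq_iff)
  then show ?thesis by blast
qed

text \<open>By ergodicity the fixed vectors are the constants, so being orthogonal to them means
  having mean zero.\<close>

lemma nonfixed_iff:
  assumes f: "f \<in> square_integrable \<gamma>"
  shows "L2_class \<gamma> f \<in> nonfixed \<longleftrightarrow> (\<integral>x. f x \<partial>\<gamma>) = 0"
proof
  assume "L2_class \<gamma> f \<in> nonfixed"
  moreover have "L2_class \<gamma> (\<lambda>_. 1) \<in> hcarrier (L2 \<gamma>)"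
    using square_integrable_one by (simp add: hcarrier_L2)
  moreover have "\<forall>\<phi>\<in>carrier L0. koopman \<gamma> \<zeta> \<phi> (L2_class \<gamma> (\<lambda>_. 1)) = L2_class \<gamma> (\<lambda>_. 1)"
    using koopman_class[OF _ square_integrable_one] by (auto simp: carrier_L0)
  ultimately have "hinner (L2 \<gamma>) (L2_class \<gamma> f) (L2_class \<gamma> (\<lambda>_. 1)) = 0"
    by (simp add: nonfixed_part_def)
  then show "(\<integral>x. f x \<partial>\<gamma>) = 0"
    by (simp add: hinner_L2_class[OF f square_integrable_one])
next
  assume f0: "(\<integral>x. f x \<partial>\<gamma>) = 0"
  have "hinner (L2 \<gamma>) (L2_class \<gamma> f) w = 0"
    if w: "w \<in> hcarrier (L2 \<gamma>)" and fixed: "\<forall>\<phi>\<in>carrier L0. koopman \<gamma> \<zeta> \<phi> w = w" for w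
  proof -
    obtain g where g: "g \<in> square_integrable \<gamma>" "w = L2_class \<gamma> g" using w by (auto simp: hcarrier_L2)
    have "AE x in \<gamma>. g (act u x) = g x" if u: "u \<in> circle_functions" for u
    proof -
      have "L2_class \<gamma> (\<lambda>x. g (act u x)) = L2_class \<gamma> g"
        using fixed u koopman_class[OF u g(1)] by (auto simp: carrier_L0 g(2))
      then show ?thesis
        by (simp add: L2_class_eq_iff[OF square_integrable_compose[OF g(1) act_preserving[OF u]]])
    qed
    from invariant_const[OF g(1) this] obtain c where c: "AE x in \<gamma>. g x = c" by blast
    have "(\<integral>x. f x * cnj (g x) \<partial>\<gamma>) = (\<integral>x. f x * cnj c \<partial>\<gamma>)"
    proof (rule integral_cong_AE)
      show "AE x in \<gamma>. f x * cnj (g x) = f x * cnj c" using c by eventually_elim simp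
    qed (use f g in \<open>auto simp: square_integrable_def\<close>)
    then show ?thesis using f0 by (simp add: g(2) hinner_L2_class[OF f g(1)])
  qed
  then show "L2_class \<gamma> f \<in> nonfixed"
    using f by (simp add: nonfixed_part_def hcarrier_L2)
qed

end

section \<open>Transfer along the isomorphism with the sum of basic representations\<close>

locale associated_action = ergodic_boolean_action \<gamma> \<zeta>
  for \<gamma> :: "'a measure" and \<zeta> :: "L0_elem \<Rightarrow> ('a \<Rightarrow> 'a) set" +
  fixes M :: "exponents \<Rightarrow> nat \<Rightarrow> point measure"
  assumes assoc: "associated_family (L2 \<gamma>) (koopman \<gamma> \<zeta>) M"
begin

abbreviation "I \<equiv> NZ \<times> {1 :: nat..}"

abbreviation "HS \<equiv> hilbert_sum I (\<lambda>(w, j). L2_symmetric w (M w j))"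

abbreviation "RS \<equiv> representation_sum I (\<lambda>(w, j). L2_symmetric w (M w j)) (\<lambda>(w, j). basic_representation w (M w j))"

lemma compat: "w \<in> NZ \<Longrightarrow> j \<ge> 1 \<Longrightarrow> compatible w (M w j)"
  and ac_Suc: "w \<in> NZ \<Longrightarrow> j \<ge> 1 \<Longrightarrow> absolutely_continuous (M w j) (M w (Suc j))"
  using assoc unfolding associated_family_def by blast+

text \<open>Vectors of the Hilbert sum are handled through families of representative functions, to
  which pointwise formulas apply; \<open>admissible\<close> collects what makes such a family a
  vector.\<close>

definition vec :: "(exponents \<Rightarrow> nat \<Rightarrow> point \<Rightarrow> complex) \<Rightarrow> exponents \<times> nat \<Rightarrow> (point \<Rightarrow> complex) set" where
  "vec G = (\<lambda>i\<in>I. case i of (w, j) \<Rightarrow> L2_class (M w j) (G w j))"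

definition admissible :: "(exponents \<Rightarrow> nat \<Rightarrow> point \<Rightarrow> complex) \<Rightarrow> bool" where
  "admissible G \<longleftrightarrow>
     (\<forall>w\<in>NZ. \<forall>j\<ge>1. G w j \<in> square_integrable (M w j) \<and> symmetric w (M w j) (G w j)) \<and>
     (\<lambda>(w, j). \<integral>\<alpha>. (cmod (G w j \<alpha>))\<^sup>2 \<partial>M w j) summable_on I"

lemma vec_apply: "w \<in> NZ \<Longrightarrow> j \<ge> 1 \<Longrightarrow> vec G (w, j) = L2_class (M w j) (G w j)"
  by (simp add: vec_def)

lemma vec_mem:
  assumes G: "admissible G"
  shows "vec G \<in> hcarrier HS"
proof -
  have si: "G w j \<in> square_integrable (M w j)" "L2_class (M w j) (G w j) \<in> hcarrier (L2_symmetric w (M w j))"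
    if "w \<in> NZ" "j \<ge> 1" for w j
    using G that L2_class_symmetric[OF compat[OF that]] by (auto simp: admissible_def)
  have "(\<lambda>i. (hnorm (case i of (w, j) \<Rightarrow> L2_symmetric w (M w j)) (vec G i))\<^sup>2) summable_on I \<longleftrightarrow>
      (\<lambda>(w, j). \<integral>\<alpha>. (cmod (G w j \<alpha>))\<^sup>2 \<partial>M w j) summable_on I"
    by (rule summable_on_cong) (auto simp: vec_apply hnorm_L2_symmetric si)
  then show ?thesis
    using G si by (auto simp: hilbert_sum_def vec_def admissible_def)
qed

lemma vec_exists:
  assumes "\<Phi> \<in> hcarrier HS"
  shows "\<exists>G. admissible G \<and> \<Phi> = vec G"
proof -
  have ext: "\<Phi> \<in> extensional I"
    and mem: "\<And>w j. w \<in> NZ \<Longrightarrow> j \<ge> 1 \<Longrightarrow> \<Phi> (w, j) \<in> hcarrier (L2_symmetric w (M w j))"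
    and summ: "(\<lambda>i. (hnorm (case i of (w, j) \<Rightarrow> L2_symmetric w (M w j)) (\<Phi> i))\<^sup>2) summable_on I"
    using assms by (auto simp: hilbert_sum_def PiE_iff)
  define G where "G w j = (SOME f. f \<in> square_integrable (M w j) \<and> \<Phi> (w, j) = L2_class (M w j) f)" for w j
  have G: "G w j \<in> square_integrable (M w j) \<and> \<Phi> (w, j) = L2_class (M w j) (G w j)" if "w \<in> NZ" "j \<ge> 1" for w j
  proof -
    have "\<exists>f. f \<in> square_integrable (M w j) \<and> \<Phi> (w, j) = L2_class (M w j) f"
      by (rule hcarrier_L2_symmetricE[OF mem[OF that]]) blast
    then show ?thesis unfolding G_def by (rule someI_ex)
  qed
  have "\<Phi> = vec G"
  proof
    fix i show "\<Phi> i = vec G i"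
      using ext G by (cases i) (auto simp: vec_def extensional_def)
  qed
  moreover have "admissible G"
    unfolding admissible_def
  proof (intro conjI ballI allI impI)
    fix w j assume wj: "w \<in> NZ" "(j :: nat) \<ge> 1"
    show "G w j \<in> square_integrable (M w j)" using G[OF wj] by blast
    show "symmetric w (M w j) (G w j)"
      using L2_class_symmetric[OF compat[OF wj], of "G w j"] G[OF wj] mem[OF wj] by simp
  next
    have "(\<lambda>i. (hnorm (case i of (w, j) \<Rightarrow> L2_symmetric w (M w j)) (\<Phi> i))\<^sup>2) summable_on I \<longleftrightarrow>
      (\<lambda>(w, j). \<integral>\<alpha>. (cmod (G w j \<alpha>))\<^sup>2 \<partial>M w j) summable_on I"
      by (rule summable_on_cong) (use G hnorm_L2_symmetric in fastforce)
    with summ show "(\<lambda>(w, j). \<integral>\<alpha>. (cmod (G w j \<alpha>))\<^sup>2 \<partial>M w j) summable_on I" by simp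
  qed
  ultimately show ?thesis by blast
qed

lemma RS_vec:
  assumes G: "admissible G" and u: "u \<in> circle_functions"
  shows "RS (L0_class u) (vec G) = vec (\<lambda>w j \<alpha>. R w u \<alpha> * G w j \<alpha>)"
proof
  fix i
  have "basic_representation w (M w j) (L0_class u) (L2_class (M w j) (G w j))
      = L2_class (M w j) (\<lambda>\<alpha>. R w u \<alpha> * G w j \<alpha>)" if "w \<in> NZ" "j \<ge> 1" for w j
    using G that L2_class_symmetric[OF compat[OF that]]
    by (intro basic_representation_class[OF compat[OF that] u]) (auto simp: admissible_def)
  then show "RS (L0_class u) (vec G) i = vec (\<lambda>w j \<alpha>. R w u \<alpha> * G w j \<alpha>) i"
    using vec_mem[OF G] by (cases i) (auto simp: representation_sum_def vec_def)
qed

lemma hinner_vec: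
  assumes G: "admissible G" and u: "u \<in> circle_functions"
  shows "hinner HS (vec (\<lambda>w j \<alpha>. R w u \<alpha> * G w j \<alpha>)) (vec G)
    = (\<Sum>\<^sub>\<infinity>(w, j)\<in>I. \<integral>\<alpha>. R w u \<alpha> * of_real ((cmod (G w j \<alpha>))\<^sup>2) \<partial>M w j)"
proof -
  have "hinner (L2 (M w j)) (L2_class (M w j) (\<lambda>\<alpha>. R w u \<alpha> * G w j \<alpha>)) (L2_class (M w j) (G w j))
      = (\<integral>\<alpha>. R w u \<alpha> * of_real ((cmod (G w j \<alpha>))\<^sup>2) \<partial>M w j)" if "w \<in> NZ" "j \<ge> 1" for w j
  proof -
    have g: "G w j \<in> square_integrable (M w j)" using G that by (auto simp: admissible_def)
    show ?thesis
      unfolding hinner_L2_class[OF R_mult_square_integrable[OF compat[OF that] u g] g]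
      by (intro Bochner_Integration.integral_cong refl) (simp add: complex_norm_square[symmetric] mult.assoc)
  qed
  then show ?thesis
    unfolding hilbert_sum_def by (auto intro!: infsum_cong simp: vec_apply)
qed

lemma isometry:
  "\<exists>V. bij_betw V (nonfixed) (hcarrier HS) \<and>
    (\<forall>a\<in>nonfixed. \<forall>b\<in>nonfixed. hinner HS (V a) (V b) = hinner (L2 \<gamma>) a b) \<and>
    (\<forall>u\<in>circle_functions. \<forall>a\<in>nonfixed. V (koopman \<gamma> \<zeta> (L0_class u) a) = RS (L0_class u) (V a))"
proof -
  have hin: "hinner (nonfixed_part (L2 \<gamma>) (koopman \<gamma> \<zeta>)) = hinner (L2 \<gamma>)"
    by (simp add: nonfixed_part_def)
  obtain V where "isometric_iso (nonfixed_part (L2 \<gamma>) (koopman \<gamma> \<zeta>)) HS V"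
    "\<forall>\<phi>\<in>carrier L0. \<forall>v\<in>nonfixed. V (koopman \<gamma> \<zeta> \<phi> v) = RS \<phi> (V v)"
    using assoc unfolding associated_family_def isomorphic_representations_def by blast
  then show ?thesis
    unfolding isometric_iso_def hin carrier_L0 by (intro exI[of _ V]) simp
qed

lemma expectation_act:
  assumes "f \<in> square_integrable \<gamma>" "u \<in> circle_functions"
  shows "(\<integral>r. f (act u r) \<partial>\<gamma>) = (\<integral>r. f r \<partial>\<gamma>)"
proof -
  have "act u \<in> measurable \<gamma> \<gamma>" "distr \<gamma> \<gamma> (act u) = \<gamma>"
    using act_preserving[OF assms(2)] by (auto simp: measure_preserving_self_def)
  then show ?thesis
    using integral_distr[of "act u" \<gamma> \<gamma> f] assms(1) by (simp add: square_integrable_def)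
qed

lemma koopman_nonfixed:
  assumes f: "f \<in> square_integrable \<gamma>" "(\<integral>r. f r \<partial>\<gamma>) = 0" and u: "u \<in> circle_functions"
  shows "L2_class \<gamma> (\<lambda>r. f (act u r)) \<in> nonfixed"
  by (subst nonfixed_iff[OF square_integrable_compose[OF f(1) act_preserving[OF u]]])
     (simp add: expectation_act[OF f(1) u] f(2))

text \<open>Mean zero places the class of \<open>f\<close> in the domain of the isometry. Its image
  has components \<open>G w j\<close>, on which the representation multiplies by
  \<open>R w u\<close>, so that only the squared moduli enter.\<close>

lemma spectral_decomposition:
  assumes f: "f \<in> square_integrable \<gamma>" "(\<integral>r. f r \<partial>\<gamma>) = 0"
  shows "\<exists>G. admissible G \<and> (\<forall>u\<in>circle_functions. correl f u
     = (\<Sum>\<^sub>\<infinity>(w, j)\<in>I. \<integral>\<alpha>. R w u \<alpha> * of_real ((cmod (G w j \<alpha>))\<^sup>2) \<partial>M w j))"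
proof -
  obtain V where V: "bij_betw V (nonfixed) (hcarrier HS)"
    "\<forall>a\<in>nonfixed. \<forall>b\<in>nonfixed. hinner HS (V a) (V b) = hinner (L2 \<gamma>) a b"
    "\<forall>u\<in>circle_functions. \<forall>a\<in>nonfixed. V (koopman \<gamma> \<zeta> (L0_class u) a) = RS (L0_class u) (V a)"
    using isometry by blast
  have nf: "L2_class \<gamma> f \<in> nonfixed"
    by (simp add: nonfixed_iff[OF f(1)] f(2))
  then have "V (L2_class \<gamma> f) \<in> hcarrier HS" using V(1) by (rule bij_betwE[rule_format, rotated])
  from vec_exists[OF this] obtain G where G: "admissible G" "V (L2_class \<gamma> f) = vec G" by blast
  have "correl f u
     = (\<Sum>\<^sub>\<infinity>(w, j)\<in>I. \<integral>\<alpha>. R w u \<alpha> * of_real ((cmod (G w j \<alpha>))\<^sup>2) \<partial>M w j)" if u: "u \<in> circle_functions" for u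
  proof -
    have "correl f u = hinner (L2 \<gamma>) (L2_class \<gamma> (\<lambda>r. f (act u r))) (L2_class \<gamma> f)"
      by (rule hinner_L2_class[OF square_integrable_compose[OF f(1) act_preserving[OF u]] f(1), symmetric])
    also have "\<dots> = hinner HS (V (koopman \<gamma> \<zeta> (L0_class u) (L2_class \<gamma> f))) (V (L2_class \<gamma> f))"
      using V(2)[rule_format, OF koopman_nonfixed[OF f u] nf] by (simp only: koopman_class[OF u f(1)])
    also have "\<dots> = hinner HS (vec (\<lambda>w j \<alpha>. R w u \<alpha> * G w j \<alpha>)) (vec G)"
      by (simp only: V(3)[rule_format, OF u nf] G(2) RS_vec[OF G(1) u])
    finally show ?thesis by (simp only: hinner_vec[OF G(1) u])
  qed
  with G(1) show ?thesis by blast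
qed

text \<open>The criterion behind both operations on measures: it suffices to find a mean-zero
  function whose correlation is the transform of a finite measure living off the diagonals.\<close>

lemma spectral_absolutely_continuous:
  assumes z: "z \<in> NZ" and f: "f \<in> square_integrable \<gamma>" "(\<integral>r. f r \<partial>\<gamma>) = 0"
    and \<sigma>: "finite_measure \<sigma>" "sets \<sigma> = sets (C z)" "AE \<alpha> in \<sigma>. inj_on \<alpha> (D z)"
    and eq: "\<And>u. u \<in> circle_functions \<Longrightarrow> correl f u = (\<integral>\<alpha>. R z u \<alpha> \<partial>\<sigma>)"
  shows "absolutely_continuous (M z 1) \<sigma>"
proof -
  obtain G where G: "admissible G" "\<And>u. u \<in> circle_functions \<Longrightarrow> correl f u
     = (\<Sum>\<^sub>\<infinity>(w, j)\<in>I. \<integral>\<alpha>. R w u \<alpha> * of_real ((cmod (G w j \<alpha>))\<^sup>2) \<partial>M w j)"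
    using spectral_decomposition[OF f] by blast
  interpret spectral_match M "\<lambda>w j \<alpha>. (cmod (G w j \<alpha>))\<^sup>2" z \<sigma>
  proof (intro spectral_match.intro spectral_family.intro spectral_match_axioms.intro)
    show "compatible w (M w j)" if "w \<in> NZ" "j \<ge> 1" for w j by (rule compat[OF that])
    show "absolutely_continuous (M w j) (M w (Suc j))" if "w \<in> NZ" "j \<ge> 1" for w j by (rule ac_Suc[OF that])
    show "integrable (M w j) (\<lambda>\<alpha>. (cmod (G w j \<alpha>))\<^sup>2)" if "w \<in> NZ" "j \<ge> 1" for w j
      using G(1) that by (auto simp: admissible_def square_integrable_def)
    show "(\<lambda>(w, j). \<integral>\<alpha>. (cmod (G w j \<alpha>))\<^sup>2 \<partial>M w j) summable_on NZ \<times> {1..}"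
      using G(1) by (simp add: admissible_def)
    show "(\<Sum>\<^sub>\<infinity>(w, j)\<in>NZ \<times> {1..}. \<integral>\<alpha>. R w u \<alpha> * of_real ((cmod (G w j \<alpha>))\<^sup>2) \<partial>M w j) = (\<integral>\<alpha>. R z u \<alpha> \<partial>\<sigma>)"
      if "u \<in> circle_functions" for u
      using G(2)[OF that] eq[OF that] by simp
  qed (simp_all add: z \<sigma>)
  show ?thesis by (rule absolutely_continuous_spectral)
qed

text \<open>The opposite direction: \<open>b\<close> is placed in the single summand
  \<open>(x, 1)\<close> and pulled back along the isometry. The last clause holds because the
  isometry intertwines and is injective, so whatever fixes \<open>b\<close> fixes
  \<open>f\<close>.\<close>

lemma realize_symmetric:
  assumes x: "x \<in> NZ" and b: "b \<in> square_integrable (M x 1)" "symmetric x (M x 1) b"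
  shows "\<exists>f\<in>square_integrable \<gamma>. (\<integral>r. f r \<partial>\<gamma>) = 0 \<and>
    (\<forall>u\<in>circle_functions. correl f u
       = (\<integral>\<alpha>. R x u \<alpha> * of_real ((cmod (b \<alpha>))\<^sup>2) \<partial>M x 1)) \<and>
    (\<forall>u\<in>circle_functions. (AE \<alpha> in M x 1. R x u \<alpha> * b \<alpha> = b \<alpha>) \<longrightarrow>
       (AE r in \<gamma>. f (act u r) = f r))"
proof -
  obtain V where V: "bij_betw V (nonfixed) (hcarrier HS)"
    "\<forall>a\<in>nonfixed. \<forall>b\<in>nonfixed. hinner HS (V a) (V b) = hinner (L2 \<gamma>) a b"
    "\<forall>u\<in>circle_functions. \<forall>a\<in>nonfixed. V (koopman \<gamma> \<zeta> (L0_class u) a) = RS (L0_class u) (V a)"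
    using isometry by blast
  define G where "G w j = (if w = x \<and> j = 1 then b else (\<lambda>_. 0))" for w and j :: nat
  have G0: "G w j = (\<lambda>_. 0)" if "(w, j) \<in> I - {(x, 1)}" for w j
    using that by (auto simp: G_def)
  have G: "admissible G"
    unfolding admissible_def
  proof (intro conjI ballI allI impI)
    show "G w j \<in> square_integrable (M w j)" for w j
      using b(1) square_integrable_zero by (cases "w = x \<and> j = 1") (auto simp: G_def)
    show "symmetric w (M w j) (G w j)" for w j
      using b(2) by (cases "w = x \<and> j = 1") (auto simp: G_def symmetric_def)
    show "(\<lambda>(w, j). \<integral>\<alpha>. (cmod (G w j \<alpha>))\<^sup>2 \<partial>M w j) summable_on I"
    proof -
      have "(\<lambda>(w, j). \<integral>\<alpha>. (cmod (G w j \<alpha>))\<^sup>2 \<partial>M w j) summable_on I \<longleftrightarrow>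
          (\<lambda>(w, j). \<integral>\<alpha>. (cmod (G w j \<alpha>))\<^sup>2 \<partial>M w j) summable_on {(x, 1 :: nat)}"
      proof (rule summable_on_cong_neutral)
        fix i assume "i \<in> I - {(x, 1)}"
        then show "(case i of (w, j) \<Rightarrow> \<integral>\<alpha>. (cmod (G w j \<alpha>))\<^sup>2 \<partial>M w j) = 0"
          by (cases i) (simp only: prod.case G0, simp)
      qed (use x in auto)
      then show ?thesis by simp
    qed
  qed
  obtain a where a: "a \<in> nonfixed" "V a = vec G"
  proof -
    have "vec G \<in> V ` nonfixed"
      unfolding bij_betw_imp_surj_on[OF V(1)] by (rule vec_mem[OF G])
    then show thesis by (rule imageE) (rule that, simp_all)
  qed
  obtain f where f: "f \<in> square_integrable \<gamma>" "a = L2_class \<gamma> f"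
    using a(1) by (auto simp: nonfixed_part_def hcarrier_L2)
  have nf: "L2_class \<gamma> f \<in> nonfixed"
    and Vf: "V (L2_class \<gamma> f) = vec G" using a f(2) by auto
  have f0: "(\<integral>r. f r \<partial>\<gamma>) = 0" using nf by (simp add: nonfixed_iff[OF f(1)])
  have VU: "V (L2_class \<gamma> (\<lambda>r. f (act u r))) = vec (\<lambda>w j \<alpha>. R w u \<alpha> * G w j \<alpha>)"
    if u: "u \<in> circle_functions" for u
    using V(3)[rule_format, OF u nf] by (simp only: Vf RS_vec[OF G u] koopman_class[OF u f(1)])
  have "correl f u = (\<integral>\<alpha>. R x u \<alpha> * of_real ((cmod (b \<alpha>))\<^sup>2) \<partial>M x 1)"
    if u: "u \<in> circle_functions" for u
  proof -
    have "correl f u = hinner (L2 \<gamma>) (L2_class \<gamma> (\<lambda>r. f (act u r))) (L2_class \<gamma> f)"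
      by (rule hinner_L2_class[OF square_integrable_compose[OF f(1) act_preserving[OF u]] f(1), symmetric])
    also have "\<dots> = hinner HS (vec (\<lambda>w j \<alpha>. R w u \<alpha> * G w j \<alpha>)) (vec G)"
      using V(2)[rule_format, OF koopman_nonfixed[OF f(1) f0 u] nf] by (simp only: VU[OF u] Vf)
    also have "\<dots> = (\<Sum>\<^sub>\<infinity>(w, j)\<in>I. \<integral>\<alpha>. R w u \<alpha> * of_real ((cmod (G w j \<alpha>))\<^sup>2) \<partial>M w j)"
      by (rule hinner_vec[OF G u])
    also have "\<dots> = (\<Sum>\<^sub>\<infinity>(w, j)\<in>{(x, 1)}. \<integral>\<alpha>. R w u \<alpha> * of_real ((cmod (G w j \<alpha>))\<^sup>2) \<partial>M w j)"
    proof (rule infsum_cong_neutral)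
      fix i assume "i \<in> I - {(x, 1)}"
      then show "(case i of (w, j) \<Rightarrow> \<integral>\<alpha>. R w u \<alpha> * of_real ((cmod (G w j \<alpha>))\<^sup>2) \<partial>M w j) = 0"
        by (cases i) (simp only: prod.case G0, simp)
    qed (use x in auto)
    also have "\<dots> = (\<integral>\<alpha>. R x u \<alpha> * of_real ((cmod (b \<alpha>))\<^sup>2) \<partial>M x 1)"
      by (simp add: G_def)
    finally show ?thesis .
  qed
  moreover have "AE r in \<gamma>. f (act u r) = f r"
    if u: "u \<in> circle_functions" and fixes_b: "AE \<alpha> in M x 1. R x u \<alpha> * b \<alpha> = b \<alpha>" for u
  proof -
    have "L2_class (M w j) (\<lambda>\<alpha>. R w u \<alpha> * G w j \<alpha>) = L2_class (M w j) (G w j)"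
      if wj: "w \<in> NZ" "j \<ge> 1" for w j
    proof -
      have "G w j \<in> square_integrable (M w j)" using G wj by (auto simp: admissible_def)
      moreover have "AE \<alpha> in M w j. R w u \<alpha> * G w j \<alpha> = G w j \<alpha>"
        using fixes_b by (cases "w = x \<and> j = 1") (auto simp: G_def simp del: One_nat_def)
      ultimately show ?thesis
        using L2_class_eq_iff[OF R_mult_square_integrable[OF compat[OF wj] u]] by blast
    qed
    then have "vec (\<lambda>w j \<alpha>. R w u \<alpha> * G w j \<alpha>) = vec G"
      unfolding vec_def by (intro restrict_ext) auto
    then have "V (L2_class \<gamma> (\<lambda>r. f (act u r))) = V (L2_class \<gamma> f)"
      by (simp only: VU[OF u] Vf)
    then have "L2_class \<gamma> (\<lambda>r. f (act u r)) = L2_class \<gamma> f"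
      by (rule inj_onD[OF bij_betw_imp_inj_on[OF V(1)] _ koopman_nonfixed[OF f(1) f0 u] nf])
    then show ?thesis
      by (simp add: L2_class_eq_iff[OF square_integrable_compose[OF f(1) act_preserving[OF u]]])
  qed
  ultimately show ?thesis using f(1) f0 by blast
qed

end

section \<open>Dilations\<close>

lemma lookup_dilate: "Poly_Mapping.lookup (dilate l x) k = (if l dvd k then Poly_Mapping.lookup x (k div l) else 0)"
  by transfer simp

lemma D_alt: "(k, i) \<in> D x \<longleftrightarrow> i < Poly_Mapping.lookup x k"
  by (auto simp: D_def in_keys_iff)

lemma NZ_alt: "x \<in> NZ \<longleftrightarrow> (\<exists>k. Poly_Mapping.lookup x k \<noteq> 0) \<and> Poly_Mapping.lookup x 0 = 0"
  by (auto simp: NZ_def in_keys_iff poly_mapping_eq_iff fun_eq_iff)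

lemma sign_div: "l \<in> {-1, 1} \<Longrightarrow> k div l = l * k" for l k :: int
  by auto

lemma D_dilate:
  assumes "l \<in> {-1, 1}"
  shows "(k, i) \<in> D (dilate l x) \<longleftrightarrow> (l * k, i) \<in> D x"
proof -
  have "l dvd k" using assms by auto
  then show ?thesis by (simp add: D_alt lookup_dilate sign_div[OF assms])
qed

lemma dilate_NZ:
  assumes l: "l \<in> {-1, 1}" and x: "x \<in> NZ"
  shows "dilate l x \<in> NZ"
proof -
  have dvd: "l dvd k" for k using l by auto
  obtain k where "Poly_Mapping.lookup x k \<noteq> 0" using x by (auto simp: NZ_alt)
  moreover have ll: "l * (l * k) = k" using l by auto
  ultimately have "Poly_Mapping.lookup (dilate l x) (l * k) \<noteq> 0"
    by (simp only: lookup_dilate dvd sign_div[OF l] ll if_True simp_thms)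
  moreover have "Poly_Mapping.lookup (dilate l x) 0 = 0" using x by (simp add: lookup_dilate NZ_alt)
  ultimately show ?thesis unfolding NZ_alt by blast
qed

definition dilate_point :: "int \<Rightarrow> exponents \<Rightarrow> point \<Rightarrow> point" where
  "dilate_point l x \<alpha> = (\<lambda>(k, i)\<in>D (dilate l x). \<alpha> (k div l, i))"

lemma dilate_measure_alt: "dilate_measure l x \<mu> = distr \<mu> (C (dilate l x)) (dilate_point l x)"
  by (simp add: dilate_measure_def dilate_point_def[abs_def])

lemma dilate_point_apply:
  assumes "l \<in> {-1, 1}" "(k, i) \<in> D (dilate l x)"
  shows "dilate_point l x \<alpha> (k, i) = \<alpha> (l * k, i)"
  using assms(2) by (simp add: dilate_point_def sign_div[OF assms(1)])

lemma measurable_dilate_point: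
  assumes l: "l \<in> {-1, 1}"
  shows "dilate_point l x \<in> measurable (C x) (C (dilate l x))"
proof -
  have "(\<lambda>\<alpha>. case q of (k, i) \<Rightarrow> \<alpha> (k div l, i)) \<in> measurable (C x) lam" if "q \<in> D (dilate l x)" for q
  proof (cases q)
    case (Pair k i)
    then have "(l * k, i) \<in> D x" using that D_dilate[OF l] by simp
    then show ?thesis using measurable_C_component by (simp add: Pair sign_div[OF l])
  qed
  then show ?thesis
    unfolding dilate_point_def[abs_def] C_def[of "dilate l x"] by (intro measurable_restrict)
qed

lemma powi_sign:
  assumes "cmod c = 1"
  shows "c powi (- k) = cnj (c powi k)"
proof -
  have "cmod (c powi k) = 1" using assms by (simp add: norm_power_int)
  then have "(c powi k) * cnj (c powi k) = 1" by (metis complex_norm_square of_real_1 power_one)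
  then have "cnj (c powi k) = inverse (c powi k)" by (metis inverse_unique)
  then show ?thesis by (simp add: power_int_minus)
qed

text \<open>For \<open>l = -1\<close> all exponents change sign, which on the circle is complex
  conjugation.\<close>

lemma R_dilate:
  assumes l: "l \<in> {-1, 1}" and u: "u \<in> circle_functions"
  shows "R (dilate l x) u (dilate_point l x \<alpha>) = (if l = 1 then R x u \<alpha> else cnj (R x u \<alpha>))"
proof -
  have ll: "l * (l * k) = k" for k using l by auto
  have "R (dilate l x) u (dilate_point l x \<alpha>) = (\<Prod>q\<in>D (dilate l x). u (\<alpha> (l * fst q, snd q)) powi fst q)"
    unfolding R_alt by (intro prod.cong refl) (auto simp: dilate_point_apply[OF l])
  also have "\<dots> = (\<Prod>q\<in>D x. u (\<alpha> q) powi (l * fst q))"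
    by (rule prod.reindex_bij_witness[of _ "\<lambda>(k, i). (l * k, i)" "\<lambda>(k, i). (l * k, i)"])
       (auto simp: ll D_dilate[OF l])
  also have "\<dots> = (if l = 1 then R x u \<alpha> else cnj (R x u \<alpha>))"
    using l circle_functionsD(2)[OF u] by (auto simp: R_alt powi_sign)
  finally show ?thesis .
qed

lemma inj_on_dilate_point:
  assumes l: "l \<in> {-1, 1}" and inj: "inj_on \<alpha> (D x)"
  shows "inj_on (dilate_point l x \<alpha>) (D (dilate l x))"
proof (rule inj_onI)
  fix p q assume p: "p \<in> D (dilate l x)" and q: "q \<in> D (dilate l x)"
    and eq: "dilate_point l x \<alpha> p = dilate_point l x \<alpha> q"
  obtain k i k' i' where [simp]: "p = (k, i)" "q = (k', i')" by (cases p, cases q) blast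
  have "(l * k, i) = (l * k', i')"
    using p q eq D_dilate[OF l] by (intro inj_onD[OF inj]) (auto simp: dilate_point_apply[OF l])
  then show "p = q" using l by auto
qed

context associated_action
begin

declare One_nat_def [simp del]

text \<open>The constant function \<open>1\<close> realises the measure \<open>M x 1\<close> itself.
  For \<open>l = -1\<close> the conjugate of the realising function has the conjugate correlation,
  which \<open>R_dilate\<close> identifies as the transform of the dilated measure.\<close>

lemma dilate_absolutely_continuous:
  assumes l: "l \<in> {-1, 1}" and x: "x \<in> NZ"
  shows "absolutely_continuous (M (dilate l x) 1) (dilate_measure l x (M x 1))"
proof -
  note \<mu> = compat[OF x order_refl]
  interpret \<mu>: finite_measure "M x 1" by (rule compatibleD(1)[OF \<mu>])
  have m: "dilate_point l x \<in> measurable (M x 1) (C (dilate l x))"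
    by (rule measurable_compatible[OF \<mu> measurable_dilate_point[OF l]])
  have one: "(\<lambda>_. 1) \<in> square_integrable (M x 1)" by (simp add: square_integrable_def)
  have sym: "symmetric x (M x 1) (\<lambda>_. 1)" by (simp add: symmetric_def)
  obtain f where f: "f \<in> square_integrable \<gamma>" "(\<integral>\<omega>. f \<omega> \<partial>\<gamma>) = 0"
    "\<And>u. u \<in> circle_functions \<Longrightarrow> correl f u
       = (\<integral>\<alpha>. R x u \<alpha> * of_real ((cmod 1)\<^sup>2) \<partial>M x 1)"
    using realize_symmetric[OF x one sym] by blast
  define g where "g \<omega> = (if l = 1 then f \<omega> else cnj (f \<omega>))" for \<omega>
  have g: "g \<in> square_integrable \<gamma>" "(\<integral>\<omega>. g \<omega> \<partial>\<gamma>) = 0"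
    unfolding g_def using f(1,2) square_integrable_cnj[OF f(1)] by (cases "l = 1"; simp)+
  have "correl g u = (\<integral>\<alpha>. R (dilate l x) u \<alpha> \<partial>dilate_measure l x (M x 1))"
    if u: "u \<in> circle_functions" for u
  proof -
    have "(\<integral>\<alpha>. R (dilate l x) u \<alpha> \<partial>dilate_measure l x (M x 1))
        = (\<integral>\<alpha>. (if l = 1 then R x u \<alpha> else cnj (R x u \<alpha>)) \<partial>M x 1)"
      unfolding dilate_measure_alt integral_distr[OF m measurable_R[OF u]] R_dilate[OF l u] ..
    also have "\<dots> = (if l = 1 then (\<integral>\<alpha>. R x u \<alpha> \<partial>M x 1) else cnj (\<integral>\<alpha>. R x u \<alpha> \<partial>M x 1))" by simp
    also have "\<dots> = (if l = 1 then correl f u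
        else (\<integral>\<omega>. cnj (f (act u \<omega>) * cnj (f \<omega>)) \<partial>\<gamma>))"
      using f(3)[OF u] by (simp del: complex_cnj_mult)
    finally show ?thesis by (simp add: g_def)
  qed
  note eq = this
  show ?thesis
  proof (rule spectral_absolutely_continuous[OF dilate_NZ[OF l x] g _ _ _ eq])
    show "finite_measure (dilate_measure l x (M x 1))"
      unfolding dilate_measure_alt by (rule \<mu>.finite_measure_distr[OF m])
    show "sets (dilate_measure l x (M x 1)) = sets (C (dilate l x))"
      by (simp add: dilate_measure_alt)
    have "AE \<alpha> in M x 1. inj_on (dilate_point l x \<alpha>) (D (dilate l x))"
      using compatibleD(4)[OF \<mu>] by eventually_elim (rule inj_on_dilate_point[OF l])
    then show "AE \<alpha> in dilate_measure l x (M x 1). inj_on \<alpha> (D (dilate l x))"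
      unfolding dilate_measure_alt by (subst AE_distr_iff[OF m sets_inj_on])
  qed
qed

end

section \<open>Tensor products\<close>

lemma card_D:
  assumes "finite K" "Poly_Mapping.keys x \<subseteq> K"
  shows "card (D x) = (\<Sum>k\<in>K. Poly_Mapping.lookup x k)"
proof -
  have "D x = Sigma K (\<lambda>k. {..<Poly_Mapping.lookup x k})"
    using assms(2) by (auto simp: D_def in_keys_iff)
  then show ?thesis using assms(1) by (simp add: card_SigmaI)
qed

lemma card_D_add: "card (D (x + y)) = card (D x) + card (D y)"
proof -
  let ?K = "Poly_Mapping.keys x \<union> Poly_Mapping.keys y"
  have "Poly_Mapping.keys (x + y) \<subseteq> ?K" by (rule Poly_Mapping.keys_add)
  then show ?thesis
    using card_D[of ?K "x + y"] card_D[of ?K x] card_D[of ?K y]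
    by (simp add: lookup_add sum.distrib)
qed

lemma add_NZ: "x \<in> NZ \<Longrightarrow> y \<in> NZ \<Longrightarrow> x + y \<in> NZ"
  unfolding NZ_alt by (auto simp: lookup_add)

locale injection_pair =
  fixes x y :: exponents and a b :: "int \<times> nat \<Rightarrow> int \<times> nat"
  assumes pair: "(a, b) \<in> injection_pairs x y"
begin

lemma inj_a: "inj_on a (D x)" and inj_b: "inj_on b (D y)"
  and disj: "a ` D x \<inter> b ` D y = {}"
  and fst_a: "p \<in> D x \<Longrightarrow> fst (a p) = fst p" and fst_b: "p \<in> D y \<Longrightarrow> fst (b p) = fst p"
  and a_mem: "p \<in> D x \<Longrightarrow> a p \<in> D (x + y)" and b_mem: "p \<in> D y \<Longrightarrow> b p \<in> D (x + y)"
  using pair by (auto simp: injection_pairs_def)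

text \<open>The disjoint images together have as many elements as \<open>D (x + y)\<close>, so they
  fill it, and every coordinate of a merged point comes from one of the two arguments.\<close>

lemma D_add: "D (x + y) = a ` D x \<union> b ` D y"
proof (rule sym, rule card_subset_eq[OF finite_D])
  show "a ` D x \<union> b ` D y \<subseteq> D (x + y)" using a_mem b_mem by blast
  show "card (a ` D x \<union> b ` D y) = card (D (x + y))"
    using disj by (simp add: card_Un_disjoint card_image inj_a inj_b card_D_add)
qed

abbreviation "merged \<equiv> merge_points x y (a, b)"

lemma merge_a: "p \<in> D x \<Longrightarrow> merged (\<alpha>, \<beta>) (a p) = \<alpha> p"
  by (simp add: merge_points_def a_mem the_inv_into_f_f[OF inj_a])

lemma merge_b:
  assumes "p \<in> D y"
  shows "merged (\<alpha>, \<beta>) (b p) = \<beta> p"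
proof -
  have "b p \<notin> a ` D x" using disj assms by blast
  then show ?thesis using assms by (simp add: merge_points_def b_mem the_inv_into_f_f[OF inj_b])
qed

lemma measurable_merged: "merged \<in> measurable (C x \<Otimes>\<^sub>M C y) (C (x + y))"
proof -
  have "(\<lambda>r. merged r q) \<in> measurable (C x \<Otimes>\<^sub>M C y) lam" if "q \<in> D (x + y)" for q
  proof -
    have "(\<exists>p\<in>D x. q = a p) \<or> (\<exists>p\<in>D y. q = b p)" using that D_add by blast
    then show ?thesis
    proof (elim disjE bexE)
      fix p assume p: "p \<in> D x" "q = a p"
      then have "(\<lambda>r. merged r q) = (\<lambda>r. fst r p)" by (auto simp: merge_a fun_eq_iff)
      then show ?thesis using measurable_compose[OF measurable_fst measurable_C_component[OF p(1)]] by simp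
    next
      fix p assume p: "p \<in> D y" "q = b p"
      then have "(\<lambda>r. merged r q) = (\<lambda>r. snd r p)" by (auto simp: merge_b fun_eq_iff)
      then show ?thesis using measurable_compose[OF measurable_snd measurable_C_component[OF p(1)]] by simp
    qed
  qed
  then have "(\<lambda>r. \<lambda>q\<in>D (x + y). merged r q) \<in> measurable (C x \<Otimes>\<^sub>M C y) (C (x + y))"
    unfolding C_def[of "x + y"] by (intro measurable_restrict)
  moreover have "(\<lambda>q\<in>D (x + y). merged r q) = merged r" for r
    by (cases r) (auto simp: merge_points_def)
  ultimately show ?thesis by simp
qed

text \<open>The value is the same for every pair of injections, so each summand of
  \<open>tensor\<close> can be treated by itself.\<close>

lemma R_merge: "R (x + y) u (merged (\<alpha>, \<beta>)) = R x u \<alpha> * R y u \<beta>"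
proof -
  have "R (x + y) u (merged (\<alpha>, \<beta>))
      = (\<Prod>q\<in>a ` D x. u (merged (\<alpha>, \<beta>) q) powi fst q) * (\<Prod>q\<in>b ` D y. u (merged (\<alpha>, \<beta>) q) powi fst q)"
    unfolding R_alt D_add using disj by (intro prod.union_disjoint) auto
  also have "\<dots> = R x u \<alpha> * R y u \<beta>"
    by (simp add: R_alt prod.reindex inj_a inj_b merge_a merge_b fst_a fst_b)
  finally show ?thesis .
qed

lemma inj_on_merge:
  assumes "inj_on \<alpha> (D x)" "inj_on \<beta> (D y)" "\<And>p q. p \<in> D x \<Longrightarrow> q \<in> D y \<Longrightarrow> \<alpha> p \<noteq> \<beta> q"
  shows "inj_on (merged (\<alpha>, \<beta>)) (D (x + y))"
  unfolding D_add inj_on_Un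
proof (intro conjI)
  show "inj_on (merged (\<alpha>, \<beta>)) (a ` D x)"
    using assms(1) by (auto simp: inj_on_def merge_a)
  show "inj_on (merged (\<alpha>, \<beta>)) (b ` D y)"
    using assms(2) by (auto simp: inj_on_def merge_b)
  have "merged (\<alpha>, \<beta>) (a p) \<noteq> merged (\<alpha>, \<beta>) (b q)" if "p \<in> D x" "q \<in> D y" for p q
    using assms(3)[OF that] that by (simp add: merge_a merge_b)
  then show "merged (\<alpha>, \<beta>) ` (a ` D x - b ` D y) \<inter> merged (\<alpha>, \<beta>) ` (b ` D y - a ` D x) = {}"
    by blast
qed

end

lemma finite_injection_pairs: "finite (injection_pairs x y)"
  by (rule finite_subset[of _ "(D x \<rightarrow>\<^sub>E D (x + y)) \<times> (D y \<rightarrow>\<^sub>E D (x + y))"])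
     (auto simp: injection_pairs_def intro!: finite_PiE)

lemma sets_tensor [simp]: "sets (tensor x y \<mu> \<nu>) = sets (C (x + y))"
  unfolding tensor_def by (rule sets.sets_measure_of_eq)

lemma emeasure_distr_merge:
  assumes \<iota>: "\<iota> \<in> injection_pairs x y" and \<mu>: "sets \<mu> = sets (C x)" and \<nu>: "sets \<nu> = sets (C y)"
    and N: "N \<in> sets (C (x + y))"
  shows "emeasure (distr (\<mu> \<Otimes>\<^sub>M \<nu>) (C (x + y)) (merge_points x y \<iota>)) N = 0 \<longleftrightarrow>
    (AE r in \<mu> \<Otimes>\<^sub>M \<nu>. merge_points x y \<iota> r \<notin> N)"
    and "merge_points x y \<iota> \<in> measurable (\<mu> \<Otimes>\<^sub>M \<nu>) (C (x + y))"
proof -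
  obtain a b where ab: "\<iota> = (a, b)" by (cases \<iota>)
  interpret injection_pair x y a b using \<iota> by unfold_locales (simp add: ab)
  show m: "merge_points x y \<iota> \<in> measurable (\<mu> \<Otimes>\<^sub>M \<nu>) (C (x + y))"
    using measurable_merged by (simp add: ab measurable_cong_sets[OF sets_pair_measure_cong[OF \<mu> \<nu>] refl])
  let ?d = "distr (\<mu> \<Otimes>\<^sub>M \<nu>) (C (x + y)) (merge_points x y \<iota>)"
  have sp: "{r \<in> space (C (x + y)). r \<notin> N} \<in> sets (C (x + y))"
  proof -
    have "{r \<in> space (C (x + y)). r \<notin> N} = space (C (x + y)) - N" by blast
    then show ?thesis using N by simp
  qed
  have "emeasure ?d N = 0 \<longleftrightarrow> N \<in> null_sets ?d" using N by auto
  also have "\<dots> \<longleftrightarrow> (AE \<alpha> in ?d. \<alpha> \<notin> N)"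
    using N by (intro AE_iff_null_sets) simp
  also have "\<dots> \<longleftrightarrow> (AE r in \<mu> \<Otimes>\<^sub>M \<nu>. merge_points x y \<iota> r \<notin> N)"
    by (rule AE_distr_iff[OF m sp])
  finally show "emeasure ?d N = 0 \<longleftrightarrow> (AE r in \<mu> \<Otimes>\<^sub>M \<nu>. merge_points x y \<iota> r \<notin> N)" .
qed

text \<open>A finite sum of measures vanishes on a set exactly when every summand does; null sets of
  \<open>tensor\<close> are studied one pair of injections at a time.\<close>

lemma tensor_null_iff:
  assumes \<mu>: "sets \<mu> = sets (C x)" and \<nu>: "sets \<nu> = sets (C y)" and N: "N \<in> sets (C (x + y))"
  shows "N \<in> null_sets (tensor x y \<mu> \<nu>) \<longleftrightarrow>
    (\<forall>\<iota>\<in>injection_pairs x y. AE r in \<mu> \<Otimes>\<^sub>M \<nu>. merge_points x y \<iota> r \<notin> N)"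
  using N emeasure_distr_merge(1)[OF _ \<mu> \<nu> N]
  by (auto simp: null_sets_def emeasure_tensor sum_nonneg_eq_0_iff[OF finite_injection_pairs])

lemma finite_measure_tensor:
  assumes \<mu>: "sets \<mu> = sets (C x)" "finite_measure \<mu>" and \<nu>: "sets \<nu> = sets (C y)" "finite_measure \<nu>"
  shows "finite_measure (tensor x y \<mu> \<nu>)"
proof
  interpret P: finite_measure "\<mu> \<Otimes>\<^sub>M \<nu>" by (rule finite_measure_pair_measure[OF \<nu>(2) \<mu>(2)])
  have sp: "space (tensor x y \<mu> \<nu>) = space (C (x + y))" by (rule sets_eq_imp_space_eq) simp
  have "emeasure (tensor x y \<mu> \<nu>) (space (tensor x y \<mu> \<nu>))
      = (\<Sum>\<iota>\<in>injection_pairs x y. ennreal (measure (\<mu> \<Otimes>\<^sub>M \<nu>)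
          (merge_points x y \<iota> -` space (C (x + y)) \<inter> space (\<mu> \<Otimes>\<^sub>M \<nu>))))"
    unfolding sp using emeasure_distr_merge(2)[OF _ \<mu>(1) \<nu>(1) sets.top]
    by (simp add: emeasure_tensor emeasure_distr P.emeasure_eq_measure)
  then show "emeasure (tensor x y \<mu> \<nu>) (space (tensor x y \<mu> \<nu>)) \<noteq> \<infinity>" by simp
qed

text \<open>Fubini: the inner measure is replaced first, then the outer one.\<close>

lemma tensor_mono:
  assumes \<mu>: "sets \<mu> = sets (C x)" "finite_measure \<mu>" and \<nu>: "sets \<nu> = sets (C y)" "finite_measure \<nu>"
    and \<mu>': "sets \<mu>' = sets (C x)" "finite_measure \<mu>'" and \<nu>': "sets \<nu>' = sets (C y)" "finite_measure \<nu>'"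
    and ac: "absolutely_continuous \<mu>' \<mu>" "absolutely_continuous \<nu>' \<nu>"
  shows "absolutely_continuous (tensor x y \<mu>' \<nu>') (tensor x y \<mu> \<nu>)"
  unfolding absolutely_continuous_def
proof
  interpret \<mu>: finite_measure \<mu> by (rule \<mu>(2))
  interpret \<nu>: finite_measure \<nu> by (rule \<nu>(2))
  interpret \<mu>': finite_measure \<mu>' by (rule \<mu>'(2))
  interpret \<nu>': finite_measure \<nu>' by (rule \<nu>'(2))
  interpret P: pair_sigma_finite \<mu> \<nu> ..
  interpret P': pair_sigma_finite \<mu>' \<nu>' ..
  fix N assume N: "N \<in> null_sets (tensor x y \<mu>' \<nu>')"
  then have NC: "N \<in> sets (C (x + y))" using null_setsD2[OF N] by simp
  have "AE r in \<mu> \<Otimes>\<^sub>M \<nu>. merge_points x y \<iota> r \<notin> N" if \<iota>: "\<iota> \<in> injection_pairs x y" for \<iota>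
  proof (rule P.AE_pair_measure)
    have [measurable]: "merge_points x y \<iota> \<in> measurable (\<mu> \<Otimes>\<^sub>M \<nu>) (C (x + y))" "N \<in> sets (C (x + y))"
      by (rule emeasure_distr_merge(2)[OF \<iota> \<mu>(1) \<nu>(1) NC]) (rule NC)
    show "{r \<in> space (\<mu> \<Otimes>\<^sub>M \<nu>). merge_points x y \<iota> r \<notin> N} \<in> sets (\<mu> \<Otimes>\<^sub>M \<nu>)" by measurable
    have "AE r in \<mu>' \<Otimes>\<^sub>M \<nu>'. merge_points x y \<iota> r \<notin> N"
      using N \<iota> by (simp add: tensor_null_iff[OF \<mu>'(1) \<nu>'(1) NC])
    then have "AE \<alpha> in \<mu>'. AE \<beta> in \<nu>'. merge_points x y \<iota> (\<alpha>, \<beta>) \<notin> N" by (rule P'.AE_pair)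
    then have "AE \<alpha> in \<mu>'. AE \<beta> in \<nu>. merge_points x y \<iota> (\<alpha>, \<beta>) \<notin> N"
      by (rule eventually_mono) (rule absolutely_continuous_AE[OF _ ac(2)], simp add: \<nu> \<nu>')
    then show "AE \<alpha> in \<mu>. AE \<beta> in \<nu>. merge_points x y \<iota> (\<alpha>, \<beta>) \<notin> N"
      by (rule absolutely_continuous_AE[OF _ ac(1), rotated]) (simp add: \<mu> \<mu>')
  qed
  then show "N \<in> null_sets (tensor x y \<mu> \<nu>)" by (simp add: tensor_null_iff[OF \<mu>(1) \<nu>(1) NC])
qed

text \<open>A point lies in cells of mass \<open>(1 / 2) ^ n\<close> for all
  \<open>n\<close>.\<close>

lemma lam_singleton: "AE \<beta> in lam. \<beta> \<noteq> c"
proof -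
  interpret product_prob_space "\<lambda>_ :: nat. measure_pmf (bernoulli_pmf (1 / 2))" UNIV
    by unfold_locales
  interpret L: prob_space lam by (rule prob_space_lam)
  have half: "emeasure (measure_pmf (bernoulli_pmf (1 / 2))) {v} = ennreal (1 / 2)" for v
    by (cases v) (simp_all add: emeasure_pmf_single)
  have cell_eq: "cell n (map c [0..<n]) = prod_emb UNIV (\<lambda>_. measure_pmf (bernoulli_pmf (1 / 2))) {..<n} (\<Pi>\<^sub>E i\<in>{..<n}. {c i})" for n
  proof (rule Set.set_eqI)
    fix \<beta> :: "nat \<Rightarrow> bool"
    have "map \<beta> [0..<n] = map c [0..<n] \<longleftrightarrow> (\<forall>i<n. \<beta> i = c i)" by auto
    then show "\<beta> \<in> cell n (map c [0..<n]) \<longleftrightarrow> \<beta> \<in> prod_emb UNIV (\<lambda>_. measure_pmf (bernoulli_pmf (1 / 2))) {..<n} (\<Pi>\<^sub>E i\<in>{..<n}. {c i})"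
      by (simp add: cell_def prod_emb_iff PiE_iff Ball_def)
  qed
  have m: "measure lam (cell n (map c [0..<n])) = (1 / 2) ^ n" for n
  proof -
    have "emeasure lam (cell n (map c [0..<n])) = (\<Prod>i<n. emeasure (measure_pmf (bernoulli_pmf (1 / 2))) {c i})"
      unfolding cell_eq lam_def by (rule emeasure_PiM_emb) auto
    also have "\<dots> = ennreal ((1 / 2) ^ n)" by (simp only: half prod_constant card_lessThan) (rule ennreal_power, simp)
    finally show ?thesis by (simp add: measure_def)
  qed
  have single: "{c} = (\<Inter>n. cell n (map c [0..<n]))"
  proof (intro equalityI subsetI)
    fix \<beta> assume \<beta>: "\<beta> \<in> (\<Inter>n. cell n (map c [0..<n]))"
    have "\<beta> = c"
    proof
      fix n
      have "map \<beta> [0..<Suc n] = map c [0..<Suc n]" using \<beta> unfolding cell_def by blast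
      then show "\<beta> n = c n" by simp
    qed
    then show "\<beta> \<in> {c}" by simp
  qed (simp add: cell_def)
  have sets: "{c} \<in> sets lam" unfolding single by (intro sets.countable_INT) auto
  have "measure lam {c} \<le> (1 / 2) ^ n" for n
    unfolding m[symmetric] using single by (intro L.finite_measure_mono) auto
  moreover have "(\<lambda>n. (1 / 2 :: real) ^ n) \<longlonglongrightarrow> 0" by (rule LIMSEQ_power_zero) simp
  ultimately have "measure lam {c} \<le> 0" by (intro LIMSEQ_le_const[of "\<lambda>n. (1 / 2 :: real) ^ n" 0]) auto
  then have "measure lam {c} = 0" by (simp add: measure_le_0_iff)
  then have "AE \<beta> in lam. \<beta> \<notin> {c}" using L.prob_eq_0[OF sets] by simp
  then show ?thesis by simp
qed

text \<open>The marginals inherit from \<open>lam\<close> the absence of atoms; consequently two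
  independent points almost surely share no coordinate.\<close>

lemma compatible_avoids_point:
  assumes \<mu>: "compatible w \<mu>" and q: "q \<in> D w"
  shows "AE \<alpha> in \<mu>. \<alpha> q \<noteq> c"
proof -
  have "\<forall>p\<in>D w. absolutely_continuous lam (distr \<mu> lam (\<lambda>\<alpha>. \<alpha> p))"
    using \<mu> unfolding compatible_def by (elim conjE)
  then have "AE \<beta> in distr \<mu> lam (\<lambda>\<alpha>. \<alpha> q). \<beta> \<noteq> c"
    using q by (intro absolutely_continuous_AE[OF _ _ lam_singleton]) auto
  moreover have "(\<lambda>\<alpha>. \<alpha> q) \<in> measurable \<mu> lam"
    by (rule measurable_compatible[OF \<mu> measurable_C_component[OF q]])
  ultimately show ?thesis by (rule AE_distrD[rotated])
qed

lemma (in pair_sigma_finite) AE_fst: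
  assumes "AE x in M1. P x"
  shows "AE r in M1 \<Otimes>\<^sub>M M2. P (fst r)"
proof -
  obtain N where N: "N \<in> null_sets M1" "\<And>x. x \<in> space M1 - N \<Longrightarrow> P x" using AE_E3[OF assms] by metis
  have "N \<times> space M2 \<in> null_sets (M1 \<Otimes>\<^sub>M M2)" using N(1) by (intro M2.times_in_null_sets1) auto
  then show ?thesis by (rule AE_I') (clarsimp simp: space_pair_measure, metis DiffI N(2))
qed

lemma (in pair_sigma_finite) AE_snd:
  assumes "AE y in M2. P y"
  shows "AE r in M1 \<Otimes>\<^sub>M M2. P (snd r)"
proof -
  obtain N where N: "N \<in> null_sets M2" "\<And>y. y \<in> space M2 - N \<Longrightarrow> P y" using AE_E3[OF assms] by metis
  have "space M1 \<times> N \<in> null_sets (M1 \<Otimes>\<^sub>M M2)" using N(1) by (intro M2.times_in_null_sets2) auto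
  then show ?thesis by (rule AE_I') (clarsimp simp: space_pair_measure, metis DiffI N(2))
qed

section \<open>Vectors living on complementary boxes\<close>

definition box_indicator :: "exponents \<Rightarrow> (nat \<Rightarrow> bool) set \<Rightarrow> point \<Rightarrow> complex" where
  "box_indicator w A \<alpha> = of_bool (\<forall>p\<in>D w. \<alpha> p \<in> A)"

lemma measurable_box_indicator [measurable]:
  assumes "A \<in> sets lam"
  shows "box_indicator w A \<in> borel_measurable (C w)"
proof -
  have s: "{\<alpha> \<in> space (C w). \<forall>p\<in>D w. \<alpha> p \<in> A} \<in> sets (C w)"
  proof (intro sets.sets_Collect_finite_All finite_D)
    fix p assume "p \<in> D w"
    from measurable_sets[OF measurable_C_component[OF this] assms]
    have "(\<lambda>\<alpha>. \<alpha> p) -` A \<inter> space (C w) \<in> sets (C w)" .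
    moreover have "(\<lambda>\<alpha>. \<alpha> p) -` A \<inter> space (C w) = {\<alpha> \<in> space (C w). \<alpha> p \<in> A}" by blast
    ultimately show "{\<alpha> \<in> space (C w). \<alpha> p \<in> A} \<in> sets (C w)" by simp
  qed
  have "box_indicator w A \<in> borel_measurable (C w) \<longleftrightarrow>
      (\<lambda>\<alpha>. indicator {\<alpha> \<in> space (C w). \<forall>p\<in>D w. \<alpha> p \<in> A} \<alpha> :: complex) \<in> borel_measurable (C w)"
    by (rule measurable_cong) (simp add: box_indicator_def indicator_def of_bool_def)
  then show ?thesis using borel_measurable_indicator[OF s] by blast
qed

lemma norm_box_indicator: "cmod (box_indicator w A \<alpha>) \<le> 1"
  by (simp add: box_indicator_def)

lemma box_indicator_square: "of_real ((cmod (box_indicator w A \<alpha>))\<^sup>2) = box_indicator w A \<alpha>"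
  by (simp add: box_indicator_def)

text \<open>All sides of the box are the same set, so permuting coordinates changes nothing.\<close>

lemma symmetric_box_indicator: "symmetric w \<mu> (box_indicator w A)"
proof -
  have "box_indicator w A (good_homeo w \<delta> \<alpha>) = box_indicator w A \<alpha>" if \<delta>: "good w \<delta>" for \<delta> \<alpha>
  proof -
    have p: "inv_into UNIV \<delta> ` D w = D w" by (rule permutes_image[OF goodD(3)[OF good_inv[OF \<delta>]]])
    have "(\<forall>q\<in>D w. good_homeo w \<delta> \<alpha> q \<in> A) \<longleftrightarrow> (\<forall>q\<in>D w. \<alpha> (inv_into UNIV \<delta> q) \<in> A)"
      by (simp add: good_homeo_def)
    also have "\<dots> \<longleftrightarrow> (\<forall>q\<in>inv_into UNIV \<delta> ` D w. \<alpha> q \<in> A)" by blast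
    finally show ?thesis by (simp only: box_indicator_def p)
  qed
  then show ?thesis by (simp add: symmetric_def)
qed

lemma box_indicator_square_integrable:
  assumes \<mu>: "compatible w \<mu>" and A: "A \<in> sets lam"
  shows "box_indicator w A \<in> square_integrable \<mu>"
proof -
  interpret finite_measure \<mu> by (rule compatibleD(1)[OF \<mu>])
  have [measurable]: "box_indicator w A \<in> borel_measurable \<mu>"
    by (rule measurable_compatible[OF \<mu> measurable_box_indicator[OF A]])
  have "integrable \<mu> (\<lambda>\<alpha>. (cmod (box_indicator w A \<alpha>))\<^sup>2)"
    by (rule integrable_const_bound[where B = 1]) (auto simp: power_le_one norm_box_indicator)
  then show ?thesis by (simp add: square_integrable_def)
qed

lemma R_box_indicator:
  assumes "\<And>\<beta>. \<beta> \<in> A \<Longrightarrow> u \<beta> = 1"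
  shows "R w u \<alpha> * box_indicator w A \<alpha> = box_indicator w A \<alpha>"
proof (cases "\<forall>p\<in>D w. \<alpha> p \<in> A")
  case True
  then have "R w u \<alpha> = 1" unfolding R_alt using assms by (intro prod.neutral) simp
  then show ?thesis by simp
next
  case False
  then show ?thesis unfolding box_indicator_def by (simp only: of_bool_eq mult_zero_right)
qed

context associated_action
begin

text \<open>The witness is the product of the functions realising the two boxes. Independence enters
  three times: for the mean of the product, for its square integrability and for its
  correlation.\<close>

lemma realize_disjoint_boxes:
  assumes x: "x \<in> NZ" and y: "y \<in> NZ" and A: "A \<in> sets lam"
  shows "\<exists>f\<in>square_integrable \<gamma>. (\<integral>r. f r \<partial>\<gamma>) = 0 \<and>
    (\<forall>u\<in>circle_functions. correl f u
       = (\<integral>\<alpha>. R x u \<alpha> * box_indicator x A \<alpha> \<partial>M x 1) * (\<integral>\<beta>. R y u \<beta> * box_indicator y (- A) \<beta> \<partial>M y 1))"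
proof -
  have cA: "- A \<in> sets lam" using sets.compl_sets[OF A] by (simp add: Compl_eq_Diff_UNIV)
  obtain f where f: "f \<in> square_integrable \<gamma>" "(\<integral>r. f r \<partial>\<gamma>) = 0"
    "\<And>u. u \<in> circle_functions \<Longrightarrow> correl f u
       = (\<integral>\<alpha>. R x u \<alpha> * of_real ((cmod (box_indicator x A \<alpha>))\<^sup>2) \<partial>M x 1)"
    "\<And>u. u \<in> circle_functions \<Longrightarrow> AE \<alpha> in M x 1. R x u \<alpha> * box_indicator x A \<alpha> = box_indicator x A \<alpha> \<Longrightarrow>
       AE r in \<gamma>. f (act u r) = f r"
    using realize_symmetric[OF x box_indicator_square_integrable[OF compat[OF x order_refl] A] symmetric_box_indicator]
    by blast
  obtain g where g: "g \<in> square_integrable \<gamma>" "(\<integral>r. g r \<partial>\<gamma>) = 0"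
    "\<And>u. u \<in> circle_functions \<Longrightarrow> correl g u
       = (\<integral>\<alpha>. R y u \<alpha> * of_real ((cmod (box_indicator y (- A) \<alpha>))\<^sup>2) \<partial>M y 1)"
    "\<And>u. u \<in> circle_functions \<Longrightarrow> AE \<alpha> in M y 1. R y u \<alpha> * box_indicator y (- A) \<alpha> = box_indicator y (- A) \<alpha> \<Longrightarrow>
       AE r in \<gamma>. g (act u r) = g r"
    using realize_symmetric[OF y box_indicator_square_integrable[OF compat[OF y order_refl] cA] symmetric_box_indicator]
    by blast
  define supp where "supp E = {u \<in> circle_functions. \<forall>\<beta>. \<beta> \<notin> E \<longrightarrow> u \<beta> = 1}" for E
  have f_inv: "AE r in \<gamma>. f (act u r) = f r" if "u \<in> supp (- A)" for u
    by (intro f(4) AE_I2 R_box_indicator) (use that in \<open>simp_all add: supp_def\<close>)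
  have g_inv: "AE r in \<gamma>. g (act u r) = g r" if "u \<in> supp A" for u
    by (intro g(4) AE_I2 R_box_indicator) (use that in \<open>simp_all add: supp_def\<close>)
  have supp_circle: "u \<in> circle_functions" if "u \<in> supp E" for u E using that by (simp add: supp_def)
  have erg: "prob E \<in> {0, 1}" if E: "invariant_set \<gamma> (act ` supp A \<union> act ` supp (- A)) E" for E
  proof (rule invariant_zero_one)
    have "AE r in \<gamma>. act u r \<in> E \<longleftrightarrow> r \<in> E" if u: "u \<in> circle_functions" for u
    proof -
      \<comment> \<open>Every \<open>u\<close> is the product of a function supported in
        \<open>A\<close> and one supported in the complement, so sets invariant under both subgroups
        are invariant under the whole group.\<close>
      define v where "v \<beta> = (if \<beta> \<in> A then u \<beta> else 1)" for \<beta>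
      define w where "w \<beta> = (if \<beta> \<in> A then 1 else u \<beta>)" for \<beta>
      have [measurable]: "u \<in> borel_measurable lam" "A \<in> sets lam" using u A by auto
      have v: "v \<in> supp A" and w: "w \<in> supp (- A)"
        using u by (auto simp: supp_def circle_functions_def v_def[abs_def] w_def[abs_def])
      have "u = (\<lambda>\<beta>. v \<beta> * w \<beta>)" by (auto simp: v_def w_def fun_eq_iff)
      then have uvw: "AE r in \<gamma>. act u r = act v (act w r)"
        using act_mult[OF supp_circle[OF v] supp_circle[OF w]] by simp
      have "AE r in \<gamma>. act v r \<in> E \<longleftrightarrow> r \<in> E" and Ew: "AE r in \<gamma>. act w r \<in> E \<longleftrightarrow> r \<in> E"
        using E v w by (auto simp: invariant_set_def)
      from AE_measure_preserving[OF act_preserving[OF supp_circle[OF w]] this(1)] Ew uvw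
      show ?thesis by eventually_elim simp
    qed
    then show "invariant_set \<gamma> (act ` circle_functions) E" using E by (simp add: invariant_set_def)
  qed
  have indep: "indep_var borel X borel Y"
    if "X \<in> borel_measurable \<gamma>" "\<And>u. u \<in> supp (- A) \<Longrightarrow> AE r in \<gamma>. X (act u r) = X r"
      "Y \<in> borel_measurable \<gamma>" "\<And>u. u \<in> supp A \<Longrightarrow> AE r in \<gamma>. Y (act u r) = Y r" for X Y :: "'a \<Rightarrow> complex"
  proof (rule commuting_invariant_functions_indep[of "act ` supp A" "act ` supp (- A)"])
    show "measure_preserving_self \<gamma> t" if "t \<in> act ` supp A \<union> act ` supp (- A)" for t
      using that act_preserving supp_circle by auto
    show "AE r in \<gamma>. s (t r) = t (s r)" if "s \<in> act ` supp A" "t \<in> act ` supp (- A)" for s t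
      using that act_commute supp_circle by auto
    show "\<exists>s'\<in>act ` supp (- A). AE r in \<gamma>. s' (s r) = r" if s: "s \<in> act ` supp (- A)" for s
    proof -
      obtain u where u: "u \<in> supp (- A)" "s = act u" using s by blast
      have "(\<lambda>\<beta>. inverse (u \<beta>)) \<in> supp (- A)"
        using u(1) circle_functions_inverse[of u] by (simp add: supp_def)
      then show ?thesis using act_inverse[OF supp_circle[OF u(1)]] u(2) by blast
    qed
  qed (use that erg in auto)
  have meas: "f \<in> borel_measurable \<gamma>" "g \<in> borel_measurable \<gamma>"
    using f(1) g(1) by (auto simp: square_integrable_def)
  have act_meas: "act u \<in> measurable \<gamma> \<gamma>" if "u \<in> circle_functions" for u
    using act_preserving[OF that] by (simp add: measure_preserving_self_def)
  have shift: "AE r in \<gamma>. h (act u (act v r)) = h (act u r)"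
    if "u \<in> circle_functions" "v \<in> circle_functions" "AE r in \<gamma>. h (act v r) = h r" for h :: "'a \<Rightarrow> complex" and u v
    using act_commute[OF that(1,2)] AE_measure_preserving[OF act_preserving[OF that(1)] that(3)]
    by eventually_elim simp
  \<comment> \<open>Translating by \<open>act u\<close> keeps the invariances of \<open>f\<close>
    and \<open>g\<close>, since the group is commutative; so the integrands of both correlations are
    again independent.\<close>
  have corr: "indep_var borel (\<lambda>r. f (act u r) * cnj (f r)) borel (\<lambda>r. g (act u r) * cnj (g r))"
    if u: "u \<in> circle_functions" for u
  proof (rule indep)
    note [measurable] = meas act_meas[OF u]
    show "(\<lambda>r. f (act u r) * cnj (f r)) \<in> borel_measurable \<gamma>"
      "(\<lambda>r. g (act u r) * cnj (g r)) \<in> borel_measurable \<gamma>" by measurable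
    show "AE r in \<gamma>. f (act u (act v r)) * cnj (f (act v r)) = f (act u r) * cnj (f r)"
      if "v \<in> supp (- A)" for v
      using shift[OF u supp_circle[OF that] f_inv[OF that]] f_inv[OF that] by eventually_elim simp
    show "AE r in \<gamma>. g (act u (act v r)) * cnj (g (act v r)) = g (act u r) * cnj (g r)"
      if "v \<in> supp A" for v
      using shift[OF u supp_circle[OF that] g_inv[OF that]] g_inv[OF that] by eventually_elim simp
  qed
  have int: "integrable \<gamma> (\<lambda>r. h (act u r) * cnj (h r))" if "h \<in> square_integrable \<gamma>" "u \<in> circle_functions" for h u
    by (rule square_integrable_mult_integrable[OF square_integrable_compose[OF that(1) act_preserving[OF that(2)]] that(1)])
  define k where "k r = f r * g r" for r
  have fg: "indep_var borel f borel g"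
    by (rule indep) (use meas f_inv g_inv in auto)
  have k0: "(\<integral>r. k r \<partial>\<gamma>) = 0"
    unfolding k_def indep_var_lebesgue_integral[OF fg square_integrable_imp_integrable[OF f(1)]
      square_integrable_imp_integrable[OF g(1)]] by (simp add: f(2))
  have k: "k \<in> square_integrable \<gamma>"
  proof -
    \<comment> \<open>The squared moduli are independent and integrable, hence so is their
      product.\<close>
    have sq: "indep_var borel (\<lambda>r. f r * cnj (f r)) borel (\<lambda>r. g r * cnj (g r))"
    proof (rule indep)
      note [measurable] = meas
      show "(\<lambda>r. f r * cnj (f r)) \<in> borel_measurable \<gamma>" "(\<lambda>r. g r * cnj (g r)) \<in> borel_measurable \<gamma>"
        by measurable
      show "AE r in \<gamma>. f (act v r) * cnj (f (act v r)) = f r * cnj (f r)" if "v \<in> supp (- A)" for v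
        using f_inv[OF that] by eventually_elim simp
      show "AE r in \<gamma>. g (act v r) * cnj (g (act v r)) = g r * cnj (g r)" if "v \<in> supp A" for v
        using g_inv[OF that] by eventually_elim simp
    qed
    have "integrable \<gamma> (\<lambda>r. (f r * cnj (f r)) * (g r * cnj (g r)))"
      by (rule indep_var_integrable[OF sq square_integrable_mult_integrable[OF f(1) f(1)]
        square_integrable_mult_integrable[OF g(1) g(1)]])
    then have "integrable \<gamma> (\<lambda>r. Re ((f r * cnj (f r)) * (g r * cnj (g r))))" by (rule integrable_Re)
    also have "(\<lambda>r. Re ((f r * cnj (f r)) * (g r * cnj (g r)))) = (\<lambda>r. (cmod (k r))\<^sup>2)"
      by (simp add: k_def fun_eq_iff norm_mult power_mult_distrib complex_norm_square[symmetric])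
    finally show ?thesis using meas by (simp add: square_integrable_def k_def[abs_def])
  qed
  have "correl k u
     = (\<integral>\<alpha>. R x u \<alpha> * box_indicator x A \<alpha> \<partial>M x 1) * (\<integral>\<beta>. R y u \<beta> * box_indicator y (- A) \<beta> \<partial>M y 1)"
    if u: "u \<in> circle_functions" for u
  proof -
    have "correl k u
      = (\<integral>r. (f (act u r) * cnj (f r)) * (g (act u r) * cnj (g r)) \<partial>\<gamma>)"
      by (intro Bochner_Integration.integral_cong refl) (simp add: k_def mult_ac)
    also have "\<dots> = correl f u * correl g u"
      by (rule indep_var_lebesgue_integral[OF corr[OF u] int[OF f(1) u] int[OF g(1) u]])
    finally show ?thesis by (simp only: f(3)[OF u] g(3)[OF u] box_indicator_square)
  qed
  then show ?thesis using k k0 by blast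
qed

text \<open>The criterion is applied to the image under merging of the product measure restricted to
  the two boxes; its transform factorises by \<open>R_merge\<close> and Fubini. Because the boxes
  use complementary sets, coordinates of the two points never coincide, which keeps this measure off
  the diagonals.\<close>

lemma merged_boxes_avoid_null:
  assumes x: "x \<in> NZ" and y: "y \<in> NZ" and A: "A \<in> sets lam" and \<iota>: "\<iota> \<in> injection_pairs x y"
    and N: "N \<in> null_sets (M (x + y) 1)"
  shows "AE r in M x 1 \<Otimes>\<^sub>M M y 1. (\<forall>p\<in>D x. fst r p \<in> A) \<and> (\<forall>q\<in>D y. snd r q \<notin> A) \<longrightarrow>
    merge_points x y \<iota> r \<notin> N"
proof -
  note \<mu> = compat[OF x order_refl] and \<nu> = compat[OF y order_refl]
  have cA: "- A \<in> sets lam" using sets.compl_sets[OF A] by (simp add: Compl_eq_Diff_UNIV)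
  interpret \<mu>: finite_measure "M x 1" by (rule compatibleD(1)[OF \<mu>])
  interpret \<nu>: finite_measure "M y 1" by (rule compatibleD(1)[OF \<nu>])
  interpret P: pair_sigma_finite "M x 1" "M y 1" ..
  interpret PF: finite_measure "M x 1 \<Otimes>\<^sub>M M y 1"
    by (rule finite_measure_pair_measure[OF compatibleD(1)[OF \<nu>] compatibleD(1)[OF \<mu>]])
  let ?P = "M x 1 \<Otimes>\<^sub>M M y 1"
  obtain a b where ab: "\<iota> = (a, b)" by (cases \<iota>)
  interpret injection_pair x y a b using \<iota> by unfold_locales (simp add: ab)
  note sets_P = sets_pair_measure_cong[OF compatibleD(2)[OF \<mu>] compatibleD(2)[OF \<nu>]]
  have NC: "N \<in> sets (C (x + y))"
    using null_setsD2[OF N] compatibleD(2)[OF compat[OF add_NZ[OF x y] order_refl]] by simp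
  have m [measurable]: "merged \<in> measurable ?P (C (x + y))"
    using emeasure_distr_merge(2)[OF \<iota> compatibleD(2)[OF \<mu>] compatibleD(2)[OF \<nu>] NC] by (simp add: ab)
  define ind where "ind r = box_indicator x A (fst r) * box_indicator y (- A) (snd r)" for r
  have bix [measurable]: "box_indicator x A \<in> borel_measurable (M x 1)"
    by (rule measurable_compatible[OF \<mu> measurable_box_indicator[OF A]])
  have biy [measurable]: "box_indicator y (- A) \<in> borel_measurable (M y 1)"
    by (rule measurable_compatible[OF \<nu> measurable_box_indicator[OF cA]])
  have ind_meas [measurable]: "ind \<in> borel_measurable ?P" unfolding ind_def[abs_def] by measurable
  define E where "E = {r \<in> space ?P. (\<forall>p\<in>D x. fst r p \<in> A) \<and> (\<forall>q\<in>D y. snd r q \<notin> A)}"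
  have ind_eq: "ind r = indicator E r" if "r \<in> space ?P" for r
    using that by (simp add: ind_def box_indicator_def E_def indicator_def of_bool_def)
  have "E = ind -` {1} \<inter> space ?P"
    using ind_eq by (auto simp: E_def indicator_def split: if_splits)
  then have E_m [measurable]: "E \<in> sets ?P" using measurable_sets[OF ind_meas, of "{1}"] by simp
  define \<sigma> where "\<sigma> = distr (density ?P (indicator E)) (C (x + y)) merged"
  have m' : "merged \<in> measurable (density ?P (indicator E)) (C (x + y))" by simp
  have fin: "finite_measure (density ?P (indicator E))"
  proof
    have "emeasure (density ?P (indicator E)) (space ?P) = emeasure ?P E"
      using E_m by (subst emeasure_restricted) (auto simp: E_def Int_absorb2)
    then show "emeasure (density ?P (indicator E)) (space (density ?P (indicator E))) \<noteq> \<infinity>"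
      by simp
  qed
  obtain f where f: "f \<in> square_integrable \<gamma>" "(\<integral>r. f r \<partial>\<gamma>) = 0"
    "\<And>u. u \<in> circle_functions \<Longrightarrow> correl f u
       = (\<integral>\<alpha>. R x u \<alpha> * box_indicator x A \<alpha> \<partial>M x 1) * (\<integral>\<beta>. R y u \<beta> * box_indicator y (- A) \<beta> \<partial>M y 1)"
    using realize_disjoint_boxes[OF x y A] by blast
  have "absolutely_continuous (M (x + y) 1) \<sigma>"
  proof (rule spectral_absolutely_continuous[OF add_NZ[OF x y] f(1,2)])
    show "finite_measure \<sigma>" unfolding \<sigma>_def by (rule finite_measure.finite_measure_distr[OF fin m'])
    show "sets \<sigma> = sets (C (x + y))" by (simp add: \<sigma>_def)
    have ix: "AE r in ?P. inj_on (fst r) (D x)"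
      by (rule P.AE_fst[OF compatibleD(4)[OF \<mu>]])
    have iy: "AE r in ?P. inj_on (snd r) (D y)"
      by (rule P.AE_snd[OF compatibleD(4)[OF \<nu>]])
    have "AE r in density ?P (indicator E). inj_on (merged r) (D (x + y))"
    proof -
      have "AE r in ?P. r \<in> E \<longrightarrow> inj_on (merged r) (D (x + y))"
        using ix iy
      proof eventually_elim
        case (elim r)
        show ?case
        proof
          assume E: "r \<in> E"
          then have "fst r p \<noteq> snd r q" if "p \<in> D x" "q \<in> D y" for p q
            using that unfolding E_def by fastforce
          from inj_on_merge[OF elim this] show "inj_on (merged r) (D (x + y))" by simp
        qed
      qed
      then show ?thesis by (subst AE_density) (auto simp: indicator_def)
    qed
    then show "AE \<alpha> in \<sigma>. inj_on \<alpha> (D (x + y))"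
      unfolding \<sigma>_def by (subst AE_distr_iff[OF m' sets_inj_on])
    fix u assume u: "u \<in> circle_functions"
    have [measurable]: "R x u \<in> borel_measurable (M x 1)" "R y u \<in> borel_measurable (M y 1)"
      using measurable_compatible[OF \<mu> measurable_R[OF u]] measurable_compatible[OF \<nu> measurable_R[OF u]] by auto
    have Rm: "(\<lambda>r. R (x + y) u (merged r)) \<in> borel_measurable ?P"
      by (rule measurable_compose[OF m measurable_R[OF u]])
    let ?F = "\<lambda>r. (R x u (fst r) * box_indicator x A (fst r)) * (R y u (snd r) * box_indicator y (- A) (snd r))"
    have F_int: "integrable ?P ?F"
    proof (rule PF.integrable_const_bound[where B = 1])
      show "AE r in ?P. norm (?F r) \<le> 1"
        by (simp add: norm_mult norm_R[OF u] norm_box_indicator mult_le_one)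
    qed measurable
    have "(\<integral>\<alpha>. R (x + y) u \<alpha> \<partial>\<sigma>) = (\<integral>r. R (x + y) u (merged r) \<partial>density ?P (indicator E))"
      unfolding \<sigma>_def by (rule integral_distr[OF m' measurable_R[OF u]])
    also have "\<dots> = (\<integral>r. R (x + y) u (merged r) \<partial>density ?P (\<lambda>r. ennreal (indicator E r)))"
      by (simp add: ennreal_indicator)
    also have "\<dots> = (\<integral>r. indicator E r *\<^sub>R R (x + y) u (merged r) \<partial>?P)"
      by (rule integral_density[OF Rm]) auto
    also have "\<dots> = (\<integral>r. ?F r \<partial>?P)"
    proof (rule Bochner_Integration.integral_cong[OF refl])
      fix r assume "r \<in> space ?P"
      from ind_eq[OF this] have "of_real (indicator E r) = ind r" by (simp add: indicator_def)
      then have "indicator E r *\<^sub>R R (x + y) u (merged r) = ind r * R (x + y) u (merged (fst r, snd r))"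
        by (simp add: scaleR_conv_of_real)
      then show "indicator E r *\<^sub>R R (x + y) u (merged r) = ?F r"
        by (simp only: R_merge ind_def mult_ac)
    qed
    also have "\<dots> = (\<integral>\<alpha>. \<integral>\<beta>. ?F (\<alpha>, \<beta>) \<partial>M y 1 \<partial>M x 1)"
      by (rule P.integral_fst'[OF F_int, symmetric])
    also have "\<dots> = (\<integral>\<alpha>. R x u \<alpha> * box_indicator x A \<alpha> \<partial>M x 1) * (\<integral>\<beta>. R y u \<beta> * box_indicator y (- A) \<beta> \<partial>M y 1)"
      by simp
    finally show "correl f u = (\<integral>\<alpha>. R (x + y) u \<alpha> \<partial>\<sigma>)"
      using f(3)[OF u] by simp
  qed
  then have "N \<in> null_sets \<sigma>" using N by (auto simp: absolutely_continuous_def)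
  then have "AE \<alpha> in \<sigma>. \<alpha> \<notin> N" by (rule AE_not_in)
  then have "AE r in density ?P (indicator E). merged r \<notin> N"
    unfolding \<sigma>_def by (rule AE_distrD[OF m'])
  then have "AE r in ?P. r \<in> E \<longrightarrow> merged r \<notin> N"
    by (subst (asm) AE_density) (auto simp: indicator_def split: if_splits)
  with AE_space show ?thesis
    by eventually_elim (auto simp: E_def ab)
qed

text \<open>Two independent points almost surely have no common coordinate, and then some set given
  by finitely many prefixes of one length contains all coordinates of the first and none of the
  second. There are countably many such sets, so the null sets can be united.\<close>

lemma tensor_absolutely_continuous:
  assumes x: "x \<in> NZ" and y: "y \<in> NZ"
  shows "absolutely_continuous (M (x + y) 1) (tensor x y (M x 1) (M y 1))"
  unfolding absolutely_continuous_def
proof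
  note \<mu> = compat[OF x order_refl] and \<nu> = compat[OF y order_refl]
  interpret \<mu>: finite_measure "M x 1" by (rule compatibleD(1)[OF \<mu>])
  interpret \<nu>: finite_measure "M y 1" by (rule compatibleD(1)[OF \<nu>])
  interpret P: pair_sigma_finite "M x 1" "M y 1" ..
  let ?P = "M x 1 \<Otimes>\<^sub>M M y 1"
  fix N assume N: "N \<in> null_sets (M (x + y) 1)"
  have NC: "N \<in> sets (C (x + y))"
    using null_setsD2[OF N] compatibleD(2)[OF compat[OF add_NZ[OF x y] order_refl]] by simp
  have sep: "AE r in ?P. \<forall>p\<in>D x. \<forall>q\<in>D y. fst r p \<noteq> snd r q"
  proof (intro AE_finite_allI finite_D)
    fix p q assume p: "p \<in> D x" and q: "q \<in> D y"
    show "AE r in ?P. fst r p \<noteq> snd r q"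
    proof (rule P.AE_pair_measure)
      have cp: "(\<lambda>\<alpha>. \<alpha> p) \<in> measurable (M x 1) lam" "(\<lambda>\<alpha>. \<alpha> q) \<in> measurable (M y 1) lam"
        by (rule measurable_compatible[OF \<mu> measurable_C_component[OF p]],
            rule measurable_compatible[OF \<nu> measurable_C_component[OF q]])
      have [measurable]: "(\<lambda>r. map (fst r p) [0..<n]) \<in> measurable ?P (count_space UNIV)"
        "(\<lambda>r. map (snd r q) [0..<n]) \<in> measurable ?P (count_space UNIV)" for n
        using measurable_compose[OF measurable_compose[OF measurable_fst cp(1)] measurable_map_upt]
          measurable_compose[OF measurable_compose[OF measurable_snd cp(2)] measurable_map_upt] by auto
      have "c \<noteq> d \<longleftrightarrow> (\<exists>n. map c [0..<n] \<noteq> map d [0..<n])" for c d :: "nat \<Rightarrow> bool"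
      proof
        assume "c \<noteq> d"
        then obtain n where "c n \<noteq> d n" by blast
        then have "map c [0..<Suc n] \<noteq> map d [0..<Suc n]" by simp
        then show "\<exists>n. map c [0..<n] \<noteq> map d [0..<n]" by blast
      qed auto
      then have "{r \<in> space ?P. fst r p \<noteq> snd r q}
          = {r \<in> space ?P. \<exists>n. map (fst r p) [0..<n] \<noteq> map (snd r q) [0..<n]}" by blast
      also have "\<dots> \<in> sets ?P" by measurable
      finally show "{r \<in> space ?P. fst r p \<noteq> snd r q} \<in> sets ?P" .
      show "AE \<alpha> in M x 1. AE \<beta> in M y 1. fst (\<alpha>, \<beta>) p \<noteq> snd (\<alpha>, \<beta>) q"
      proof (rule AE_I2)
        fix \<alpha>
        show "AE \<beta> in M y 1. fst (\<alpha>, \<beta>) p \<noteq> snd (\<alpha>, \<beta>) q"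
          using compatible_avoids_point[OF \<nu> q, of "\<alpha> p"] by eventually_elim auto
      qed
    qed
  qed
  define level where "level n S = {\<beta> :: nat \<Rightarrow> bool. map \<beta> [0..<n] \<in> S}" for n S
  have level: "level n S \<in> sets lam" for n S
    using measurable_sets[OF measurable_map_upt, of S n] by (simp add: level_def vimage_def)
  have "AE r in ?P. merge_points x y \<iota> r \<notin> N" if \<iota>: "\<iota> \<in> injection_pairs x y" for \<iota>
  proof -
    have "AE r in ?P. \<forall>n. \<forall>S\<in>{S. finite S}. (\<forall>p\<in>D x. fst r p \<in> level n S) \<and> (\<forall>q\<in>D y. snd r q \<notin> level n S) \<longrightarrow>
       merge_points x y \<iota> r \<notin> N"
      unfolding AE_all_countable
      by (intro allI AE_ball_countable[THEN iffD2] ballI merged_boxes_avoid_null[OF x y level \<iota> N])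
         (auto intro: countable_Collect_finite)
    with sep show ?thesis
    proof eventually_elim
      case (elim r)
      obtain n where n: "\<forall>\<beta>\<in>fst r ` D x \<union> snd r ` D y. \<forall>\<beta>'\<in>fst r ` D x \<union> snd r ` D y.
          map \<beta> [0..<n] = map \<beta>' [0..<n] \<longrightarrow> \<beta> = \<beta>'"
        using eventually_happens'[OF sequentially_bot eventually_cell_separates[of "fst r ` D x \<union> snd r ` D y"]]
        by (meson finite_D finite_UnI finite_imageI)
      \<comment> \<open>The prefixes of the first point; by the choice of \<open>n\<close>, no
        coordinate of the second has one of them.\<close>
      define S where "S = (\<lambda>p. map (fst r p) [0..<n]) ` D x"
      have "finite S" by (simp add: S_def)
      moreover have "fst r p \<in> level n S" if "p \<in> D x" for p
        using that unfolding S_def level_def by blast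
      moreover have "snd r q \<notin> level n S" if q: "q \<in> D y" for q
      proof
        assume "snd r q \<in> level n S"
        then obtain p where p: "p \<in> D x" "map (snd r q) [0..<n] = map (fst r p) [0..<n]"
          unfolding S_def level_def by blast
        then have "snd r q = fst r p" using n q by blast
        then show False using elim(1) p(1) q by force
      qed
      ultimately show ?case using elim(2) by blast
    qed
  qed
  then show "N \<in> null_sets (tensor x y (M x 1) (M y 1))"
    by (simp add: tensor_null_iff[OF compatibleD(2)[OF \<mu>] compatibleD(2)[OF \<nu>] NC])
qed

text \<open>Each new factor costs two absolute continuities: \<open>tensor_mono\<close> passes to
  the spectral measures of the partial sum and of the new factor, and
  \<open>tensor_absolutely_continuous\<close> combines these two. Finiteness and the sets are
  carried along for \<open>tensor_mono\<close>.\<close>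

lemma tensor_upto_absolutely_continuous:
  assumes "n \<ge> 1" "\<And>i. i \<in> {1..n} \<Longrightarrow> l i \<in> {-1, 1}" "\<And>i. i \<in> {1..n} \<Longrightarrow> xs i \<in> NZ"
  defines "X \<equiv> \<lambda>i. dilate (l i) (xs i)" and "m \<equiv> \<lambda>i. dilate_measure (l i) (xs i) (M (xs i) 1)"
  shows "(\<Sum>i=1..n. X i) \<in> NZ \<and> sets (tensor_upto X m n) = sets (C (\<Sum>i=1..n. X i)) \<and>
    finite_measure (tensor_upto X m n) \<and> absolutely_continuous (M (\<Sum>i=1..n. X i) 1) (tensor_upto X m n)"
proof -
  have X: "X i \<in> NZ" and m: "sets (m i) = sets (C (X i))" "finite_measure (m i)"
      "absolutely_continuous (M (X i) 1) (m i)" if "i \<in> {1..n}" for i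
  proof -
    note li = assms(2)[OF that] and xi = assms(3)[OF that]
    show "X i \<in> NZ" unfolding X_def by (rule dilate_NZ[OF li xi])
    show "sets (m i) = sets (C (X i))" by (simp add: m_def X_def dilate_measure_def)
    have "dilate_point (l i) (xs i) \<in> measurable (M (xs i) 1) (C (X i))"
      unfolding X_def by (rule measurable_compatible[OF compat[OF xi order_refl] measurable_dilate_point[OF li]])
    then show "finite_measure (m i)"
      unfolding m_def dilate_measure_alt X_def
      by (rule finite_measure.finite_measure_distr[OF compatibleD(1)[OF compat[OF xi order_refl]]])
    show "absolutely_continuous (M (X i) 1) (m i)"
      unfolding m_def X_def by (rule dilate_absolutely_continuous[OF li xi])
  qed
  have "k \<ge> 1 \<Longrightarrow> k \<le> n \<Longrightarrow> (\<Sum>i=1..k. X i) \<in> NZ \<and> sets (tensor_upto X m k) = sets (C (\<Sum>i=1..k. X i)) \<and>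
    finite_measure (tensor_upto X m k) \<and> absolutely_continuous (M (\<Sum>i=1..k. X i) 1) (tensor_upto X m k)" for k
  proof (induction k)
    case (Suc k)
    show ?case
    proof (cases k)
      \<comment> \<open>One factor is the genuine base case; the empty product is excluded by
        \<open>k \<ge> 1\<close>.\<close>
      case 0
      then show ?thesis using X[of 1] m[of 1] Suc.prems by (simp add: One_nat_def)
    next
      case (Suc j)
      let ?s = "\<Sum>i=1..k. X i"
      have IH: "?s \<in> NZ" "sets (tensor_upto X m k) = sets (C ?s)" "finite_measure (tensor_upto X m k)"
        "absolutely_continuous (M ?s 1) (tensor_upto X m k)"
        using Suc.IH Suc.prems Suc by auto
      have mem: "Suc k \<in> {1..n}" using Suc.prems by simp
      have sum: "(\<Sum>i=1..Suc k. X i) = ?s + X (Suc k)" by simp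
      have T: "tensor_upto X m (Suc k) = tensor ?s (X (Suc k)) (tensor_upto X m k) (m (Suc k))"
        by (simp add: Suc)
      note \<mu> = compat[OF IH(1) order_refl] and \<nu> = compat[OF X[OF mem] order_refl]
      have "absolutely_continuous (tensor ?s (X (Suc k)) (M ?s 1) (M (X (Suc k)) 1))
          (tensor ?s (X (Suc k)) (tensor_upto X m k) (m (Suc k)))"
        by (rule tensor_mono[OF IH(2,3) m(1,2)[OF mem] compatibleD(2,1)[OF \<mu>] compatibleD(2,1)[OF \<nu>] IH(4) m(3)[OF mem]])
      then have "absolutely_continuous (M (?s + X (Suc k)) 1) (tensor ?s (X (Suc k)) (tensor_upto X m k) (m (Suc k)))"
        using tensor_absolutely_continuous[OF IH(1) X[OF mem]] unfolding absolutely_continuous_def by blast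
      then show ?thesis
        unfolding sum T using add_NZ[OF IH(1) X[OF mem]] finite_measure_tensor[OF IH(2,3) m(1,2)[OF mem]] by simp
    qed
  qed simp
  then show ?thesis using assms(1) by blast
qed

end

theorem theorem5p1:
  fixes \<gamma> :: "'a measure"
    and \<zeta> :: "L0_elem \<Rightarrow> ('a \<Rightarrow> 'a) set"
    and \<xi> :: "L0_elem \<Rightarrow> ('a \<Rightarrow> complex) set \<Rightarrow> ('a \<Rightarrow> complex) set"
    and \<mu> :: "exponents \<Rightarrow> point measure"
    and l :: "nat \<Rightarrow> int"
    and xs :: "nat \<Rightarrow> exponents"
    and x :: exponents
    and p :: nat
  assumes "standard_borel_space \<gamma>" and "prob_space \<gamma>" and "atomless \<gamma>"
    and "boolean_action \<gamma> \<zeta>" and "ergodic_action \<gamma> \<zeta>"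
    and "unitary_representation (L2 \<gamma>) \<xi>" and "\<xi> = koopman \<gamma> \<zeta>"
    and "associated_measures (L2 \<gamma>) \<xi> \<mu>"
    and "p \<ge> 1"
    and "\<forall>i\<in>{1..p}. l i \<in> {-1, 1}" and "\<forall>i\<in>{1..p}. xs i \<in> NZ" and "x \<in> NZ"
    and "(\<Sum>i=1..p. dilate (l i) (xs i)) = x"
  shows "absolutely_continuous (\<mu> x)
           (tensor_upto (\<lambda>i. dilate (l i) (xs i)) (\<lambda>i. dilate_measure (l i) (xs i) (\<mu> (xs i))) p)"
proof -
  obtain M where M: "associated_family (L2 \<gamma>) (koopman \<gamma> \<zeta>) M" and \<mu>: "\<And>w. w \<in> NZ \<Longrightarrow> \<mu> w = M w 1"
    using assms(7,8) unfolding associated_measures_def by blast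
  interpret associated_action \<gamma> \<zeta> M
    by (intro associated_action.intro ergodic_boolean_action.intro ergodic_boolean_action_axioms.intro
      associated_action_axioms.intro assms M)
  \<comment> \<open>The measures are identified with \<open>M w 1\<close> only for \<open>w\<close>
    in \<open>NZ\<close>, so the factors are exchanged just at the indices that occur.\<close>
  have upto_cong: "tensor_upto X m k = tensor_upto X m' k" if "\<And>i. i \<in> {1..k} \<Longrightarrow> m i = m' i" "k \<ge> 1" for X m m' k
    using that by (induction X m k rule: tensor_upto.induct) auto
  have "tensor_upto (\<lambda>i. dilate (l i) (xs i)) (\<lambda>i. dilate_measure (l i) (xs i) (\<mu> (xs i))) p
      = tensor_upto (\<lambda>i. dilate (l i) (xs i)) (\<lambda>i. dilate_measure (l i) (xs i) (M (xs i) 1)) p"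
    using assms(9,11) \<mu> by (intro upto_cong) auto
  moreover have "absolutely_continuous (M x 1)
      (tensor_upto (\<lambda>i. dilate (l i) (xs i)) (\<lambda>i. dilate_measure (l i) (xs i) (M (xs i) 1)) p)"
    using tensor_upto_absolutely_continuous[of p l xs] assms(9-11,13) by simp
  ultimately show ?thesis using \<mu>[OF assms(12)] by simp
qed

end
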